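(* In the setting described in the context (constants $a,b,c,d,e,r,p$, functions $\mathring P,N,E,C$, and the prefactor $E_n^0$), assume additionally that $C$ is uniformly bounded on $\partial D(0,n^{-e})$ as $n\to\infty$ and that $$c\ge\min\left(\tfrac32a+d,\ \tfrac32a+2d-e\right).$$ Suppose that $R:\mathbb C\setminus\Sigma\to\mathbb C^{m\times m}$ (depending on $n$) converges uniformly to $\mathbb I$ as $n\to\infty$, and that it can be written in the integral form $$R(z)=\mathbb I+\frac1{2\pi i}\int_\Sigma\frac{F_R(s)\Delta(s)}{s-z}\,ds,\qquad z\in\mathbb C\setminus\Sigma,$$ where (i) $\Sigma$ is an oriented ($n$-dependent) contour of the form $\Sigma=\partial D(0,n^{-a})\cup\Sigma_r\cup\partial D(0,r)\cup\Sigma_\infty$, where $\Sigma_r$ lies in $A(0;n^{-a},r)$ and $\Sigma_\infty$ lies in $A(0;r,\infty)$, both consist of a finite union of smooth curves, and the inversion $s\mapsto s^{-1}$ is bounded in $L^2(\Sigma_\infty)$ sense by some $n$-independent constant; (ii) $\Delta\in L^2(\Sigma)\cap L^\infty(\Sigma)$ satisfies, uniformly on the indicated curves as $n\to\infty$, $$\Delta(z)=\begin{cases}\mathcal O(n^{d-c}),& z\in\partial D(0,n^{-a}),\\ \mathcal O(n^{d-b}),& z\in\partial D(0,r),\\ \mathcal O(\exp(-\alpha n|z|^\beta)),& z\in\Sigma_r,\end{cases}$$ for some $\alpha>0$ and some $0<\beta<1/a$, and both $\|\Delta\|_{L^2(\Sigma)}\to0$ and $\|\Delta\|_{L^\infty(\Sigma)}\to0$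 as $n\to\infty$; (iii) $F_R=\mathbb I+X$, with $X\in L^2(\Sigma)$ and $\|X\|_{L^2(\Sigma)}\to0$ as $n\to\infty$. Let $\mathfrak c>0$ be a constant and put $x_n=\frac{x}{\mathfrak c n^b}$, $y_n=\frac{y}{\mathfrak c n^b}$. Then $$E_n^0(y_n)^{-1}R(y_n)^{-1}R(x_n)E_n^0(x_n)=\mathbb I+\mathcal O\left(n^{d-b}(x-y)\right)+\mathcal O\left(n^{e-b}(x-y)\right)$$ uniformly for $x,y$ in compact subsets of $\mathbb C$ (in particular of $\mathbb R$) as $n\to\infty$.
   Context: Conventions. $m$ is a fixed positive integer, $\mathbb I$ is the $m\times m$ identity matrix, $n=1,2,\ldots$ is a parameter on which all functions may depend (usually not indicated). $D(0,\rho)=\{|z|<\rho\}$, $A(0;r_1,r_2)=\{r_1<|z|<r_2\}$; overlines denote closures; circles are positively oriented. For matrix-valued quantities, $X=\mathcal O(g)$ as $n\to\infty$ means $\|X\|\le M|g|$ for all sufficiently large $n$, with $M$ independent of $n$; "uniformly" means $M$ and the threshold do not depend on the indicated variables. An $\mathcal O$-term inside a product stands for some matrix-valued function with that bound. "Non-singular" means invertible everywhere. A contour is a finite union of smooth curves intersecting in at most finitely many points. When $a=0$, the condition $\beta<1/a$ is void. Setting. $r>0$ (with $r>1$ if $a=0$) and $a,b,c,d,e\ge0$ satisfy $a\le e<b$, $d<\min(b,c)$ and $c>b-a$. $\mathring P,N$ are $m\times m$ matrix-valued functions defined in a neighborhood of $\overline{D(0,r)}$ (no regularity imposed, $N$ invertible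 where inverted), and $C,E$ are $m\times m$ functions in a neighborhood of $\overline{D(0,r)}$, such that uniformly for $z\in\partial D(0,n^{-a})$ as $n\to\infty$ $$\mathring P(z)N(z)^{-1}E(z)=\mathbb I+\frac{C(z)}{n^bz}+\mathcal O(n^{-c}).$$ (i) $C$ is meromorphic with only a possible pole at $0$ of order at most $p$ for all $n$ ($p$ a fixed non-negative integer), and is uniformly bounded on $\partial D(0,n^{-a})$ as $n\to\infty$. (ii) $E$ is non-singular and analytic, and uniformly for $z,w\in\partial D(0,n^{-a})$ as $n\to\infty$: $E(z)=\mathcal O(n^{d/2})$, $E(z)^{-1}=\mathcal O(n^{d/2})$, $E(z)^{-1}E(w)=\mathbb I+\mathcal O(n^e(z-w))$. Prefactor $E_n^0$. For a matrix-valued function $G$ meromorphic on $\overline{D(0,r)}$ with at most a pole at $0$, $G^-$ denotes the principal part of its Laurent series at $0$ (the terms with negative powers of $z$), $G^+=G-G^-$, and $$\pi G=-G^+G-GG^-+G^+G^-+G^+GG^-.$$ $\pi^j$ is the $j$-fold iterate ($\pi^0G=G$). Put $F(z)=\dfrac{E(z)C(z)E(z)^{-1}}{n^bz}$, and let $K$ be the biggest integer such that $2^K<\frac{a+c-e}{b-e}$. Then $$E_n^0(z)=\left(\mathbb I-(\pi^KF)^+(z)\right)\left(\mathbb I-(\pi^{K-1}F)^+(z)\right)\cdots\left(\mathbb I-F^+(z)\right)E(z),\qquad z\in\overline{D(0,n^{-a})},$$ which is invertible on this disc for $n$ large enough.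
   Formalization: The formal theorem additionally assumes that the total length of Σ_r is O(n^κ) for some constant κ; without a bound on this length the statement fails (exponentially many circles in Σ_r with tiny Δ on each). *)

theory Defs
  imports "HOL-Complex_Analysis.Complex_Analysis"
begin

section \<open>Uniform asymptotics and complex matrices\<close>

text \<open>\<open>X n z = O(g n z)\<close> as \<open>n \<rightarrow> \<infinity>\<close>, uniformly for \<open>z \<in> S n\<close>.\<close>

definition unif_bigo ::
  "(nat \<Rightarrow> 'i set) \<Rightarrow> (nat \<Rightarrow> 'i \<Rightarrow> 'v::real_normed_vector) \<Rightarrow> (nat \<Rightarrow> 'i \<Rightarrow> 'w::real_normed_vector) \<Rightarrow> bool"
  where "unif_bigo S X g \<longleftrightarrow> (\<exists>M. \<forall>\<^sub>F n in sequentially. \<forall>z\<in>S n. norm (X n z) \<le> M * norm (g n z))"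

definition cscale :: "complex \<Rightarrow> complex^'n^'m \<Rightarrow> complex^'n^'m"  (infixr \<open>*\<^sub>C\<close> 75)
  where "w *\<^sub>C A = (\<chi> i j. w * A $ i $ j)"

text \<open>\<open>G\<close> is analytic in a neighborhood of the closed disc of radius \<open>r\<close>, apart from a possible
  pole at the origin of order at most \<open>p\<close>.\<close>

definition pole_at_0_only :: "nat \<Rightarrow> real \<Rightarrow> (complex \<Rightarrow> complex^'n^'m) \<Rightarrow> bool"
  where "pole_at_0_only p r G \<longleftrightarrow> (\<forall>i j.
    (\<lambda>z. G z $ i $ j) meromorphic_on cball 0 r \<and>
    (\<lambda>z. G z $ i $ j) analytic_on cball 0 r - {0} \<and>
    - int p \<le> fls_subdegree (laurent_expansion (\<lambda>z. G z $ i $ j) 0))"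

section \<open>The prefactor\<close>

text \<open>\<open>fls_prpart\<close> collects the negative Laurent coefficients as a polynomial in \<open>1/z\<close> without
  constant term.\<close>

definition principal_part :: "(complex \<Rightarrow> complex^'n^'m) \<Rightarrow> complex \<Rightarrow> complex^'n^'m"
  where "principal_part G z =
    (\<chi> i j. poly (fls_prpart (laurent_expansion (\<lambda>w. G w $ i $ j) 0)) (inverse z))"

text \<open>\<open>G - G\<^sup>-\<close> has a removable singularity at the origin, and its value there is needed:
  \<open>remove_sings\<close> replaces the meaningless value \<open>G 0 - G\<^sup>- 0\<close> by the limit.\<close>

definition regular_part :: "(complex \<Rightarrow> complex^'n^'m) \<Rightarrow> complex \<Rightarrow> complex^'n^'m"
  where "regular_part G z =
    (\<chi> i j. remove_sings (\<lambda>w. (G w - principal_part G w) $ i $ j) z)"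

definition pi_op :: "(complex \<Rightarrow> complex^'m^'m) \<Rightarrow> complex \<Rightarrow> complex^'m^'m"
  where "pi_op G z =
    - (regular_part G z ** G z) - G z ** principal_part G z
    + regular_part G z ** principal_part G z
    + regular_part G z ** G z ** principal_part G z"

definition F_fun ::
  "real \<Rightarrow> (nat \<Rightarrow> complex \<Rightarrow> complex^'m^'m) \<Rightarrow> (nat \<Rightarrow> complex \<Rightarrow> complex^'m^'m)
    \<Rightarrow> nat \<Rightarrow> complex \<Rightarrow> complex^'m^'m"
  where "F_fun b E C n z =
    (1 / (of_real (real n powr b) * z)) *\<^sub>C (E n z ** C n z ** matrix_inv (E n z))"

text \<open>The biggest \<open>K\<close> with \<open>2\<^sup>K < (a + c - e) / (b - e)\<close>. In the setting \<open>c > b - a\<close> and \<open>e < b\<close>,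
  so the quotient exceeds 1 and the biggest integer is a natural number.\<close>

definition K_max :: "real \<Rightarrow> real \<Rightarrow> real \<Rightarrow> real \<Rightarrow> nat"
  where "K_max a b c e = (GREATEST k::nat. (2::real) ^ k < (a + c - e) / (b - e))"

text \<open>The product \<open>(\<I> - (\<pi>\<^sup>k G)\<^sup>+) \<cdots> (\<I> - G\<^sup>+)\<close>, with indices decreasing from left to right.\<close>

primrec pi_product :: "(complex \<Rightarrow> complex^'m^'m) \<Rightarrow> nat \<Rightarrow> complex \<Rightarrow> complex^'m^'m" where
  "pi_product G 0 z = mat 1 - regular_part G z"
| "pi_product G (Suc k) z = (mat 1 - regular_part ((pi_op ^^ Suc k) G) z) ** pi_product G k z"

definition E0 ::
  "real \<Rightarrow> real \<Rightarrow> real \<Rightarrow> real \<Rightarrow> (nat \<Rightarrow> complex \<Rightarrow> complex^'m^'m) \<Rightarrow> (nat \<Rightarrow> complex \<Rightarrow> complex^'m^'m)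
    \<Rightarrow> nat \<Rightarrow> complex \<Rightarrow> complex^'m^'m"
  where "E0 a b c e E C n z = pi_product (F_fun b E C n) (K_max a b c e) z ** E n z"

section \<open>Contours\<close>

text \<open>An oriented curve is a parametrization on an interval that may be open, half-open, closed
  or unbounded: contours may run to infinity, and their arcs may end on a curve that they do not
  meet. A closed curve is parametrized injectively on a half-open interval.
  Smooth means \<open>C\<^sup>1\<close> with nowhere vanishing derivative.\<close>

type_synonym curve = "real set \<times> (real \<Rightarrow> complex)"

definition smooth_curve :: "curve \<Rightarrow> bool"
  where "smooth_curve = (\<lambda>(J, \<gamma>). is_interval J \<and> interior J \<noteq> {} \<and> inj_on \<gamma> J \<and>
    (\<exists>\<gamma>'. continuous_on J \<gamma>' \<and>
      (\<forall>t\<in>J. (\<gamma> has_vector_derivative \<gamma>' t) (at t within J) \<and> \<gamma>' t \<noteq> 0)))"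

definition curve_trace :: "curve \<Rightarrow> complex set"
  where "curve_trace = (\<lambda>(J, \<gamma>). \<gamma> ` J)"

definition contour_trace :: "curve list \<Rightarrow> complex set"
  where "contour_trace \<Gamma> = (\<Union>\<kappa>\<in>set \<Gamma>. curve_trace \<kappa>)"

definition is_contour :: "curve list \<Rightarrow> bool"
  where "is_contour \<Gamma> \<longleftrightarrow> (\<forall>\<kappa>\<in>set \<Gamma>. smooth_curve \<kappa>) \<and>
    (\<forall>i<length \<Gamma>. \<forall>j<length \<Gamma>. i \<noteq> j \<longrightarrow> finite (curve_trace (\<Gamma> ! i) \<inter> curve_trace (\<Gamma> ! j)))"

definition circle_curve :: "real \<Rightarrow> curve"
  where "circle_curve \<rho> = ({0..<1}, circlepath 0 \<rho>)"

definition contour_int :: "curve list \<Rightarrow> (complex \<Rightarrow> complex^'n^'m) \<Rightarrow> complex^'n^'m"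
  where "contour_int \<Gamma> g = (\<Sum>(J, \<gamma>)\<leftarrow>\<Gamma>.
    (LINT t:J|lebesgue. vector_derivative \<gamma> (at t within J) *\<^sub>C g (\<gamma> t)))"

text \<open>\<open>L\<^sup>2\<close> and \<open>L\<^sup>\<infinity>\<close> bounds do not control the \<open>L\<^sup>1\<close> norm on a curve whose length is not controlled, and an
  \<open>n\<close>-dependent contour inside an annulus can have any length. So the length of \<open>\<Sigma>\<^sub>r\<close> has to be
  restricted, as the integrability of \<open>s\<^sup>-\<^sup>2\<close> restricts \<open>\<Sigma>\<^sub>\<infinity>\<close>.\<close>

definition contour_length :: "curve list \<Rightarrow> ennreal"
  where "contour_length \<Gamma> = (\<Sum>(J, \<gamma>)\<leftarrow>\<Gamma>.
    (\<integral>\<^sup>+t\<in>J. ennreal (norm (vector_derivative \<gamma> (at t within J))) \<partial>lebesgue))"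

text \<open>\<open>L\<^sup>2\<close> and \<open>L\<^sup>\<infinity>\<close> with respect to arc length. Since the parametrizations have nowhere vanishing
  derivative, null sets for arc length are null sets of the parameter.\<close>

definition contour_L2 :: "curve list \<Rightarrow> (complex \<Rightarrow> 'v::euclidean_space) \<Rightarrow> bool"
  where "contour_L2 \<Gamma> f \<longleftrightarrow> (\<forall>(J, \<gamma>)\<in>set \<Gamma>.
    set_borel_measurable lebesgue J (\<lambda>t. f (\<gamma> t)) \<and>
    set_integrable lebesgue J (\<lambda>t. (norm (f (\<gamma> t)))\<^sup>2 * norm (vector_derivative \<gamma> (at t within J))))"

definition contour_L2norm :: "curve list \<Rightarrow> (complex \<Rightarrow> 'v::euclidean_space) \<Rightarrow> real"
  where "contour_L2norm \<Gamma> f = sqrt (\<Sum>(J, \<gamma>)\<leftarrow>\<Gamma>.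
    (LINT t:J|lebesgue. (norm (f (\<gamma> t)))\<^sup>2 * norm (vector_derivative \<gamma> (at t within J))))"

definition ess_bound :: "curve list \<Rightarrow> (complex \<Rightarrow> 'v::euclidean_space) \<Rightarrow> real \<Rightarrow> bool"
  where "ess_bound \<Gamma> f B \<longleftrightarrow> 0 \<le> B \<and>
    (\<forall>(J, \<gamma>)\<in>set \<Gamma>. AE t in lebesgue. t \<in> J \<longrightarrow> norm (f (\<gamma> t)) \<le> B)"

definition contour_Linf :: "curve list \<Rightarrow> (complex \<Rightarrow> 'v::euclidean_space) \<Rightarrow> bool"
  where "contour_Linf \<Gamma> f \<longleftrightarrow>
    (\<forall>(J, \<gamma>)\<in>set \<Gamma>. set_borel_measurable lebesgue J (\<lambda>t. f (\<gamma> t))) \<and> (\<exists>B. ess_bound \<Gamma> f B)"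

definition contour_Linfnorm :: "curve list \<Rightarrow> (complex \<Rightarrow> 'v::euclidean_space) \<Rightarrow> real"
  where "contour_Linfnorm \<Gamma> f = Inf {B. ess_bound \<Gamma> f B}"

end

theory Submission
  imports Defs "HOL-Real_Asymp.Real_Asymp"
begin

text \<open>Let \<open>T z\<close> be the conjugate by \<open>A = E 0\<close> of the product of the factors \<open>\<I> - (\<pi>\<^sup>k F)\<^sup>+\<close>, so that the
  prefactor is \<open>A T A\<inverse> E\<close>. By the maximum principle \<open>E(z)\<inverse> E(w) - \<I> = O(n\<^sup>e (z - w))\<close> holds on the whole disc
  of radius \<open>n powr - a\<close>. Hence \<open>A\<inverse> E\<close> and its inverse are bounded on the circle of radius \<open>\<rho> = n powr - e\<close>,
  and \<open>F\<close> conjugated by \<open>A\<close> is of size \<open>\<epsilon> = n powr (e - b)\<close> there. As the pole orders are bounded, taking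
  principal and regular parts costs only a constant factor on that circle, so all conjugated iterates
  of \<open>\<pi>\<close> are \<open>O(\<epsilon>)\<close> there. Consequently \<open>T - \<I>\<close> is \<open>O(\<epsilon>)\<close> on the disc and has Lipschitz constant \<open>O(\<epsilon> / \<rho>)\<close>
  on half of it. This works for any number of factors; the choice of \<open>K\<close> plays no role.

  By the integral representation, \<open>R(x) - R(y)\<close> is \<open>x - y\<close> times an integral of
  \<open>F\<^sub>R(s) \<Delta>(s) / ((s - x) (s - y))\<close>, which is bounded up to a contribution \<open>n powr (3 a / 2 + d - c)\<close> of the
  smallest circle. Conjugation by the prefactor costs a factor \<open>n\<^sup>d\<close>, and the lower bound on \<open>c\<close> is what makes
  the result \<open>O(n\<^sup>d + n\<^sup>e)\<close> times \<open>x - y\<close>.\<close>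

section \<open>Complex matrices and the maximum principle\<close>

text \<open>The data bound \<open>E\<close> and its inverse only by n^(d/2), so a direct estimate of
  \<open>F\<close> on the circle of radius n^(-e) gives n^(d+e-b), which need not tend to 0. Only
  the quotients E(z)^-1 E(w) are well behaved. Conjugation by the constant matrix E(0) brings them
  in: it commutes with products and with taking Laurent parts, hence with the whole recursion behind
  the prefactor. The radius n^(-e) is the largest scale on which the Lipschitz bound keeps these
  quotients bounded, and the points x_n, of size n^(-b) with b > e, lie deep inside.

  In the final quotient the matrices E(0) and E(0)^-1 are absorbed into such quotients in every term
  except the one containing R(x_n) - R(y_n).

  The exponent 3a/2 is 2a - a/2: on the circle of radius n^(-a) the kernel has order n^(2a), while
  the L2 norm of the constant 1, of order n^(-a/2), is what Cauchy-Schwarz pairs with the bounded L2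
  norm of \<open>X\<close>.\<close>

no_notation fps_nth (infixl \<open>$\<close> 75)

section \<open>The Frobenius norm and matrix algebra\<close>

text \<open>The norm of nested vectors is the Frobenius norm, so Cauchy-Schwarz in each entry gives
  submultiplicativity. The identity then has norm sqrt m instead of 1, which is why the constant
  \<open>one\<close> appears in later bounds.\<close>

lemma norm_matrix_mult_le:
  fixes A :: "complex^'n^'m" and B :: "complex^'k^'n"
  shows "norm (A ** B) \<le> norm A * norm B"
proof -
  have sq: "(norm M)\<^sup>2 = (\<Sum>i\<in>UNIV. \<Sum>j\<in>UNIV. (norm (M $ i $ j))\<^sup>2)" for M :: "complex^'x^'y"
    by (simp add: norm_vec_def L2_set_def sum_nonneg)
  have entry: "(norm ((A ** B) $ i $ j))\<^sup>2
      \<le> (\<Sum>k\<in>UNIV. (norm (A $ i $ k))\<^sup>2) * (\<Sum>k\<in>UNIV. (norm (B $ k $ j))\<^sup>2)" for i j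
  proof -
    have "norm ((A ** B) $ i $ j) \<le> (\<Sum>k\<in>UNIV. norm (A $ i $ k) * norm (B $ k $ j))"
      unfolding matrix_matrix_mult_def by (simp add: sum_norm_le norm_mult)
    then have "(norm ((A ** B) $ i $ j))\<^sup>2 \<le> (\<Sum>k\<in>UNIV. norm (A $ i $ k) * norm (B $ k $ j))\<^sup>2"
      by (rule power_mono) simp
    also have "\<dots> \<le> (\<Sum>k\<in>UNIV. (norm (A $ i $ k))\<^sup>2) * (\<Sum>k\<in>UNIV. (norm (B $ k $ j))\<^sup>2)"
      by (rule Cauchy_Schwarz_ineq_sum)
    finally show ?thesis .
  qed
  have "(norm (A ** B))\<^sup>2 \<le> (\<Sum>i\<in>UNIV. \<Sum>j\<in>UNIV.
      (\<Sum>k\<in>UNIV. (norm (A $ i $ k))\<^sup>2) * (\<Sum>k\<in>UNIV. (norm (B $ k $ j))\<^sup>2))"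
    unfolding sq by (intro sum_mono entry)
  also have "\<dots> = (\<Sum>i\<in>UNIV. \<Sum>k\<in>UNIV. (norm (A $ i $ k))\<^sup>2) * (\<Sum>j\<in>UNIV. \<Sum>k\<in>UNIV. (norm (B $ k $ j))\<^sup>2)"
    by (simp add: sum_product)
  also have "(\<Sum>j\<in>UNIV. \<Sum>k\<in>UNIV. (norm (B $ k $ j))\<^sup>2) = (norm B)\<^sup>2"
    unfolding sq by (rule sum.swap)
  also have "(\<Sum>i\<in>UNIV. \<Sum>k\<in>UNIV. (norm (A $ i $ k))\<^sup>2) = (norm A)\<^sup>2"
    unfolding sq ..
  finally have "(norm (A ** B))\<^sup>2 \<le> (norm A * norm B)\<^sup>2"
    by (simp only: power_mult_distrib)
  then show ?thesis
    by (rule power2_le_imp_le) simp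
qed

lemma norm_matrix_mult_mono:
  fixes A :: "complex^'n^'m" and B :: "complex^'k^'n"
  assumes "norm A \<le> x" "norm B \<le> y"
  shows "norm (A ** B) \<le> x * y"
  by (rule order_trans[OF norm_matrix_mult_le]) (use assms order_trans[OF norm_ge_zero] in \<open>auto intro!: mult_mono\<close>)

lemma matrix_add_mult_distrib: "(A + B) ** C = A ** C + B ** (C :: complex^'k^'n)"
  and matrix_mult_add_distrib: "D ** (C + C') = D ** C + D ** (C' :: complex^'k^'n)"
  and matrix_diff_mult_distrib: "(A - B) ** C = A ** C - B ** (C :: complex^'k^'n)"
  and matrix_mult_diff_distrib: "D ** (C - C') = D ** C - D ** (C' :: complex^'k^'n)"
  and matrix_minus_mult: "(- A) ** C = - (A ** (C :: complex^'k^'n))"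
  and matrix_mult_minus: "A ** (- C) = - (A ** (C :: complex^'k^'n))"
  for A B D :: "complex^'n^'m"
  by (simp_all add: matrix_matrix_mult_def vec_eq_iff algebra_simps sum.distrib sum_subtractf sum_negf)

lemmas matrix_distribs = matrix_add_mult_distrib matrix_mult_add_distrib
  matrix_diff_mult_distrib matrix_mult_diff_distrib matrix_minus_mult matrix_mult_minus

text \<open>Supplies the continuity of the product, from which the measurability of matrix-valued
  integrands is derived.\<close>

lemma bounded_bilinear_matrix_mult:
  "bounded_bilinear ((**) :: complex^'n^'m \<Rightarrow> complex^'k^'n \<Rightarrow> complex^'k^'m)"
proof
  fix A A' :: "complex^'n^'m" and B B' :: "complex^'k^'n" and t :: real
  show "(t *\<^sub>R A) ** B = t *\<^sub>R (A ** B)" "A ** (t *\<^sub>R B) = t *\<^sub>R (A ** B)"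
    by (simp_all add: matrix_matrix_mult_def vec_eq_iff scaleR_sum_right)
  show "\<exists>K. \<forall>(a :: complex^'n^'m) (b :: complex^'k^'n). norm (a ** b) \<le> norm a * norm b * K"
    by (rule exI[of _ 1]) (simp add: norm_matrix_mult_le)
qed (simp_all add: matrix_distribs)

lemma cscale_entry [simp]: "(w *\<^sub>C A) $ i $ j = w * A $ i $ j"
  by (simp add: cscale_def)

lemma norm_cscale: "norm (w *\<^sub>C A) = norm w * norm A"
proof -
  have row: "norm ((w *\<^sub>C A) $ i) = norm w * norm (A $ i)" for i
    unfolding norm_vec_def by (simp add: L2_set_right_distrib norm_mult)
  show ?thesis
    unfolding norm_vec_def[of "w *\<^sub>C A"] norm_vec_def[of A] by (simp add: row L2_set_right_distrib)
qed

lemma cscale_matrix_mult: "(w *\<^sub>C A) ** B = w *\<^sub>C (A ** B)"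
  and matrix_mult_cscale: "A ** (w *\<^sub>C B) = w *\<^sub>C (A ** B)"
  by (simp_all add: matrix_matrix_mult_def vec_eq_iff sum_distrib_left algebra_simps)

lemma cscale_algebra:
  "w *\<^sub>C (A + B) = w *\<^sub>C A + w *\<^sub>C B" "w *\<^sub>C (A - B) = w *\<^sub>C A - w *\<^sub>C B"
  "(w + v) *\<^sub>C A = w *\<^sub>C A + v *\<^sub>C A" "(w - v) *\<^sub>C A = w *\<^sub>C A - v *\<^sub>C A"
  "w *\<^sub>C v *\<^sub>C A = (w * v) *\<^sub>C A" "w *\<^sub>C (- A) = - (w *\<^sub>C A)"
  by (simp_all add: vec_eq_iff algebra_simps)

lemma bounded_bilinear_cscale: "bounded_bilinear ((*\<^sub>C) :: complex \<Rightarrow> complex^'n^'m \<Rightarrow> complex^'n^'m)"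
proof
  fix w w' :: complex and A A' :: "complex^'n^'m" and t :: real
  show "(t *\<^sub>R w) *\<^sub>C A = t *\<^sub>R w *\<^sub>C A" "w *\<^sub>C (t *\<^sub>R A) = t *\<^sub>R w *\<^sub>C A"
    by (simp_all add: vec_eq_iff)
  show "\<exists>K. \<forall>w (A :: complex^'n^'m). norm (w *\<^sub>C A) \<le> norm w * norm A * K"
    by (rule exI[of _ 1]) (simp add: norm_cscale)
qed (simp_all add: cscale_algebra)

lemma norm_entry_le: "norm (A $ i $ j) \<le> norm (A :: complex^'n^'m)"
  by (meson Finite_Cartesian_Product.norm_nth_le order_trans)

text \<open>Lets scalar complex analysis be applied to each entry, at the cost of a factor that
  depends only on the dimensions and not on n.\<close>

lemma norm_le_entries:
  fixes A :: "complex^'n^'m"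
  assumes "\<And>i j. norm (A $ i $ j) \<le> B"
  shows "norm A \<le> real CARD('m) * real CARD('n) * B"
proof -
  have "norm A \<le> (\<Sum>i\<in>UNIV. norm (A $ i))"
    unfolding norm_vec_def[of A] by (rule L2_set_le_sum) simp
  also have "\<dots> \<le> (\<Sum>i\<in>(UNIV::'m set). \<Sum>j\<in>(UNIV::'n set). norm (A $ i $ j))"
    unfolding norm_vec_def[where 'a = complex and 'b='n] by (intro sum_mono L2_set_le_sum) simp
  also have "\<dots> \<le> (\<Sum>i\<in>(UNIV::'m set). \<Sum>j\<in>(UNIV::'n set). B)"
    by (intro sum_mono assms)
  finally show ?thesis by simp
qed

lemma matrix_inv_mult:
  fixes A :: "complex^'m^'m"
  assumes "invertible A"
  shows "A ** matrix_inv A = mat 1" "matrix_inv A ** A = mat 1"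
  using someI_ex[OF assms[unfolded invertible_def]] by (simp_all add: matrix_inv_def)

lemma matrix_inv_unique:
  fixes A B :: "complex^'m^'m"
  assumes "B ** A = mat 1"
  shows "matrix_inv A = B"
proof -
  have "invertible A" using assms invertible_left_inverse by blast
  then have "B ** (A ** matrix_inv A) = B" by (simp add: matrix_inv_mult)
  then show ?thesis using assms by (simp add: matrix_mul_assoc)
qed

text \<open>Left-associated products are the normal form under \<open>matrix_mul_assoc\<close>;
  there an adjacent inverse pair is not a subterm, and this shape still cancels it.\<close>

lemma matrix_cancel:
  fixes A B X :: "complex^'m^'m"
  assumes "A ** B = mat 1"
  shows "X ** A ** B = X"
  using assms by (simp add: matrix_mul_assoc[symmetric])

text \<open>If B v = 0, then v = -(B - I) v has at most half its own norm, so the kernel is trivial.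
  The bound on the inverse comes from B^-1 = I - (B - I) B^-1 by absorbing the last term.\<close>

lemma invertible_near_identity:
  fixes B :: "complex^'m^'m"
  assumes "norm (B - mat 1) \<le> 1 / 2"
  shows "invertible B" and "norm (matrix_inv B) \<le> 2 * norm (mat 1 :: complex^'m^'m)"
proof -
  show inv: "invertible B"
  proof -
    have "v = 0" if v: "B *v v = 0" for v
    proof -
      \<comment> \<open>Every column of \<open>W\<close> is \<open>v\<close>, so that the
        submultiplicative matrix norm applies to the vector as well.\<close>
      define W :: "complex^'m^'m" where "W = (\<chi> i j. v $ i)"
      have "B ** W = 0"
        using v by (simp add: vec_eq_iff W_def matrix_matrix_mult_def matrix_vector_mult_def)
      then have "W = - ((B - mat 1) ** W)" by (simp add: matrix_distribs)
      then have "norm W = norm ((B - mat 1) ** W)" by (metis norm_minus_cancel)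
      also have "\<dots> \<le> norm (B - mat 1) * norm W" by (rule norm_matrix_mult_le)
      also have "\<dots> \<le> 1 / 2 * norm W" using assms by (intro mult_right_mono) auto
      finally have "W = 0" by simp
      then show "v = 0" by (simp add: vec_eq_iff W_def)
    qed
    then show ?thesis
      using invertible_left_inverse matrix_left_invertible_ker by blast
  qed
  have "matrix_inv B = mat 1 - (B - mat 1) ** matrix_inv B"
    using matrix_inv_mult[OF inv] by (simp add: matrix_distribs)
  then have "norm (matrix_inv B) = norm (mat 1 - (B - mat 1) ** matrix_inv B)"
    by (rule arg_cong)
  also have "\<dots> \<le> norm (mat 1 :: complex^'m^'m) + norm ((B - mat 1) ** matrix_inv B)"
    by (rule norm_triangle_ineq4)
  also have "norm ((B - mat 1) ** matrix_inv B) \<le> norm (B - mat 1) * norm (matrix_inv B)"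
    by (rule norm_matrix_mult_le)
  also have "norm (B - mat 1) * norm (matrix_inv B) \<le> 1 / 2 * norm (matrix_inv B)"
    using assms by (intro mult_right_mono) auto
  finally show "norm (matrix_inv B) \<le> 2 * norm (mat 1 :: complex^'m^'m)" by simp
qed

section \<open>Matrix-valued holomorphic functions and the maximum principle\<close>

definition mat_holomorphic :: "(complex \<Rightarrow> complex^'n^'m) \<Rightarrow> complex set \<Rightarrow> bool"  (infix \<open>mat'_holomorphic'_on\<close> 50)
  where "G mat_holomorphic_on S \<longleftrightarrow> (\<forall>i j. (\<lambda>z. G z $ i $ j) holomorphic_on S)"

lemma mat_holomorphic_const: "(\<lambda>z. A) mat_holomorphic_on S"
  and mat_holomorphic_add: "G mat_holomorphic_on S \<Longrightarrow> H mat_holomorphic_on S \<Longrightarrow> (\<lambda>z. G z + H z) mat_holomorphic_on S"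
  and mat_holomorphic_diff: "G mat_holomorphic_on S \<Longrightarrow> H mat_holomorphic_on S \<Longrightarrow> (\<lambda>z. G z - H z) mat_holomorphic_on S"
  and mat_holomorphic_minus: "G mat_holomorphic_on S \<Longrightarrow> (\<lambda>z. - G z) mat_holomorphic_on S"
  and mat_holomorphic_cscale: "g holomorphic_on S \<Longrightarrow> H mat_holomorphic_on S \<Longrightarrow> (\<lambda>z. g z *\<^sub>C H z) mat_holomorphic_on S"
  and mat_holomorphic_mult: "G mat_holomorphic_on S \<Longrightarrow> H' mat_holomorphic_on S \<Longrightarrow> (\<lambda>z. G z ** H' z) mat_holomorphic_on S"
  for G H :: "complex \<Rightarrow> complex^'n^'m" and H' :: "complex \<Rightarrow> complex^'k^'n"
  by (auto simp: mat_holomorphic_def matrix_matrix_mult_def intro!: holomorphic_intros)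

lemmas mat_holomorphic_intros = mat_holomorphic_const mat_holomorphic_add mat_holomorphic_diff
  mat_holomorphic_minus mat_holomorphic_cscale mat_holomorphic_mult

text \<open>Cramer's rule: the entry (i, j) of the inverse solves a linear system with right-hand
  side the j-th unit vector, so it is a quotient of two determinants, each polynomial in holomorphic
  entries.\<close>

lemma mat_holomorphic_inv:
  fixes G :: "complex \<Rightarrow> complex^'m^'m"
  assumes G: "G mat_holomorphic_on S" and inv: "\<And>z. z \<in> S \<Longrightarrow> invertible (G z)"
  shows "(\<lambda>z. matrix_inv (G z)) mat_holomorphic_on S"
  unfolding mat_holomorphic_def
proof (intro allI)
  fix i j
  have det: "(\<lambda>z. det (H z)) holomorphic_on S" if "H mat_holomorphic_on S" for H :: "complex \<Rightarrow> complex^'m^'m"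
    unfolding det_def using that by (auto simp: mat_holomorphic_def intro!: holomorphic_intros)
  define b :: "complex^'m" where "b = axis j 1"
  let ?D = "\<lambda>z. \<chi> k l. if l = i then b $ k else G z $ k $ l"
  have eq: "matrix_inv (G z) $ i $ j = det (?D z) / det (G z)" if z: "z \<in> S" for z
  proof -
    let ?x = "matrix_inv (G z) *v b"
    have "G z *v ?x = b"
      by (simp add: matrix_vector_mul_assoc matrix_inv_mult inv z)
    then have "?x = (\<chi> k. det (\<chi> k' l. if l = k then b $ k' else G z $ k' $ l) / det (G z))"
      using cramer[of "G z" ?x b] inv[OF z] by (simp add: invertible_det_nz)
    then have "?x $ i = det (?D z) / det (G z)" by simp
    also have "?x $ i = matrix_inv (G z) $ i $ j"
      by (simp add: b_def matrix_vector_mult_def axis_def if_distrib cong: if_cong)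
    finally show ?thesis .
  qed
  have "?D mat_holomorphic_on S"
    unfolding mat_holomorphic_def
  proof (intro allI)
    fix k l
    show "(\<lambda>z. ?D z $ k $ l) holomorphic_on S"
      using G by (cases "l = i") (auto simp: mat_holomorphic_def)
  qed
  then have "(\<lambda>z. det (?D z) / det (G z)) holomorphic_on S"
    using inv invertible_det_nz by (intro holomorphic_on_divide det G) auto
  then show "(\<lambda>z. matrix_inv (G z) $ i $ j) holomorphic_on S"
    by (rule holomorphic_transform) (simp add: eq)
qed

lemma max_modulus_ball:
  assumes f: "f holomorphic_on ball 0 r" and \<rho>: "0 < \<rho>" "\<rho> < r"
    and M: "\<And>z. z \<in> sphere 0 \<rho> \<Longrightarrow> norm (f z) \<le> M" and z: "z \<in> cball 0 \<rho>"
  shows "norm (f z) \<le> M"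
proof (rule maximum_modulus_frontier[where S = "cball 0 \<rho>" and f = f])
  show "f holomorphic_on interior (cball 0 \<rho>)" "continuous_on (closure (cball 0 \<rho>)) f"
    using \<rho> by (auto intro!: holomorphic_on_imp_continuous_on intro: holomorphic_on_subset[OF f])
qed (use M z in auto)

text \<open>A Schwarz lemma: since f vanishes at w, the quotient f(z) / (z - w) has a removable
  singularity, and the maximum principle applies to it.\<close>

lemma max_modulus_difference_quotient:
  assumes f: "f holomorphic_on ball 0 r" and \<rho>: "0 < \<rho>" "\<rho> < r"
    and w: "w \<in> cball 0 \<rho>" "f w = 0"
    and M: "\<And>z. z \<in> sphere 0 \<rho> \<Longrightarrow> norm (f z) \<le> M * norm (z - w)" and z: "z \<in> cball 0 \<rho>"
  shows "norm (f z) \<le> M * norm (z - w)"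
proof -
  define q where "q = (\<lambda>z. if z = w then deriv f w else (f z - f w) / (z - w))"
  have q: "q holomorphic_on ball 0 r"
    unfolding q_def by (rule pole_lemma_open[OF f]) simp
  have off: "norm (q z) \<le> M" if "z \<in> sphere 0 \<rho>" "z \<noteq> w" for z
    using M[OF that(1)] that w by (simp add: q_def norm_divide divide_le_eq)
  have sph: "norm (q z) \<le> M" if zs: "z \<in> sphere 0 \<rho>" for z
  \<comment> \<open>The point \<open>w\<close> may lie on the circle. There the hypothesis only says
    0 \<le> 0, so the bound on the quotient at \<open>w\<close> is obtained by continuity from the
    other points of the circle, of which \<open>w\<close> is a limit.\<close>
  proof (cases "z = w")
    case True
    have "connected (sphere (0::complex) \<rho>)" by (rule connected_sphere) simp
    moreover have "sphere (0::complex) \<rho> \<noteq> {x}" for x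
    proof
      assume "sphere 0 \<rho> = {x}"
      moreover have "of_real \<rho> \<in> sphere (0::complex) \<rho>" "- of_real \<rho> \<in> sphere (0::complex) \<rho>"
        using \<rho> by auto
      ultimately have "of_real \<rho> = - (of_real \<rho> :: complex)" by (metis singletonD)
      then show False using \<rho> by (simp add: complex_eq_iff)
    qed
    ultimately have lim: "at z within sphere 0 \<rho> \<noteq> bot"
      using connected_imp_perfect[OF _ zs] trivial_limit_within by blast
    have "continuous_on (ball 0 r) q" using q by (rule holomorphic_on_imp_continuous_on)
    then have "isCont q z"
      using zs \<rho> by (simp add: continuous_on_eq_continuous_at)
    then have "((\<lambda>z. norm (q z)) \<longlongrightarrow> norm (q z)) (at z within sphere 0 \<rho>)"
      by (intro tendsto_norm) (auto simp: isCont_def intro: tendsto_within_subset)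
    then show ?thesis
      by (rule tendsto_upperbound[OF _ _ lim]) (auto simp: eventually_at_filter off True)
  qed (use off zs in auto)
  have "norm (q z) \<le> M"
    using max_modulus_ball[OF q \<rho> sph z] by simp
  then show ?thesis
    using w(2) by (cases "z = w") (auto simp: q_def norm_divide divide_le_eq)
qed

lemma mat_max_modulus_ball:
  fixes G :: "complex \<Rightarrow> complex^'n^'m"
  assumes "G mat_holomorphic_on ball 0 r" "0 < \<rho>" "\<rho> < r"
    and M: "\<And>z. z \<in> sphere 0 \<rho> \<Longrightarrow> norm (G z) \<le> M" and "z \<in> cball 0 \<rho>"
  shows "norm (G z) \<le> real CARD('m) * real CARD('n) * M"
proof (rule norm_le_entries)
  fix i j
  show "norm (G z $ i $ j) \<le> M"
    by (rule max_modulus_ball[where r = r and \<rho> = \<rho>])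
       (use assms order_trans[OF norm_entry_le M] in \<open>auto simp: mat_holomorphic_def\<close>)
qed

lemma mat_max_modulus_difference_quotient:
  fixes G :: "complex \<Rightarrow> complex^'n^'m"
  assumes "G mat_holomorphic_on ball 0 r" "0 < \<rho>" "\<rho> < r" "w \<in> cball 0 \<rho>" "G w = 0"
    and M: "\<And>z. z \<in> sphere 0 \<rho> \<Longrightarrow> norm (G z) \<le> M * norm (z - w)" and "z \<in> cball 0 \<rho>"
  shows "norm (G z) \<le> real CARD('m) * real CARD('n) * (M * norm (z - w))"
proof (rule norm_le_entries)
  fix i j
  show "norm (G z $ i $ j) \<le> M * norm (z - w)"
    by (rule max_modulus_difference_quotient[where r = r and \<rho> = \<rho>])
       (use assms order_trans[OF norm_entry_le M] in \<open>auto simp: mat_holomorphic_def\<close>)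
qed

text \<open>On the circle the difference G(u) - G(w) is at most 2 M while u has distance at least
  \<rho> / 2 from w; their quotient 4 M / \<rho> is carried inside by the maximum principle. This is
  why w is confined to the half disc.\<close>

lemma mat_holomorphic_lipschitz:
  fixes G :: "complex \<Rightarrow> complex^'n^'m"
  assumes G: "G mat_holomorphic_on ball 0 r" and \<rho>: "0 < \<rho>" "\<rho> < r"
    and M: "\<And>z. z \<in> cball 0 \<rho> \<Longrightarrow> norm (G z) \<le> M" and w: "w \<in> cball 0 (\<rho> / 2)" and z: "z \<in> cball 0 \<rho>"
  shows "norm (G z - G w) \<le> real CARD('m) * real CARD('n) * (4 * M / \<rho> * norm (z - w))"
proof (rule mat_max_modulus_difference_quotient[OF _ \<rho>, where G = "\<lambda>z. G z - G w"])
  show "(\<lambda>z. G z - G w) mat_holomorphic_on ball 0 r"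
    by (intro mat_holomorphic_intros G)
  fix u assume u: "u \<in> sphere (0::complex) \<rho>"
  have "norm u \<le> norm (u - w) + norm w" by norm
  then have d: "1 \<le> 2 / \<rho> * norm (u - w)" using u w \<rho> by (simp add: field_simps)
  have M0: "0 \<le> M" using M[OF z] norm_ge_zero order_trans by blast
  have "norm (G u - G w) \<le> M + M"
    by (rule order_trans[OF norm_triangle_ineq4 add_mono]) (use M u w \<rho> in auto)
  also have "\<dots> \<le> 4 * M / \<rho> * norm (u - w)"
    using mult_left_mono[OF d, of "2 * M"] M0 by (simp add: field_simps)
  finally show "norm (G u - G w) \<le> 4 * M / \<rho> * norm (u - w)" .
qed (use w z \<rho> in auto)

section \<open>Laurent splittings\<close>

text \<open>Induction on the pole order: H(0) / z^(q+1) goes into the principal part, and (H - H(0))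
  / z takes the place of H. As H(0) obeys the same bound as H on the circle, each step at most
  doubles the constant, whence 2^q. This constant does not involve the radius, so it is uniform on
  shrinking circles as long as q is fixed.\<close>

lemma laurent_split_bound:
  assumes "H holomorphic_on ball 0 r" and \<rho>: "0 < \<rho>" "\<rho> < r"
    and "\<And>z. z \<in> sphere 0 \<rho> \<Longrightarrow> norm (H z) \<le> M * \<rho> ^ q"
  shows "\<exists>pl h. coeff pl 0 = 0 \<and> h holomorphic_on ball 0 r \<and>
    (\<forall>z\<in>ball 0 r - {0}. H z / z ^ q = poly pl (inverse z) + h z) \<and>
    (\<forall>z\<in>cball 0 \<rho>. norm (h z) \<le> 2 ^ q * M)"
  using assms(1,4)
proof (induction q arbitrary: H M)
  case 0
  have "norm (H z) \<le> M" if "z \<in> cball 0 \<rho>" for z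
    by (rule max_modulus_ball[OF 0(1) \<rho> _ that]) (use 0(2) in auto)
  then show ?case
    using 0(1) by (intro exI[of _ 0] exI[of _ H]) auto
next
  case (Suc q)
  define H1 where "H1 = (\<lambda>z. if z = 0 then deriv H 0 else (H z - H 0) / (z - 0))"
  have H1: "H1 holomorphic_on ball 0 r"
    unfolding H1_def by (rule pole_lemma_open[OF Suc.prems(1)]) simp
  have H0: "norm (H 0) \<le> M * \<rho> ^ Suc q"
    by (rule max_modulus_ball[OF Suc.prems(1) \<rho> Suc.prems(2)]) (use \<rho> in auto)
  have "norm (H1 z) \<le> (2 * M) * \<rho> ^ q" if z: "z \<in> sphere 0 \<rho>" for z
  proof -
    have "norm (H z - H 0) \<le> M * \<rho> ^ Suc q + M * \<rho> ^ Suc q"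
      by (rule order_trans[OF norm_triangle_ineq4 add_mono[OF Suc.prems(2)[OF z] H0]])
    then show ?thesis
      using z \<rho> by (auto simp: H1_def norm_divide divide_le_eq algebra_simps)
  qed
  from Suc.IH[OF H1 this] obtain pl h where IH: "coeff pl 0 = 0" "h holomorphic_on ball 0 r"
    "\<And>z. z \<in> ball 0 r - {0} \<Longrightarrow> H1 z / z ^ q = poly pl (inverse z) + h z"
    "\<And>z. z \<in> cball 0 \<rho> \<Longrightarrow> norm (h z) \<le> 2 ^ q * (2 * M)"
    by blast
  show ?case
  proof (intro exI conjI ballI)
    show "coeff (pl + monom (H 0) (Suc q)) 0 = 0" "h holomorphic_on ball 0 r"
      using IH by simp_all
    fix z :: complex assume z: "z \<in> ball 0 r - {0}"
    then have "H z = H 0 + z * H1 z" by (simp add: H1_def)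
    then have "H z / z ^ Suc q = H 0 * inverse z ^ Suc q + H1 z / z ^ q"
      using z by (simp add: divide_simps)
    then show "H z / z ^ Suc q = poly (pl + monom (H 0) (Suc q)) (inverse z) + h z"
      using IH(3)[OF z] by (simp add: poly_monom)
  next
    fix z :: complex assume "z \<in> cball 0 \<rho>"
    then show "norm (h z) \<le> 2 ^ Suc q * M" using IH(4)[of z] by simp
  qed
qed

text \<open>Uniqueness of the Laurent expansion: the holomorphic summand contributes no negative
  powers. The condition on the constant coefficient assigns the constant term to \<open>h\<close>,
  in agreement with \<open>fls_prpart\<close>, whose coefficient at 0 vanishes.\<close>

lemma fls_prpart_laurent_expansion_eqI:
  assumes pl: "coeff pl 0 = 0" and r: "0 < r" and h: "h holomorphic_on ball 0 r"
    and f: "\<And>z. z \<in> ball 0 r - {0} \<Longrightarrow> f z = poly pl (inverse z) + h z"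
  shows "fls_prpart (laurent_expansion f 0) = pl"
proof -
  define P where "P = (\<Sum>i\<le>degree pl. fls_const (coeff pl i) * fls_X_inv ^ i)"
  have "(\<lambda>z. \<Sum>i\<le>degree pl. coeff pl i * inverse z ^ i) has_laurent_expansion P"
    unfolding P_def
    by (intro laurent_expansion_intros)
  then have "(\<lambda>z. poly pl (inverse z) + h z) has_laurent_expansion P + fps_to_fls (fps_expansion h 0)"
    unfolding poly_altdef
    by (intro has_laurent_expansion_add has_laurent_expansion_fps has_fps_expansion_fps_expansion[OF _ _ h])
       (use r in auto)
  moreover have "\<forall>\<^sub>F z in at 0. z \<in> ball 0 r - {0}"
    using r by (intro eventually_at_in_open) auto
  then have "\<forall>\<^sub>F z in at 0. f z = poly pl (inverse z) + h z"
    by eventually_elim (rule f)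
  ultimately have "f has_laurent_expansion P + fps_to_fls (fps_expansion h 0)"
    by (simp add: has_laurent_expansion_cong[of f])
  then have L: "laurent_expansion f 0 = P + fps_to_fls (fps_expansion h 0)"
    by (rule laurent_expansion_0_eqI)
  have "fls_nth P (- int n) = coeff pl n" for n
  proof -
    have "fls_nth P (- int n) = (\<Sum>i\<le>degree pl. if i = n then coeff pl i else 0)"
      unfolding P_def fls_nth_sum
      by (intro sum.cong) (auto simp: fls_X_inv_power_times_conv_shift)
    also have "\<dots> = coeff pl n"
      by (simp add: coeff_eq_0)
    finally show ?thesis .
  qed
  then show ?thesis
    using pl by (intro poly_eqI) (simp add: L)
qed

text \<open>A relational description of principal and regular part that can be checked without
  series. Nothing is asked of \<open>G\<close> at 0, where its value is arbitrary.\<close>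

definition laurent_split ::
  "real \<Rightarrow> (complex \<Rightarrow> complex^'n^'m) \<Rightarrow> (complex \<Rightarrow> complex^'n^'m) \<Rightarrow> (complex \<Rightarrow> complex^'n^'m) \<Rightarrow> bool"
  where "laurent_split r G S H \<longleftrightarrow> H mat_holomorphic_on ball 0 r \<and>
    (\<exists>pl. (\<forall>i j. coeff (pl i j) 0 = 0) \<and> S = (\<lambda>z. \<chi> i j. poly (pl i j) (inverse z))) \<and>
    (\<forall>z\<in>ball 0 r - {0}. G z = S z + H z)"

text \<open>The principal parts agree even at 0, since both sides evaluate the same polynomials at
  \<open>inverse z\<close>. The regular part is a limit of G - S, and this limit is H by continuity,
  also at the removable singularity.\<close>

lemma laurent_split_parts:
  assumes split: "laurent_split r G S H" and r: "0 < r"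
  shows "principal_part G = S" and "\<And>z. z \<in> ball 0 r \<Longrightarrow> regular_part G z = H z"
proof -
  from split obtain pl where H: "\<And>i j. (\<lambda>z. H z $ i $ j) holomorphic_on ball 0 r"
    and pl: "\<And>i j. coeff (pl i j) 0 = 0" and S: "S = (\<lambda>z. \<chi> i j. poly (pl i j) (inverse z))"
    and G: "\<And>z. z \<in> ball 0 r - {0} \<Longrightarrow> G z = S z + H z"
    unfolding laurent_split_def mat_holomorphic_def by blast
  have "fls_prpart (laurent_expansion (\<lambda>w. G w $ i $ j) 0) = pl i j" for i j
    by (rule fls_prpart_laurent_expansion_eqI[OF pl r H]) (simp add: G S)
  then show P: "principal_part G = S"
    by (simp add: principal_part_def S fun_eq_iff)
  fix z :: complex assume z: "z \<in> ball 0 r"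
  have "remove_sings (\<lambda>w. (G w - principal_part G w) $ i $ j) z = H z $ i $ j" for i j
  proof (rule remove_sings_eqI)
    have "isCont (\<lambda>w. H w $ i $ j) z"
      using holomorphic_on_imp_continuous_on[OF H] z by (simp add: continuous_on_eq_continuous_at)
    moreover have "\<forall>\<^sub>F w in at z. w \<in> ball 0 r - {0}"
      using z eventually_at_in_open'[of "ball 0 r" z] eventually_neq_at_within[of 0 z UNIV]
      by (auto elim: eventually_elim2)
    then have "\<forall>\<^sub>F w in at z. H w $ i $ j = (G w - principal_part G w) $ i $ j"
      by eventually_elim (simp add: G P)
    ultimately show "(\<lambda>w. (G w - principal_part G w) $ i $ j) \<midarrow>z\<rightarrow> H z $ i $ j"
      unfolding isCont_def by (rule Lim_transform_eventually)
  qed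
  then show "regular_part G z = H z"
    by (simp add: regular_part_def vec_eq_iff)
qed

text \<open>Constant factors act linearly on the Laurent coefficients. This is what makes
  conjugation by a constant matrix commute with the splitting.\<close>

lemma laurent_split_mult:
  fixes A :: "complex^'m^'l" and B :: "complex^'k^'n"
  assumes "laurent_split r G S H"
  shows "laurent_split r (\<lambda>z. A ** G z ** B) (\<lambda>z. A ** S z ** B) (\<lambda>z. A ** H z ** B)"
proof -
  from assms obtain pl where pl: "\<And>i j. coeff (pl i j) 0 = 0"
    and S: "S = (\<lambda>z. \<chi> i j. poly (pl i j) (inverse z))"
    unfolding laurent_split_def by blast
  define pl' where "pl' = (\<lambda>i j. \<Sum>k\<in>UNIV. smult (B $ k $ j) (\<Sum>l\<in>UNIV. smult (A $ i $ l) (pl l k)))"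
  have "coeff (pl' i j) 0 = 0" for i j
    by (simp add: pl'_def coeff_sum pl)
  moreover have "A ** S z ** B = (\<chi> i j. poly (pl' i j) (inverse z))" for z
    by (simp add: pl'_def S matrix_matrix_mult_def poly_sum vec_eq_iff mult.commute)
  ultimately show ?thesis
    using assms unfolding laurent_split_def
    by (auto simp: matrix_distribs intro!: mat_holomorphic_intros)
qed

section \<open>Upper bounds for pole orders\<close>

text \<open>Only an upper bound on the order is recorded: it survives sums and products in spite of
  cancellation, and a single \<open>q\<close> can serve all n.\<close>

definition pole_order_le :: "nat \<Rightarrow> real \<Rightarrow> (complex \<Rightarrow> complex^'n^'m) \<Rightarrow> bool"
  where "pole_order_le q r G \<longleftrightarrow>
    (\<exists>H. H mat_holomorphic_on ball 0 r \<and> (\<forall>z\<in>ball 0 r - {0}. G z = (1 / z ^ q) *\<^sub>C H z))"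

lemma pole_order_le_holomorphic:
  assumes "G mat_holomorphic_on ball 0 r"
  shows "pole_order_le 0 r G"
  unfolding pole_order_le_def using assms by (intro exI[of _ G]) (simp add: vec_eq_iff)

lemma pole_order_le_mono:
  assumes "pole_order_le q r G" "q \<le> q'"
  shows "pole_order_le q' r G"
proof -
  obtain H where H: "H mat_holomorphic_on ball 0 r" "\<And>z. z \<in> ball 0 r - {0} \<Longrightarrow> G z = (1 / z ^ q) *\<^sub>C H z"
    using assms(1) unfolding pole_order_le_def by blast
  show ?thesis
    unfolding pole_order_le_def
  proof (intro exI conjI ballI)
    show "(\<lambda>z. (z ^ (q' - q)) *\<^sub>C H z) mat_holomorphic_on ball 0 r"
      by (intro mat_holomorphic_intros H holomorphic_intros)
    fix z :: complex assume z: "z \<in> ball 0 r - {0}"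
    then show "G z = (1 / z ^ q') *\<^sub>C (z ^ (q' - q)) *\<^sub>C H z"
      using H(2)[OF z] assms(2) by (simp add: cscale_algebra power_diff)
  qed
qed

lemma pole_order_le_mult:
  assumes "pole_order_le q1 r G1" "pole_order_le q2 r G2"
  shows "pole_order_le (q1 + q2) r (\<lambda>z. G1 z ** G2 z)"
proof -
  obtain H1 H2 where H: "H1 mat_holomorphic_on ball 0 r" "H2 mat_holomorphic_on ball 0 r"
      "\<And>z. z \<in> ball 0 r - {0} \<Longrightarrow> G1 z = (1 / z ^ q1) *\<^sub>C H1 z"
      "\<And>z. z \<in> ball 0 r - {0} \<Longrightarrow> G2 z = (1 / z ^ q2) *\<^sub>C H2 z"
    using assms unfolding pole_order_le_def by blast
  have "G1 z ** G2 z = (1 / z ^ (q1 + q2)) *\<^sub>C (H1 z ** H2 z)" if "z \<in> ball 0 r - {0}" for z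
    by (simp only: H(3,4)[OF that] cscale_matrix_mult matrix_mult_cscale cscale_algebra(5))
       (simp add: power_add mult.commute)
  then show ?thesis
    unfolding pole_order_le_def using H(1,2)
    by (intro exI[of _ "\<lambda>z. H1 z ** H2 z"] conjI mat_holomorphic_intros) auto
qed

lemma pole_order_le_add:
  assumes "pole_order_le q r G1" "pole_order_le q r G2"
  shows "pole_order_le q r (\<lambda>z. G1 z + G2 z)"
proof -
  obtain H1 H2 where H: "H1 mat_holomorphic_on ball 0 r" "H2 mat_holomorphic_on ball 0 r"
      "\<And>z. z \<in> ball 0 r - {0} \<Longrightarrow> G1 z = (1 / z ^ q) *\<^sub>C H1 z"
      "\<And>z. z \<in> ball 0 r - {0} \<Longrightarrow> G2 z = (1 / z ^ q) *\<^sub>C H2 z"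
    using assms unfolding pole_order_le_def by blast
  show ?thesis
    unfolding pole_order_le_def using H
    by (intro exI[of _ "\<lambda>z. H1 z + H2 z"] conjI mat_holomorphic_intros) (auto simp: cscale_algebra)
qed

lemma pole_order_le_minus:
  assumes "pole_order_le q r G"
  shows "pole_order_le q r (\<lambda>z. - G z)"
proof -
  obtain H where H: "H mat_holomorphic_on ball 0 r" "\<And>z. z \<in> ball 0 r - {0} \<Longrightarrow> G z = (1 / z ^ q) *\<^sub>C H z"
    using assms(1) unfolding pole_order_le_def by blast
  show ?thesis
    unfolding pole_order_le_def using H
    by (intro exI[of _ "\<lambda>z. - H z"] conjI mat_holomorphic_intros) (auto simp: cscale_algebra)
qed

lemma pole_order_le_laurent_split:
  assumes G: "pole_order_le q r G" and split: "laurent_split r G S H"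
  shows "pole_order_le q r S"
proof -
  have "pole_order_le q r (\<lambda>z. G z + - H z)"
    using split pole_order_le_mono[OF pole_order_le_holomorphic, of H r q]
    by (intro pole_order_le_add G pole_order_le_minus) (auto simp: laurent_split_def)
  moreover have "G z + - H z = S z" if "z \<in> ball 0 r - {0}" for z
    using split that by (auto simp: laurent_split_def)
  ultimately show ?thesis
    unfolding pole_order_le_def by (metis (no_types, lifting))
qed

text \<open>The values of G on one circle control the regular part on the whole disc: z^q G(z) is
  holomorphic and has size \<rho>^q M there, which is the input of the entrywise splitting.\<close>

lemma laurent_split_exists:
  fixes G :: "complex \<Rightarrow> complex^'n^'m"
  assumes G: "pole_order_le q r G" and \<rho>: "0 < \<rho>" "\<rho> < r"
    and M: "\<And>z. z \<in> sphere 0 \<rho> \<Longrightarrow> norm (G z) \<le> M"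
  obtains S H where "laurent_split r G S H"
    "\<And>z. z \<in> cball 0 \<rho> \<Longrightarrow> norm (H z) \<le> real CARD('m) * real CARD('n) * (2 ^ q * M)"
proof -
  obtain H0 where H0: "H0 mat_holomorphic_on ball 0 r"
      and GH: "\<And>z. z \<in> ball 0 r - {0} \<Longrightarrow> G z = (1 / z ^ q) *\<^sub>C H0 z"
    using G unfolding pole_order_le_def by blast
  have "\<exists>pl h. coeff pl 0 = 0 \<and> h holomorphic_on ball 0 r \<and>
    (\<forall>z\<in>ball 0 r - {0}. H0 z $ i $ j / z ^ q = poly pl (inverse z) + h z) \<and>
    (\<forall>z\<in>cball 0 \<rho>. norm (h z) \<le> 2 ^ q * M)" for i j
  proof (rule laurent_split_bound[OF _ \<rho>])
    show "(\<lambda>z. H0 z $ i $ j) holomorphic_on ball 0 r"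
      using H0 by (simp add: mat_holomorphic_def)
    fix z :: complex assume z: "z \<in> sphere 0 \<rho>"
    then have "z \<in> ball 0 r - {0}" using \<rho> by auto
    then have "H0 z $ i $ j = z ^ q * G z $ i $ j" by (simp add: GH)
    then have "norm (H0 z $ i $ j) = \<rho> ^ q * norm (G z $ i $ j)"
      using z by (simp add: norm_mult norm_power)
    also have "\<dots> \<le> \<rho> ^ q * M"
      using order_trans[OF norm_entry_le M[OF z]] \<rho> by (intro mult_left_mono) auto
    finally show "norm (H0 z $ i $ j) \<le> M * \<rho> ^ q" by (simp add: mult.commute)
  qed
  then obtain pl h where plh: "\<And>i j. coeff (pl i j) 0 = 0" "\<And>i j. h i j holomorphic_on ball 0 r"
    "\<And>i j z. z \<in> ball 0 r - {0} \<Longrightarrow> H0 z $ i $ j / z ^ q = poly (pl i j) (inverse z) + h i j z"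
    "\<And>i j z. z \<in> cball 0 \<rho> \<Longrightarrow> norm (h i j z) \<le> 2 ^ q * M"
    by metis
  show ?thesis
  proof (rule that)
    show "laurent_split r G (\<lambda>z. \<chi> i j. poly (pl i j) (inverse z)) (\<lambda>z. \<chi> i j. h i j z)"
      unfolding laurent_split_def mat_holomorphic_def
      using plh(1,2) plh(3)[symmetric] by (auto simp: GH vec_eq_iff)
    show "norm ((\<chi> i j. h i j z) :: complex^'n^'m) \<le> real CARD('m) * real CARD('n) * (2 ^ q * M)" if "z \<in> cball 0 \<rho>" for z
      by (rule norm_le_entries) (simp add: plh(4)[OF that])
  qed
qed

text \<open>Multiplication by z^p shifts the Laurent expansion to nonnegative powers, so the product
  has a limit at 0 and the singularity is removable.\<close>

lemma pole_at_0_only_imp_pole_order_le: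
  assumes G: "pole_at_0_only p r G" and r: "0 < r"
  shows "pole_order_le p r G"
proof -
  have "\<exists>h. h holomorphic_on ball 0 r \<and> (\<forall>z\<in>ball 0 r - {0}. G z $ i $ j = h z / z ^ p)" for i j
  proof -
    let ?f = "\<lambda>z. G z $ i $ j"
    define F where "F = laurent_expansion ?f 0"
    have mero: "(?f) meromorphic_on cball 0 r" and ana: "(?f) analytic_on cball 0 r - {0}"
      and sub: "- int p \<le> fls_subdegree F"
      using G by (auto simp: pole_at_0_only_def F_def)
    have "(?f) has_laurent_expansion F"
      using meromorphic_on_imp_has_laurent_expansion[OF mero, of 0] r by (simp add: F_def)
    then have "(\<lambda>z. ?f z * z powi int p) has_laurent_expansion fls_shift (- int p) F"
      by (rule has_laurent_expansion_shift)
    \<comment> \<open>The zero series has subdegree 0 by convention, and shifting does not change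
      that; hence the separate case.\<close>
    moreover have "0 \<le> fls_subdegree (fls_shift (- int p) F)"
      using sub by (cases "F = 0") auto
    ultimately have "((\<lambda>z. (?f z) * z powi int p) \<longlongrightarrow> fls_nth (fls_shift (- int p) F) 0) (at 0)"
      by (rule has_laurent_expansion_imp_tendsto_0)
    then have lim: "(\<lambda>z. ?f z * z ^ p) \<midarrow>0\<rightarrow> fls_nth (fls_shift (- int p) F) 0"
      by simp
    define h where "h = (\<lambda>z. if z = 0 then fls_nth (fls_shift (- int p) F) 0 else ?f z * z ^ p)"
    have "h holomorphic_on ball 0 r"
    proof (rule no_isolated_singularity'[where K = "{0}"])
      have "(\<lambda>z. ?f z * z ^ p) holomorphic_on ball 0 r - {0}"
        using analytic_imp_holomorphic[OF ana]
        by (intro holomorphic_intros) (auto intro: holomorphic_on_subset)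
      then show "h holomorphic_on ball 0 r - {0}"
        by (rule holomorphic_transform) (simp add: h_def)
      have "h \<midarrow>0\<rightarrow> h 0"
        using lim by (rule Lim_transform_eventually[THEN tendsto_eq_rhs])
          (auto simp: h_def eventually_at_filter)
      then show "(h \<longlongrightarrow> h z) (at z within ball 0 r)" if "z \<in> {0}" for z
        using that by (auto intro: tendsto_within_subset[OF _ subset_UNIV])
    qed auto
    then show ?thesis
      by (intro exI[of _ h]) (auto simp: h_def)
  qed
  then obtain h where h: "\<And>i j. h i j holomorphic_on ball 0 r"
      "\<And>i j z. z \<in> ball 0 r - {0} \<Longrightarrow> G z $ i $ j = h i j z / z ^ p"
    by metis
  then show ?thesis
    unfolding pole_order_le_def mat_holomorphic_def
    by (intro exI[of _ "\<lambda>z. \<chi> i j. h i j z"]) (auto simp: vec_eq_iff)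
qed

section \<open>The operator \<open>\<pi>\<close> in conjugated coordinates\<close>

definition conj_by :: "complex^'m^'m \<Rightarrow> complex^'m^'m \<Rightarrow> complex^'m^'m"
  where "conj_by A X = matrix_inv A ** X ** A"

lemma conj_by_distribs:
  "conj_by A (X + Y) = conj_by A X + conj_by A Y" "conj_by A (X - Y) = conj_by A X - conj_by A Y"
  "conj_by A (- X) = - conj_by A X"
  by (simp_all add: conj_by_def matrix_distribs)

lemma conj_by_mult:
  assumes "invertible A"
  shows "conj_by A (X ** Y) = conj_by A X ** conj_by A Y"
  using matrix_cancel[OF matrix_inv_mult(1)[OF assms], of "matrix_inv A ** X"]
  by (simp add: conj_by_def matrix_mul_assoc)

lemma conj_by_one: "invertible A \<Longrightarrow> conj_by A (mat 1) = mat 1"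
  by (simp add: conj_by_def matrix_inv_mult)

lemma conj_by_inverse:
  assumes "invertible A"
  shows "conj_by A (A ** X ** matrix_inv A) = X" and "A ** conj_by A X ** matrix_inv A = X"
proof -
  have "conj_by A (A ** X ** matrix_inv A) = (matrix_inv A ** A) ** X ** (matrix_inv A ** A)"
    by (simp only: conj_by_def matrix_mul_assoc)
  then show "conj_by A (A ** X ** matrix_inv A) = X"
    by (simp add: matrix_inv_mult assms)
  have "A ** conj_by A X ** matrix_inv A = (A ** matrix_inv A) ** X ** (A ** matrix_inv A)"
    by (simp only: conj_by_def matrix_mul_assoc)
  then show "A ** conj_by A X ** matrix_inv A = X"
    by (simp add: matrix_inv_mult assms)
qed

lemma pole_order_le_conj_by:
  assumes "pole_order_le q r G"
  shows "pole_order_le q r (\<lambda>z. conj_by A (G z))"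
  unfolding conj_by_def
  using pole_order_le_mult[OF pole_order_le_mult[OF pole_order_le_holomorphic assms] pole_order_le_holomorphic,
      OF mat_holomorphic_const mat_holomorphic_const, of "matrix_inv A" A]
  by simp

text \<open>Split the conjugated function, for which a bound is known, and conjugate the splitting
  back: by uniqueness it is the splitting of G. So the regular part is controlled after conjugation
  although no bound on G itself is available.\<close>

lemma regular_part_conj_by:
  fixes G :: "complex \<Rightarrow> complex^'m^'m"
  assumes G: "pole_order_le q r G" and A: "invertible A" and \<rho>: "0 < \<rho>" "\<rho> < r"
    and M: "\<And>z. z \<in> sphere 0 \<rho> \<Longrightarrow> norm (conj_by A (G z)) \<le> M"
  shows "\<And>z. z \<in> cball 0 \<rho> \<Longrightarrow>
      norm (conj_by A (regular_part G z)) \<le> real CARD('m) * real CARD('m) * (2 ^ q * M)"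
    and "regular_part G mat_holomorphic_on ball 0 r"
    and "pole_order_le q r (principal_part G)"
    and "\<And>z. z \<in> ball 0 r - {0} \<Longrightarrow> principal_part G z = G z - regular_part G z"
proof -
  obtain S' H' where "laurent_split r (\<lambda>z. conj_by A (G z)) S' H'"
    and bound: "\<And>z. z \<in> cball 0 \<rho> \<Longrightarrow> norm (H' z) \<le> real CARD('m) * real CARD('m) * (2 ^ q * M)"
    using laurent_split_exists[OF pole_order_le_conj_by[OF G] \<rho> M] by blast
  from laurent_split_mult[OF this(1), of A "matrix_inv A"]
  have split: "laurent_split r G (\<lambda>z. A ** S' z ** matrix_inv A) (\<lambda>z. A ** H' z ** matrix_inv A)"
    by (simp add: conj_by_inverse A)
  have r: "0 < r" using \<rho> by simp
  note parts = laurent_split_parts[OF split r]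
  show "norm (conj_by A (regular_part G z)) \<le> real CARD('m) * real CARD('m) * (2 ^ q * M)"
    if "z \<in> cball 0 \<rho>" for z
    using that \<rho> bound[OF that] by (simp add: parts(2) conj_by_inverse A)
  show "pole_order_le q r (principal_part G)"
    using pole_order_le_laurent_split[OF G split] by (simp add: parts(1))
  have "(\<lambda>z. A ** H' z ** matrix_inv A) mat_holomorphic_on ball 0 r"
    using split by (simp add: laurent_split_def)
  then show "regular_part G mat_holomorphic_on ball 0 r"
    unfolding mat_holomorphic_def
    by (metis (no_types, lifting) holomorphic_transform parts(2))
  show "principal_part G z = G z - regular_part G z" if "z \<in> ball 0 r - {0}" for z
    using split that by (auto simp: laurent_split_def parts)
qed

text \<open>The regular part is at most k M and the principal part, as a difference, at most (k + 1)
  M. The four terms of \<open>pi_op\<close> are products of two or three such quantities, and M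
  \<le> 1 reduces them to multiples of M; the four summands of the constant belong to these terms in
  order. The pole order doubles because each term has at most two factors with a pole.\<close>

lemma pi_op_conj_by:
  fixes G :: "complex \<Rightarrow> complex^'m^'m"
  assumes G: "pole_order_le q r G" and A: "invertible A" and \<rho>: "0 < \<rho>" "\<rho> < r"
    and M: "\<And>z. z \<in> sphere 0 \<rho> \<Longrightarrow> norm (conj_by A (G z)) \<le> M" and M1: "M \<le> 1"
    and k: "k = real CARD('m) * real CARD('m) * 2 ^ q"
  shows "pole_order_le (q + q) r (pi_op G)"
    and "\<And>z. z \<in> sphere 0 \<rho> \<Longrightarrow> norm (conj_by A (pi_op G z)) \<le> (k + (k + 1) + k * (k + 1) + k * (k + 1)) * M"
proof -
  note parts = regular_part_conj_by[OF G A \<rho> M]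
  note mono = pole_order_le_mono[of _ r _ "q + q"]
  have reg: "pole_order_le 0 r (regular_part G)"
    by (intro pole_order_le_holomorphic parts(2))
  have "pole_order_le (q + q) r (\<lambda>z. regular_part G z ** G z)"
    by (rule mono[OF pole_order_le_mult[OF reg G]]) simp
  moreover have "pole_order_le (q + q) r (\<lambda>z. G z ** principal_part G z)"
    by (rule pole_order_le_mult[OF G parts(3)])
  moreover have "pole_order_le (q + q) r (\<lambda>z. regular_part G z ** principal_part G z)"
    by (rule mono[OF pole_order_le_mult[OF reg parts(3)]]) simp_all
  moreover have "pole_order_le (q + q) r (\<lambda>z. regular_part G z ** G z ** principal_part G z)"
    by (rule mono[OF pole_order_le_mult[OF pole_order_le_mult[OF reg G] parts(3)]]) simp_all
  ultimately have "pole_order_le (q + q) r (\<lambda>z. - (regular_part G z ** G z) + - (G z ** principal_part G z)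
      + regular_part G z ** principal_part G z + regular_part G z ** G z ** principal_part G z)"
    by (intro pole_order_le_add pole_order_le_minus)
  then show "pole_order_le (q + q) r (pi_op G)"
    by (simp add: pi_op_def[abs_def])
  fix z :: complex assume z: "z \<in> sphere 0 \<rho>"
  let ?g = "conj_by A (G z)" and ?h = "conj_by A (regular_part G z)" and ?s = "conj_by A (principal_part G z)"
  have k0: "0 \<le> k" by (simp add: k)
  have M0: "0 \<le> M" using M[OF z] norm_ge_zero order_trans by blast
  have g: "norm ?g \<le> M" by (rule M[OF z])
  have h: "norm ?h \<le> k * M" using parts(1)[of z] z by (simp add: k mult.assoc)
  have "?s = ?g - ?h" using parts(4)[of z] z \<rho> by (auto simp: conj_by_distribs)
  then have "norm ?s \<le> norm ?g + norm ?h" by (simp only: norm_triangle_ineq4)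
  then have s: "norm ?s \<le> (k + 1) * M"
    using g h unfolding distrib_right by linarith
  have MM: "M * M \<le> M" "M * M * M \<le> M"
    using M0 M1 mult_left_le[of M M] mult_left_le[of M "M * M"] by auto
  have "conj_by A (pi_op G z) = - (?h ** ?g) - ?g ** ?s + ?h ** ?s + ?h ** ?g ** ?s"
    by (simp add: pi_op_def conj_by_distribs conj_by_mult A)
  also have "norm \<dots> \<le> norm (?h ** ?g) + norm (?g ** ?s) + norm (?h ** ?s) + norm (?h ** ?g ** ?s)"
    by norm
  also have "\<dots> \<le> (k * M) * M + M * ((k + 1) * M) + (k * M) * ((k + 1) * M) + ((k * M) * M) * ((k + 1) * M)"
    by (intro add_mono norm_matrix_mult_mono g h s)
  also have "\<dots> = (k + (k + 1) + k * (k + 1)) * (M * M) + k * (k + 1) * (M * M * M)"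
    by (simp add: algebra_simps)
  also have "\<dots> \<le> (k + (k + 1) + k * (k + 1)) * M + k * (k + 1) * M"
    by (intro add_mono mult_left_mono MM) (use k0 in auto)
  also have "\<dots> = (k + (k + 1) + k * (k + 1) + k * (k + 1)) * M"
    by (simp add: algebra_simps)
  finally show "norm (conj_by A (pi_op G z)) \<le> (k + (k + 1) + k * (k + 1) + k * (k + 1)) * M" .
qed

section \<open>Sequences of functions that are small after conjugation\<close>

locale conjugated_discs =
  fixes r :: real and A :: "nat \<Rightarrow> complex^'m^'m" and \<rho> \<epsilon> :: "nat \<Rightarrow> real"
  assumes discs: "\<forall>\<^sub>F n in sequentially. invertible (A n) \<and> 0 < \<rho> n \<and> \<rho> n < r \<and> 0 \<le> \<epsilon> n"
    and \<epsilon>_0: "\<epsilon> \<longlonglongrightarrow> 0"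
begin

text \<open>Both the pole order and the constant are chosen before n: the loss 2^q in taking Laurent
  parts must not grow with n. Each application of \<open>pi_op\<close> changes them, but the number
  of applications is fixed.\<close>

definition small :: "(nat \<Rightarrow> complex \<Rightarrow> complex^'m^'m) \<Rightarrow> bool"
  where "small G \<longleftrightarrow> (\<exists>q c. \<forall>\<^sub>F n in sequentially. pole_order_le q r (G n) \<and>
    (\<forall>z\<in>sphere 0 (\<rho> n). norm (conj_by (A n) (G n z)) \<le> c * \<epsilon> n))"

lemma eventually_\<epsilon>_le_1: "\<forall>\<^sub>F n in sequentially. c * \<epsilon> n \<le> 1"
proof -
  have "(\<lambda>n. c * \<epsilon> n) \<longlonglongrightarrow> c * 0" by (intro tendsto_intros \<epsilon>_0)
  then have "\<forall>\<^sub>F n in sequentially. c * \<epsilon> n < 1" by (rule order_tendstoD) simp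
  then show ?thesis by eventually_elim simp
qed

lemma small_pi_op:
  assumes "small G"
  shows "small (\<lambda>n. pi_op (G n))"
proof -
  from assms obtain q c where G: "\<forall>\<^sub>F n in sequentially. pole_order_le q r (G n) \<and>
    (\<forall>z\<in>sphere 0 (\<rho> n). norm (conj_by (A n) (G n z)) \<le> c * \<epsilon> n)"
    unfolding small_def by blast
  define k where "k = real CARD('m) * real CARD('m) * 2 ^ q"
  from G discs eventually_\<epsilon>_le_1[of c]
  have "\<forall>\<^sub>F n in sequentially. pole_order_le (q + q) r (pi_op (G n)) \<and>
    (\<forall>z\<in>sphere 0 (\<rho> n). norm (conj_by (A n) (pi_op (G n) z))
      \<le> ((k + (k + 1) + k * (k + 1) + k * (k + 1)) * c) * \<epsilon> n)"
  proof eventually_elim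
    case (elim n)
    show ?case
      using pi_op_conj_by[of q r "G n" "A n" "\<rho> n" "c * \<epsilon> n", OF _ _ _ _ _ _ k_def] elim
      by (simp add: mult.assoc)
  qed
  then show ?thesis unfolding small_def by blast
qed

lemma small_pi_op_iterate: "small G \<Longrightarrow> small (\<lambda>n. (pi_op ^^ k) (G n))"
  by (induction k) (simp_all add: small_pi_op)

lemma small_regular_part:
  assumes "small G"
  obtains c where "0 \<le> c" "\<forall>\<^sub>F n in sequentially. regular_part (G n) mat_holomorphic_on ball 0 r \<and>
    (\<forall>z\<in>cball 0 (\<rho> n). norm (conj_by (A n) (regular_part (G n) z)) \<le> c * \<epsilon> n)"
proof -
  from assms obtain q c where G: "\<forall>\<^sub>F n in sequentially. pole_order_le q r (G n) \<and>
    (\<forall>z\<in>sphere 0 (\<rho> n). norm (conj_by (A n) (G n z)) \<le> c * \<epsilon> n)"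
    unfolding small_def by blast
  define k where "k = real CARD('m) * real CARD('m) * 2 ^ q"
  from G discs have "\<forall>\<^sub>F n in sequentially. regular_part (G n) mat_holomorphic_on ball 0 r \<and>
    (\<forall>z\<in>cball 0 (\<rho> n). norm (conj_by (A n) (regular_part (G n) z)) \<le> (k * \<bar>c\<bar>) * \<epsilon> n)"
  proof eventually_elim
    case (elim n)
    have "c * \<epsilon> n \<le> \<bar>c\<bar> * \<epsilon> n" using elim by (intro mult_right_mono) auto
    then have M: "norm (conj_by (A n) (G n z)) \<le> \<bar>c\<bar> * \<epsilon> n" if "z \<in> sphere 0 (\<rho> n)" for z
      using elim that by force
    show ?case
      using regular_part_conj_by(1,2)[of q r "G n" "A n" "\<rho> n" "\<bar>c\<bar> * \<epsilon> n", OF _ _ _ _ M] elim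
      by (simp add: k_def mult.assoc)
  qed
  then show ?thesis
    by (intro that[of "k * \<bar>c\<bar>"]) (auto simp: k_def)
qed

text \<open>If T is the conjugated product so far and X the next regular part, then (I - X) T - I =
  (T - I) - X T. Eventually T is bounded by 1 + |I|, so each factor adds c' (1 + |I|) to the
  constant.\<close>

lemma pi_product_near_identity:
  assumes "small G"
  shows "\<exists>c\<ge>0. \<forall>\<^sub>F n in sequentially. pi_product (G n) K mat_holomorphic_on ball 0 r \<and>
    (\<forall>z\<in>cball 0 (\<rho> n). norm (conj_by (A n) (pi_product (G n) K z) - mat 1) \<le> c * \<epsilon> n)"
proof (induction K)
  case 0
  from small_regular_part[OF assms] obtain c where c: "0 \<le> c" "\<forall>\<^sub>F n in sequentially.
    regular_part (G n) mat_holomorphic_on ball 0 r \<and>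
    (\<forall>z\<in>cball 0 (\<rho> n). norm (conj_by (A n) (regular_part (G n) z)) \<le> c * \<epsilon> n)" .
  from c(2) discs have "\<forall>\<^sub>F n in sequentially. pi_product (G n) 0 mat_holomorphic_on ball 0 r \<and>
    (\<forall>z\<in>cball 0 (\<rho> n). norm (conj_by (A n) (pi_product (G n) 0 z) - mat 1) \<le> c * \<epsilon> n)"
  proof eventually_elim
    case (elim n)
    have "pi_product (G n) 0 = (\<lambda>z. mat 1 - regular_part (G n) z)" by (rule ext) simp
    then show ?case
      using elim by (auto simp: conj_by_distribs conj_by_one intro!: mat_holomorphic_intros)
  qed
  then show ?case using c(1) by blast
next
  case (Suc K)
  then obtain c where c: "0 \<le> c" "\<forall>\<^sub>F n in sequentially. pi_product (G n) K mat_holomorphic_on ball 0 r \<and>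
    (\<forall>z\<in>cball 0 (\<rho> n). norm (conj_by (A n) (pi_product (G n) K z) - mat 1) \<le> c * \<epsilon> n)" by blast
  from small_regular_part[OF small_pi_op_iterate[OF assms, of "Suc K"]]
  obtain c' where c': "0 \<le> c'" "\<forall>\<^sub>F n in sequentially.
    regular_part ((pi_op ^^ Suc K) (G n)) mat_holomorphic_on ball 0 r \<and>
    (\<forall>z\<in>cball 0 (\<rho> n). norm (conj_by (A n) (regular_part ((pi_op ^^ Suc K) (G n)) z)) \<le> c' * \<epsilon> n)" .
  define one where "one = norm (mat 1 :: complex^'m^'m)"
  from c(2) c'(2) discs eventually_\<epsilon>_le_1[of c]
  have "\<forall>\<^sub>F n in sequentially. pi_product (G n) (Suc K) mat_holomorphic_on ball 0 r \<and>
    (\<forall>z\<in>cball 0 (\<rho> n). norm (conj_by (A n) (pi_product (G n) (Suc K) z) - mat 1)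
      \<le> (c + c' * (1 + one)) * \<epsilon> n)"
  proof eventually_elim
    case (elim n)
    let ?R = "regular_part ((pi_op ^^ Suc K) (G n))"
    have eq: "pi_product (G n) (Suc K) = (\<lambda>z. (mat 1 - ?R z) ** pi_product (G n) K z)" by (rule ext) simp
    have "norm (conj_by (A n) (pi_product (G n) (Suc K) z) - mat 1) \<le> (c + c' * (1 + one)) * \<epsilon> n"
      if z: "z \<in> cball 0 (\<rho> n)" for z
    proof -
      define T where "T = conj_by (A n) (pi_product (G n) K z)"
      define X where "X = conj_by (A n) (?R z)"
      have T1: "norm (T - mat 1) \<le> c * \<epsilon> n" and X: "norm X \<le> c' * \<epsilon> n"
        using elim z by (auto simp: T_def X_def)
      have T: "norm T \<le> 1 + one"
        using norm_triangle_ineq[of "T - mat 1" "mat 1"] T1 elim by (simp add: one_def)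
      have "conj_by (A n) (pi_product (G n) (Suc K) z) = (mat 1 - X) ** T"
        using elim by (simp only: eq conj_by_distribs conj_by_mult conj_by_one X_def T_def)
      then have "conj_by (A n) (pi_product (G n) (Suc K) z) - mat 1 = (T - mat 1) - X ** T"
        by (simp add: matrix_distribs)
      also have "norm \<dots> \<le> c * \<epsilon> n + (c' * \<epsilon> n) * (1 + one)"
        by (rule order_trans[OF norm_triangle_ineq4]) (intro add_mono T1 norm_matrix_mult_mono X T)
      finally show ?thesis by (simp add: algebra_simps)
    qed
    moreover have "pi_product (G n) (Suc K) mat_holomorphic_on ball 0 r"
      unfolding eq using elim by (intro mat_holomorphic_intros) auto
    ultimately show ?case by blast
  qed
  moreover have "0 \<le> c + c' * (1 + one)" using c(1) c'(1) by (simp add: one_def)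
  ultimately show ?case by blast
qed

end

section \<open>Integrals over contours\<close>

text \<open>What integration asks of a parametrization, common to smooth arcs and to the circles.
  The restricted measure takes the place of set integrals, so that bounds are required on the
  parameter set only.\<close>

definition regular_curve :: "curve \<Rightarrow> bool"
  where "regular_curve = (\<lambda>(J, \<gamma>). J \<in> sets lebesgue \<and>
    \<gamma> \<in> borel_measurable (restrict_space lebesgue J) \<and>
    (\<lambda>t. vector_derivative \<gamma> (at t within J)) \<in> borel_measurable (restrict_space lebesgue J))"

definition arc_integrable :: "curve list \<Rightarrow> (complex \<Rightarrow> real) \<Rightarrow> bool"
  where "arc_integrable \<Gamma> f \<longleftrightarrow> (\<forall>(J, \<gamma>)\<in>set \<Gamma>.
    integrable (restrict_space lebesgue J) (\<lambda>t. f (\<gamma> t) * norm (vector_derivative \<gamma> (at t within J))))"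

definition arc_integral :: "curve list \<Rightarrow> (complex \<Rightarrow> real) \<Rightarrow> real"
  where "arc_integral \<Gamma> f = (\<Sum>(J, \<gamma>)\<leftarrow>\<Gamma>.
    integral\<^sup>L (restrict_space lebesgue J) (\<lambda>t. f (\<gamma> t) * norm (vector_derivative \<gamma> (at t within J))))"

text \<open>Every point of a nondegenerate interval is a limit point of it, endpoints included, so
  the one-sided derivatives there are unique as well.\<close>

lemma vector_derivative_within_interval:
  assumes J: "is_interval J" "interior J \<noteq> {}" and t: "t \<in> J"
    and D: "(\<gamma> has_vector_derivative D) (at t within J)"
  shows "vector_derivative \<gamma> (at t within J) = D"
proof (rule vector_derivative_within[OF _ D])
  have "connected J" using J(1) by (simp add: is_interval_connected)
  moreover have "J \<noteq> {x}" for x :: real using J(2) by auto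
  ultimately show "at t within J \<noteq> bot"
    using connected_imp_perfect t trivial_limit_within by blast
qed

lemma regular_curveI:
  assumes J: "is_interval J" "interior J \<noteq> {}" and \<gamma>': "continuous_on J \<gamma>'"
    and D: "\<And>t. t \<in> J \<Longrightarrow> (\<gamma> has_vector_derivative \<gamma>' t) (at t within J)"
  shows "regular_curve (J, \<gamma>)"
proof -
  have J_borel: "J \<in> sets lebesgue"
    using real_interval_borel_measurable[OF J(1)] by simp
  have meas: "f \<in> borel_measurable (restrict_space lebesgue J)" if "continuous_on J f" for f :: "real \<Rightarrow> complex"
    using that J_borel by (rule continuous_imp_measurable_on_sets_lebesgue)
  have "continuous_on J \<gamma>"
    using D by (auto simp: continuous_on_eq_continuous_within intro: has_vector_derivative_continuous)
  moreover have "vector_derivative \<gamma> (at t within J) = \<gamma>' t" if "t \<in> J" for t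
    by (rule vector_derivative_within_interval[OF J that D[OF that]])
  then have "continuous_on J (\<lambda>t. vector_derivative \<gamma> (at t within J))"
    using \<gamma>' by (simp cong: continuous_on_cong)
  ultimately show ?thesis
    using meas J_borel by (auto simp: regular_curve_def)
qed

lemma smooth_curve_regular: "smooth_curve \<kappa> \<Longrightarrow> regular_curve \<kappa>"
  unfolding smooth_curve_def by (cases \<kappa>) (auto intro: regular_curveI)

lemma circle_curve_regular: "regular_curve (circle_curve \<rho>)"
  unfolding circle_curve_def
  by (rule regular_curveI[OF _ _ _ has_vector_derivative_circlepath])
     (auto simp: is_interval_1 intro!: continuous_intros)

lemma circle_curve_trace: "0 \<le> \<rho> \<Longrightarrow> contour_trace [circle_curve \<rho>] \<subseteq> sphere 0 \<rho>"
  by (auto simp: contour_trace_def curve_trace_def circle_curve_def circlepath norm_mult)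

lemma arc_integral_append: "arc_integral (\<Gamma> @ \<Gamma>') f = arc_integral \<Gamma> f + arc_integral \<Gamma>' f"
  by (simp add: arc_integral_def)

lemma arc_integral_nonneg:
  assumes "\<And>s. 0 \<le> f s"
  shows "0 \<le> arc_integral \<Gamma> f"
  unfolding arc_integral_def using assms by (auto intro!: sum_list_nonneg)

lemma arc_integrable_linear:
  assumes "arc_integrable \<Gamma> f" "arc_integrable \<Gamma> g"
  shows "arc_integrable \<Gamma> (\<lambda>s. u * f s + v * g s)"
    and "arc_integral \<Gamma> (\<lambda>s. u * f s + v * g s) = u * arc_integral \<Gamma> f + v * arc_integral \<Gamma> g"
proof -
  show "arc_integrable \<Gamma> (\<lambda>s. u * f s + v * g s)"
    using assms unfolding arc_integrable_def
    by (auto simp: distrib_right mult.assoc split: prod.splits)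
  show "arc_integral \<Gamma> (\<lambda>s. u * f s + v * g s) = u * arc_integral \<Gamma> f + v * arc_integral \<Gamma> g"
    using assms
  proof (induction \<Gamma>)
    case (Cons \<kappa> \<Gamma>)
    then have "arc_integrable \<Gamma> f" "arc_integrable \<Gamma> g" by (simp_all add: arc_integrable_def)
    with Cons.IH Cons.prems show ?case
      by (cases \<kappa>) (simp add: arc_integral_def arc_integrable_def distrib_right mult.assoc algebra_simps)
  qed (simp add: arc_integral_def)
qed

lemma arc_integrable_circle:
  assumes "0 \<le> \<rho>"
  shows "arc_integrable [circle_curve \<rho>] (\<lambda>s. 1)" and "arc_integral [circle_curve \<rho>] (\<lambda>s. 1) = 2 * pi * \<rho>"
proof -
  have "norm (vector_derivative (circlepath 0 \<rho>) (at t within {0..<1})) = 2 * pi * \<rho>" if "t \<in> {0..<1}" for t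
    using assms that
    by (subst vector_derivative_within_interval[OF _ _ _ has_vector_derivative_circlepath])
       (auto simp: is_interval_1 norm_mult)
  then have cong: "t \<in> space (restrict_space lebesgue {0..<1}) \<Longrightarrow>
      1 * norm (vector_derivative (circlepath 0 \<rho>) (at t within {0..<1})) = 2 * pi * \<rho>" for t
    by (simp add: space_restrict_space)
  have "integrable (restrict_space lebesgue {0..<1::real}) (\<lambda>t. 2 * pi * \<rho>)"
    by (rule finite_measure.integrable_const) (intro finite_measureI, simp add: emeasure_restrict_space space_restrict_space)
  then show "arc_integrable [circle_curve \<rho>] (\<lambda>s. 1)"
    unfolding arc_integrable_def circle_curve_def
    by (simp only: Bochner_Integration.integrable_cong[OF refl cong] list.set ball_simps prod.case)
  have "integral\<^sup>L (restrict_space lebesgue {0..<1::real}) (\<lambda>t. 2 * pi * \<rho>) = 2 * pi * \<rho>"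
    by (simp add: measure_restrict_space space_restrict_space)
  then show "arc_integral [circle_curve \<rho>] (\<lambda>s. 1) = 2 * pi * \<rho>"
    unfolding arc_integral_def circle_curve_def
    by (simp only: Bochner_Integration.integral_cong[OF refl cong] list.map sum_list.Cons sum_list.Nil prod.case)
qed

text \<open>Finiteness of the extended length makes the speed of each curve integrable, so length
  becomes a real integral. The maximum with 0 is due to \<open>ennreal\<close> sending negative
  reals to 0.\<close>

lemma arc_integrable_length:
  assumes reg: "\<And>\<kappa>. \<kappa> \<in> set \<Gamma> \<Longrightarrow> regular_curve \<kappa>" and L: "contour_length \<Gamma> \<le> ennreal L"
  shows "arc_integrable \<Gamma> (\<lambda>s. 1)" and "arc_integral \<Gamma> (\<lambda>s. 1) \<le> max 0 L"
proof -
  let ?l = "\<lambda>(J, \<gamma>). \<integral>\<^sup>+t. ennreal (norm (vector_derivative \<gamma> (at t within J))) \<partial>(restrict_space lebesgue J)"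
  have "arc_integrable \<Gamma> (\<lambda>s. 1) \<and> ennreal (arc_integral \<Gamma> (\<lambda>s. 1)) = (\<Sum>\<kappa>\<leftarrow>\<Gamma>. ?l \<kappa>)"
    if "(\<Sum>\<kappa>\<leftarrow>\<Gamma>. ?l \<kappa>) < \<infinity>"
    using that reg
  proof (induction \<Gamma>)
    case (Cons \<kappa> \<Gamma>)
    obtain J \<gamma> where \<kappa>: "\<kappa> = (J, \<gamma>)" by (cases \<kappa>)
    have fin: "?l \<kappa> < \<infinity>" "(\<Sum>\<kappa>\<leftarrow>\<Gamma>. ?l \<kappa>) < \<infinity>"
      using Cons.prems(1) by (auto simp: ennreal_add_eq_top less_top)
    have meas: "(\<lambda>t. vector_derivative \<gamma> (at t within J)) \<in> borel_measurable (restrict_space lebesgue J)"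
      using Cons.prems(2)[of \<kappa>] by (simp add: \<kappa> regular_curve_def)
    have int: "integrable (restrict_space lebesgue J) (\<lambda>t. norm (vector_derivative \<gamma> (at t within J)))"
      using fin(1) meas by (simp add: \<kappa> integrable_iff_bounded)
    have "ennreal (integral\<^sup>L (restrict_space lebesgue J) (\<lambda>t. norm (vector_derivative \<gamma> (at t within J)))) = ?l \<kappa>"
      using nn_integral_eq_integral[OF int] by (simp add: \<kappa>)
    moreover have "arc_integrable \<Gamma> (\<lambda>s. 1) \<and> ennreal (arc_integral \<Gamma> (\<lambda>s. 1)) = (\<Sum>\<kappa>\<leftarrow>\<Gamma>. ?l \<kappa>)"
      using Cons fin(2) by auto
    moreover have "0 \<le> arc_integral \<Gamma> (\<lambda>s. 1)" by (rule arc_integral_nonneg) simp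
    ultimately show ?case
      using int by (simp add: \<kappa> arc_integral_def arc_integrable_def ennreal_plus)
  qed (simp add: arc_integral_def arc_integrable_def)
  moreover have "contour_length \<Gamma> = (\<Sum>\<kappa>\<leftarrow>\<Gamma>. ?l \<kappa>)"
    unfolding contour_length_def using reg
    by (intro arg_cong[of _ _ sum_list] map_cong refl)
       (auto simp: regular_curve_def nn_integral_restrict_space split: prod.splits)
  ultimately have *: "arc_integrable \<Gamma> (\<lambda>s. 1)" "ennreal (arc_integral \<Gamma> (\<lambda>s. 1)) \<le> ennreal L"
    using L le_less_trans[OF L] by auto
  show "arc_integrable \<Gamma> (\<lambda>s. 1)" by fact
  show "arc_integral \<Gamma> (\<lambda>s. 1) \<le> max 0 L"
    using *(2) by (cases "0 \<le> L") (auto simp: ennreal_le_iff ennreal_neg)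
qed

lemma set_borel_measurable_restrict:
  fixes f :: "real \<Rightarrow> 'v::euclidean_space"
  assumes "J \<in> sets lebesgue"
  shows "set_borel_measurable lebesgue J f \<longleftrightarrow> f \<in> borel_measurable (restrict_space lebesgue J)"
  using assms by (simp add: set_borel_measurable_def borel_measurable_restrict_space_iff)

text \<open>Translates the set integrals in the definition of the L2 norm into integrals over the
  restricted measure.\<close>

lemma contour_L2_arc_integrable:
  assumes reg: "\<And>\<kappa>. \<kappa> \<in> set \<Gamma> \<Longrightarrow> regular_curve \<kappa>" and f: "contour_L2 \<Gamma> f"
  shows "arc_integrable \<Gamma> (\<lambda>s. (norm (f s))\<^sup>2)"
    and "contour_L2norm \<Gamma> f = sqrt (arc_integral \<Gamma> (\<lambda>s. (norm (f s))\<^sup>2))"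
    and "\<And>J \<gamma>. (J, \<gamma>) \<in> set \<Gamma> \<Longrightarrow> (\<lambda>t. f (\<gamma> t)) \<in> borel_measurable (restrict_space lebesgue J)"
proof -
  show "arc_integrable \<Gamma> (\<lambda>s. (norm (f s))\<^sup>2)"
    using assms unfolding arc_integrable_def contour_L2_def
    by (auto 0 4 simp: regular_curve_def set_integrable_def integrable_restrict_space split: prod.splits)
  show "contour_L2norm \<Gamma> f = sqrt (arc_integral \<Gamma> (\<lambda>s. (norm (f s))\<^sup>2))"
    unfolding contour_L2norm_def arc_integral_def
    using reg
    by (intro arg_cong[of _ _ sqrt] arg_cong[of _ _ sum_list] map_cong refl)
       (auto simp: regular_curve_def integral_restrict_space set_lebesgue_integral_def split: prod.splits)
  show "(\<lambda>t. f (\<gamma> t)) \<in> borel_measurable (restrict_space lebesgue J)" if "(J, \<gamma>) \<in> set \<Gamma>" for J \<gamma>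
    using assms that set_borel_measurable_restrict[of J "\<lambda>t. f (\<gamma> t)"]
    by (auto simp: contour_L2_def regular_curve_def)
qed

lemma borel_measurable_bilinear:
  fixes f :: "'u::euclidean_space \<Rightarrow> 'v::euclidean_space \<Rightarrow> 'w::euclidean_space"
  assumes "bounded_bilinear f" "u \<in> borel_measurable M" "v \<in> borel_measurable M"
  shows "(\<lambda>t. f (u t) (v t)) \<in> borel_measurable M"
  by (rule borel_measurable_continuous_Pair[OF assms(2,3)])
     (intro bounded_bilinear.continuous_on[OF assms(1)] continuous_intros)

section \<open>Differences of Cauchy integrals\<close>

text \<open>The difference of the kernels is (x - y) / ((s - x) (s - y)), and |s - x| \<ge> |s| / 2
  for |x| \<le> \<delta> / 2 \<le> |s| / 2, so it is at most 4 |x - y| / |s|^2. One power of |s| is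
  absorbed by the weight in the bound on h, the other by \<delta>. The weight leaves room for h to
  be compared with |s| times an integrable function on contours of infinite length.\<close>

lemma curve_integral_difference:
  fixes h :: "complex \<Rightarrow> complex^'n^'m"
  assumes reg: "regular_curve (J, \<gamma>)"
    and hm: "(\<lambda>t. h (\<gamma> t)) \<in> borel_measurable (restrict_space lebesgue J)"
    and f: "integrable (restrict_space lebesgue J) (\<lambda>t. f (\<gamma> t) * norm (vector_derivative \<gamma> (at t within J)))"
    and \<delta>: "0 < \<delta>" "\<And>t. t \<in> J \<Longrightarrow> \<delta> \<le> norm (\<gamma> t)"
    and hf: "\<And>t. t \<in> J \<Longrightarrow> norm (h (\<gamma> t)) \<le> norm (\<gamma> t) * f (\<gamma> t)"
    and x: "norm x \<le> \<delta> / 2" and y: "norm y \<le> \<delta> / 2"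
  shows "norm ((LINT t:J|lebesgue. vector_derivative \<gamma> (at t within J) *\<^sub>C (1 / (\<gamma> t - x)) *\<^sub>C h (\<gamma> t))
      - (LINT t:J|lebesgue. vector_derivative \<gamma> (at t within J) *\<^sub>C (1 / (\<gamma> t - y)) *\<^sub>C h (\<gamma> t)))
    \<le> 4 * norm (x - y) / \<delta> *
      integral\<^sup>L (restrict_space lebesgue J) (\<lambda>t. f (\<gamma> t) * norm (vector_derivative \<gamma> (at t within J)))"
proof -
  let ?\<mu> = "restrict_space lebesgue J"
  define v where "v = (\<lambda>t. vector_derivative \<gamma> (at t within J))"
  define g where "g = (\<lambda>z t. v t *\<^sub>C (1 / (\<gamma> t - z)) *\<^sub>C h (\<gamma> t))"
  have J: "J \<in> sets lebesgue" and meas: "\<gamma> \<in> borel_measurable ?\<mu>" "v \<in> borel_measurable ?\<mu>"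
    using reg by (simp_all add: regular_curve_def v_def)
  have LINT: "(LINT t:J|lebesgue. w t) = integral\<^sup>L ?\<mu> w" for w :: "real \<Rightarrow> complex^'n^'m"
    using J by (simp add: set_lebesgue_integral_def integral_restrict_space)
  have sp: "t \<in> J" if "t \<in> space ?\<mu>" for t using that by (simp add: space_restrict_space)
  have far: "0 < norm (\<gamma> t)" "norm (\<gamma> t) / 2 \<le> norm (\<gamma> t - z)" if "t \<in> J" "norm z \<le> \<delta> / 2" for t z
  proof -
    show "0 < norm (\<gamma> t)" using \<delta>(2)[OF that(1)] \<delta>(1) by linarith
    have "norm (\<gamma> t) \<le> norm (\<gamma> t - z) + norm z" by norm
    then show "norm (\<gamma> t) / 2 \<le> norm (\<gamma> t - z)" using \<delta>(2)[OF that(1)] that(2) by linarith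
  qed
  have inv: "norm (1 / (\<gamma> t - z)) \<le> 2 / norm (\<gamma> t)" if "t \<in> J" "norm z \<le> \<delta> / 2" for t z
  proof -
    have "1 / norm (\<gamma> t - z) \<le> 1 / (norm (\<gamma> t) / 2)"
      using far[OF that] by (intro divide_left_mono mult_pos_pos) linarith+
    then show ?thesis by (simp add: norm_divide)
  qed
  have int: "integrable ?\<mu> (g z)" if z: "norm z \<le> \<delta> / 2" for z
  proof (rule Bochner_Integration.integrable_bound)
    show "integrable ?\<mu> (\<lambda>t. 2 * (f (\<gamma> t) * norm (v t)))" using f by (simp add: v_def)
    show "g z \<in> borel_measurable ?\<mu>"
      unfolding g_def
      by (intro borel_measurable_bilinear[OF bounded_bilinear_cscale] meas hm borel_measurable_divide
          borel_measurable_diff borel_measurable_const)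
    have "norm (g z t) \<le> norm (2 * (f (\<gamma> t) * norm (v t)))" if t: "t \<in> J" for t
    proof -
      have "norm (1 / (\<gamma> t - z)) * norm (h (\<gamma> t)) \<le> 2 / norm (\<gamma> t) * (norm (\<gamma> t) * f (\<gamma> t))"
        by (intro mult_mono inv hf t z) auto
      also have "\<dots> = 2 * f (\<gamma> t)" using far(1)[OF t z] by simp
      finally have "norm (g z t) \<le> norm (v t) * (2 * f (\<gamma> t))"
        unfolding g_def norm_cscale by (intro mult_left_mono) auto
      then show ?thesis by (simp add: algebra_simps)
    qed
    then show "AE t in ?\<mu>. norm (g z t) \<le> norm (2 * (f (\<gamma> t) * norm (v t)))"
      using sp by (intro AE_I2) auto
  qed
  have "norm (g x t - g y t) \<le> 4 * norm (x - y) / \<delta> * (f (\<gamma> t) * norm (v t))" if t: "t \<in> J" for t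
  proof -
    note n0 = far[OF t x] far[OF t y]
    have "1 / (\<gamma> t - x) - 1 / (\<gamma> t - y) = (x - y) * (1 / (\<gamma> t - x)) * (1 / (\<gamma> t - y))"
    proof -
      have "\<gamma> t - x \<noteq> 0" "\<gamma> t - y \<noteq> 0" using n0 by auto
      then show ?thesis by (simp add: divide_simps)
    qed
    then have "norm (1 / (\<gamma> t - x) - 1 / (\<gamma> t - y)) = norm (x - y) * norm (1 / (\<gamma> t - x)) * norm (1 / (\<gamma> t - y))"
      by (simp only: norm_mult)
    also have "\<dots> \<le> norm (x - y) * (2 / norm (\<gamma> t)) * (2 / norm (\<gamma> t))"
      by (intro mult_mono inv t x y) auto
    finally have "norm (1 / (\<gamma> t - x) - 1 / (\<gamma> t - y)) * norm (h (\<gamma> t))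
        \<le> (norm (x - y) * (2 / norm (\<gamma> t)) * (2 / norm (\<gamma> t))) * (norm (\<gamma> t) * f (\<gamma> t))"
      by (intro mult_mono hf t) auto
    also have "\<dots> = 4 * norm (x - y) * (f (\<gamma> t) / norm (\<gamma> t))"
      using n0 by simp
    \<comment> \<open>Nonnegativity of \<open>f\<close> on the curve is inherited from the bound on
      \<open>h\<close>, because |s| is positive there.\<close>
    also have "f (\<gamma> t) / norm (\<gamma> t) \<le> f (\<gamma> t) / \<delta>"
    proof -
      have "0 \<le> norm (\<gamma> t) * f (\<gamma> t)" using hf[OF t] norm_ge_zero order_trans by blast
      then have "0 \<le> f (\<gamma> t)" using n0 by (simp add: zero_le_mult_iff)
      then show ?thesis using \<delta>(1) \<delta>(2)[OF t] by (intro divide_left_mono mult_pos_pos) linarith+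
    qed
    finally have *: "norm (1 / (\<gamma> t - x) - 1 / (\<gamma> t - y)) * norm (h (\<gamma> t)) \<le> 4 * norm (x - y) * (f (\<gamma> t) / \<delta>)"
      by (simp add: mult_left_mono)
    have "g x t - g y t = v t *\<^sub>C (1 / (\<gamma> t - x) - 1 / (\<gamma> t - y)) *\<^sub>C h (\<gamma> t)"
      by (simp only: g_def cscale_algebra)
    then have "norm (g x t - g y t) = norm (v t) * (norm (1 / (\<gamma> t - x) - 1 / (\<gamma> t - y)) * norm (h (\<gamma> t)))"
      by (simp only: norm_cscale)
    also have "\<dots> \<le> norm (v t) * (4 * norm (x - y) * (f (\<gamma> t) / \<delta>))"
      by (intro mult_left_mono *) auto
    finally show ?thesis by (simp add: mult.commute mult.left_commute)
  qed
  then have "norm (integral\<^sup>L ?\<mu> (\<lambda>t. g x t - g y t))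
      \<le> integral\<^sup>L ?\<mu> (\<lambda>t. 4 * norm (x - y) / \<delta> * (f (\<gamma> t) * norm (v t)))"
    using f sp by (intro Bochner_Integration.integral_norm_bound_integral Bochner_Integration.integrable_diff int x y)
      (auto simp: v_def)
  then show ?thesis
    using int x y f by (simp add: LINT g_def v_def)
qed

lemma contour_int_difference:
  fixes h :: "complex \<Rightarrow> complex^'n^'m"
  assumes reg: "\<And>\<kappa>. \<kappa> \<in> set \<Gamma> \<Longrightarrow> regular_curve \<kappa>"
    and hm: "\<And>J \<gamma>. (J, \<gamma>) \<in> set \<Gamma> \<Longrightarrow> (\<lambda>t. h (\<gamma> t)) \<in> borel_measurable (restrict_space lebesgue J)"
    and f: "arc_integrable \<Gamma> f"
    and \<delta>: "0 < \<delta>" "\<And>s. s \<in> contour_trace \<Gamma> \<Longrightarrow> \<delta> \<le> norm s"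
    and hf: "\<And>s. s \<in> contour_trace \<Gamma> \<Longrightarrow> norm (h s) \<le> norm s * f s"
    and x: "norm x \<le> \<delta> / 2" and y: "norm y \<le> \<delta> / 2"
  shows "norm (contour_int \<Gamma> (\<lambda>s. (1 / (s - x)) *\<^sub>C h s) - contour_int \<Gamma> (\<lambda>s. (1 / (s - y)) *\<^sub>C h s))
    \<le> 4 * norm (x - y) / \<delta> * arc_integral \<Gamma> f"
  using reg hm f \<delta>(2) hf
proof (induction \<Gamma>)
  case Nil
  then show ?case by (simp add: contour_int_def arc_integral_def)
next
  case (Cons \<kappa> \<Gamma>)
  obtain J \<gamma> where \<kappa>: "\<kappa> = (J, \<gamma>)" by (cases \<kappa>)
  have tr: "contour_trace (\<kappa> # \<Gamma>) = \<gamma> ` J \<union> contour_trace \<Gamma>"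
    by (simp add: contour_trace_def curve_trace_def \<kappa>)
  have IH: "norm (contour_int \<Gamma> (\<lambda>s. (1 / (s - x)) *\<^sub>C h s) - contour_int \<Gamma> (\<lambda>s. (1 / (s - y)) *\<^sub>C h s))
    \<le> 4 * norm (x - y) / \<delta> * arc_integral \<Gamma> f"
    using Cons.prems by (intro Cons.IH) (auto simp: arc_integrable_def tr)
  have head: "norm ((LINT t:J|lebesgue. vector_derivative \<gamma> (at t within J) *\<^sub>C (1 / (\<gamma> t - x)) *\<^sub>C h (\<gamma> t))
      - (LINT t:J|lebesgue. vector_derivative \<gamma> (at t within J) *\<^sub>C (1 / (\<gamma> t - y)) *\<^sub>C h (\<gamma> t)))
    \<le> 4 * norm (x - y) / \<delta> *
      integral\<^sup>L (restrict_space lebesgue J) (\<lambda>t. f (\<gamma> t) * norm (vector_derivative \<gamma> (at t within J)))"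
    using Cons.prems unfolding tr
    by (intro curve_integral_difference \<delta>(1) x y) (auto simp: arc_integrable_def \<kappa>)
  show ?case
    using norm_triangle_mono[OF head IH]
    by (simp add: contour_int_def arc_integral_def \<kappa> algebra_simps)
qed

text \<open>\<open>FR\<close> is known only on the contour, so its measurability is transferred from
  I + X on the parameter set.\<close>

lemma contour_product_measurable:
  fixes X \<Delta> FR :: "complex \<Rightarrow> complex^'m^'m"
  assumes reg: "\<And>\<kappa>. \<kappa> \<in> set \<Gamma> \<Longrightarrow> regular_curve \<kappa>"
    and X: "contour_L2 \<Gamma> X" and \<Delta>: "contour_L2 \<Gamma> \<Delta>"
    and FR: "\<And>s. s \<in> contour_trace \<Gamma> \<Longrightarrow> FR s = mat 1 + X s" and \<kappa>: "(J, \<gamma>) \<in> set \<Gamma>"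
  shows "(\<lambda>t. FR (\<gamma> t) ** \<Delta> (\<gamma> t)) \<in> borel_measurable (restrict_space lebesgue J)"
proof -
  have "FR (\<gamma> t) = mat 1 + X (\<gamma> t)" if "t \<in> J" for t
    using that \<kappa> by (intro FR) (auto simp: contour_trace_def curve_trace_def)
  then have "(\<lambda>t. FR (\<gamma> t)) \<in> borel_measurable (restrict_space lebesgue J) \<longleftrightarrow>
      (\<lambda>t. mat 1 + X (\<gamma> t)) \<in> borel_measurable (restrict_space lebesgue J)"
    by (intro measurable_cong) (simp add: space_restrict_space)
  then have "(\<lambda>t. FR (\<gamma> t)) \<in> borel_measurable (restrict_space lebesgue J)"
    using contour_L2_arc_integrable(3)[OF reg X \<kappa>] by simp
  then show ?thesis
    by (intro borel_measurable_bilinear[OF bounded_bilinear_matrix_mult] contour_L2_arc_integrable(3)[OF reg \<Delta> \<kappa>])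
qed

text \<open>The parameter \<open>l\<close> comes from \<open>\<bar>X\<bar> \<le> l + \<bar>X\<bar>\<^sup>2 / l\<close>, which replaces the Cauchy-Schwarz inequality. On a circle of
  radius \<open>\<delta>\<close> the choice \<open>l = 1 / sqrt \<delta>\<close> is optimal.\<close>

lemma contour_int_difference_bounded_length:
  fixes X \<Delta> FR :: "complex \<Rightarrow> complex^'m^'m"
  assumes reg: "\<And>\<kappa>. \<kappa> \<in> set \<Gamma> \<Longrightarrow> regular_curve \<kappa>"
    and X: "contour_L2 \<Gamma> X" and \<Delta>: "contour_L2 \<Gamma> \<Delta>"
    and FR: "\<And>s. s \<in> contour_trace \<Gamma> \<Longrightarrow> FR s = mat 1 + X s"
    and D: "0 \<le> D" "\<And>s. s \<in> contour_trace \<Gamma> \<Longrightarrow> norm (\<Delta> s) \<le> D"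
    and \<delta>: "0 < \<delta>" "\<And>s. s \<in> contour_trace \<Gamma> \<Longrightarrow> \<delta> \<le> norm s"
    and L: "arc_integrable \<Gamma> (\<lambda>s. 1)" "arc_integral \<Gamma> (\<lambda>s. 1) \<le> L"
    and X1: "arc_integral \<Gamma> (\<lambda>s. (norm (X s))\<^sup>2) \<le> 1" and l: "0 < l"
    and xy: "norm x \<le> \<delta> / 2" "norm y \<le> \<delta> / 2"
  shows "norm (contour_int \<Gamma> (\<lambda>s. (1 / (s - x)) *\<^sub>C (FR s ** \<Delta> s)) - contour_int \<Gamma> (\<lambda>s. (1 / (s - y)) *\<^sub>C (FR s ** \<Delta> s)))
    \<le> 4 * norm (x - y) * (D / \<delta>\<^sup>2 * ((norm (mat 1 :: complex^'m^'m) + l) * L + 1 / l))"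
proof -
  define one where "one = norm (mat 1 :: complex^'m^'m)"
  \<comment> \<open>The weights make \<open>\<delta> * f s\<close> equal to (|I| + l + |X|^2 / l) D,
    which dominates the integrand; then \<delta> is replaced by |s|.\<close>
  define u where "u = D / \<delta> * (one + l)"
  define v where "v = D / \<delta> * (1 / l)"
  define f where "f = (\<lambda>s. u * 1 + v * (norm (X s))\<^sup>2)"
  have uv: "0 \<le> u" "0 \<le> v" using D(1) \<delta>(1) l by (simp_all add: u_def v_def one_def)
  have X2: "arc_integrable \<Gamma> (\<lambda>s. (norm (X s))\<^sup>2)"
    by (rule contour_L2_arc_integrable(1)[OF reg X])
  note f_arc = arc_integrable_linear[OF L(1) X2, of u v, folded f_def]
  have "norm (FR s ** \<Delta> s) \<le> norm s * f s" if s: "s \<in> contour_trace \<Gamma>" for s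
  proof -
    have "norm (X s) \<le> l + (norm (X s))\<^sup>2 / l"
    proof (cases "norm (X s) \<le> l")
      case False
      then have "norm (X s) * l \<le> norm (X s) * norm (X s)" by (intro mult_left_mono) auto
      then have "norm (X s) \<le> (norm (X s))\<^sup>2 / l" using l by (simp add: field_simps power2_eq_square)
      then show ?thesis using l by linarith
    qed (use l in \<open>auto intro: add_increasing2\<close>)
    then have "norm (FR s) \<le> one + (l + (norm (X s))\<^sup>2 / l)"
      using norm_triangle_ineq[of "mat 1" "X s"] by (simp add: FR s one_def)
    then have "norm (FR s ** \<Delta> s) \<le> (one + (l + (norm (X s))\<^sup>2 / l)) * D"
      by (intro norm_matrix_mult_mono D(2) s)
    also have "\<dots> = \<delta> * f s"
      using \<delta>(1) by (simp add: f_def u_def v_def field_simps)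
    also have "\<dots> \<le> norm s * f s"
      using \<delta>(2)[OF s] uv by (intro mult_right_mono) (auto simp: f_def)
    finally show ?thesis .
  qed
  from contour_int_difference[OF reg contour_product_measurable[OF reg X \<Delta> FR] f_arc(1) \<delta> this xy]
  have "norm (contour_int \<Gamma> (\<lambda>s. (1 / (s - x)) *\<^sub>C (FR s ** \<Delta> s)) - contour_int \<Gamma> (\<lambda>s. (1 / (s - y)) *\<^sub>C (FR s ** \<Delta> s)))
    \<le> 4 * norm (x - y) / \<delta> * arc_integral \<Gamma> f" by simp
  also have "\<dots> \<le> 4 * norm (x - y) / \<delta> * (u * L + v * 1)"
    unfolding f_arc(2) using uv \<delta>(1) by (intro mult_left_mono add_mono L X1) auto
  also have "\<dots> = 4 * norm (x - y) * (D / \<delta>\<^sup>2 * ((one + l) * L + 1 / l))"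
    by (simp add: u_def v_def power2_eq_square algebra_simps add_divide_distrib)
  finally show ?thesis unfolding one_def .
qed

text \<open>Without a bound on the length, integrability has to come from three L2 functions. With a
  b \<le> a^2 + b^2, the term |\<Delta>| = |s| |1/s| |\<Delta>| is at most |s| (|1/s|^2 +
  |\<Delta>|^2), and |X| |\<Delta>| is at most (|s| / r) (|X|^2 + |\<Delta>|^2) because |s| \<ge>
  r.\<close>

lemma contour_int_difference_unbounded:
  fixes X \<Delta> FR :: "complex \<Rightarrow> complex^'m^'m"
  assumes reg: "\<And>\<kappa>. \<kappa> \<in> set \<Gamma> \<Longrightarrow> regular_curve \<kappa>"
    and X: "contour_L2 \<Gamma> X" and \<Delta>: "contour_L2 \<Gamma> \<Delta>" and inv: "contour_L2 \<Gamma> inverse"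
    and FR: "\<And>s. s \<in> contour_trace \<Gamma> \<Longrightarrow> FR s = mat 1 + X s"
    and r: "0 < r" "\<And>s. s \<in> contour_trace \<Gamma> \<Longrightarrow> r \<le> norm s"
    and X1: "arc_integral \<Gamma> (\<lambda>s. (norm (X s))\<^sup>2) \<le> 1"
    and \<Delta>1: "arc_integral \<Gamma> (\<lambda>s. (norm (\<Delta> s))\<^sup>2) \<le> 1"
    and M: "arc_integral \<Gamma> (\<lambda>s. (norm (inverse s))\<^sup>2) \<le> M"
    and xy: "norm x \<le> r / 2" "norm y \<le> r / 2"
  shows "norm (contour_int \<Gamma> (\<lambda>s. (1 / (s - x)) *\<^sub>C (FR s ** \<Delta> s)) - contour_int \<Gamma> (\<lambda>s. (1 / (s - y)) *\<^sub>C (FR s ** \<Delta> s)))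
    \<le> 4 * norm (x - y) * ((norm (mat 1 :: complex^'m^'m) * (1 + M) + 2 / r) / r)"
proof -
  define one where "one = norm (mat 1 :: complex^'m^'m)"
  have one: "0 \<le> one" by (simp add: one_def)
  define f1 where "f1 = (\<lambda>s. one * (norm (inverse s))\<^sup>2 + 1 / r * (norm (X s))\<^sup>2)"
  define f where "f = (\<lambda>s. 1 * f1 s + (one + 1 / r) * (norm (\<Delta> s))\<^sup>2)"
  have L2: "arc_integrable \<Gamma> (\<lambda>s. (norm (inverse s))\<^sup>2)" "arc_integrable \<Gamma> (\<lambda>s. (norm (X s))\<^sup>2)"
      "arc_integrable \<Gamma> (\<lambda>s. (norm (\<Delta> s))\<^sup>2)"
    by (rule contour_L2_arc_integrable(1)[OF reg], assumption, fact)+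
  note f1_arc = arc_integrable_linear[OF L2(1,2), of one "1 / r", folded f1_def]
  note f_arc = arc_integrable_linear[OF f1_arc(1) L2(3), of 1 "one + 1 / r", folded f_def]
  have "norm (FR s ** \<Delta> s) \<le> norm s * f s" if s: "s \<in> contour_trace \<Gamma>" for s
  proof -
    have s0: "0 < norm s" "r \<le> norm s" using r(1) r(2)[OF s] by linarith+
    have prod: "a * b \<le> a\<^sup>2 + b\<^sup>2" for a b :: real
      using sum_squares_bound[of a b] zero_le_power2[of a] zero_le_power2[of b] by linarith
    have "norm (FR s) \<le> one + norm (X s)"
      using norm_triangle_ineq[of "mat 1" "X s"] by (simp add: FR s one_def)
    then have "norm (FR s ** \<Delta> s) \<le> (one + norm (X s)) * norm (\<Delta> s)"
      by (intro norm_matrix_mult_mono) auto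
    also have "\<dots> = one * (norm s * (norm (inverse s) * norm (\<Delta> s))) + 1 * (norm (X s) * norm (\<Delta> s))"
      using s0 by (simp add: algebra_simps norm_inverse)
    also have "\<dots> \<le> one * (norm s * ((norm (inverse s))\<^sup>2 + (norm (\<Delta> s))\<^sup>2))
        + norm s / r * ((norm (X s))\<^sup>2 + (norm (\<Delta> s))\<^sup>2)"
      using one s0 r(1) by (intro add_mono mult_mono mult_left_mono prod) auto
    also have "\<dots> = norm s * f s"
      by (simp add: f_def f1_def algebra_simps)
    finally show ?thesis .
  qed
  from contour_int_difference[OF reg contour_product_measurable[OF reg X \<Delta> FR] f_arc(1) r this xy]
  have "norm (contour_int \<Gamma> (\<lambda>s. (1 / (s - x)) *\<^sub>C (FR s ** \<Delta> s)) - contour_int \<Gamma> (\<lambda>s. (1 / (s - y)) *\<^sub>C (FR s ** \<Delta> s)))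
    \<le> 4 * norm (x - y) / r * arc_integral \<Gamma> f" by simp
  also have "\<dots> \<le> 4 * norm (x - y) / r * (1 * (one * M + 1 / r * 1) + (one + 1 / r) * 1)"
    unfolding f_arc(2) f1_arc(2) using one r(1) by (intro mult_left_mono add_mono M X1 \<Delta>1) auto
  also have "\<dots> = 4 * norm (x - y) * ((one * (1 + M) + 2 / r) / r)"
    by (simp add: algebra_simps add_divide_distrib)
  finally show ?thesis unfolding one_def .
qed

text \<open>Substituting t = n^\<gamma> reduces the claim to exponential decay in t itself.\<close>

lemma exp_decay_dominates_powr:
  fixes \<alpha> \<gamma> q :: real
  assumes "0 < \<alpha>" "0 < \<gamma>"
  shows "(\<lambda>n. exp (- \<alpha> * real n powr \<gamma>) * real n powr q) \<longlonglongrightarrow> 0"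
proof -
  have "((\<lambda>t. exp (- \<alpha> * t) * t powr (q / \<gamma>)) \<longlongrightarrow> 0) at_top"
    using assms(1) by real_asymp
  moreover have "filterlim (\<lambda>n. real n powr \<gamma>) at_top sequentially"
    using assms(2) by real_asymp
  ultimately have "(\<lambda>n. exp (- \<alpha> * real n powr \<gamma>) * (real n powr \<gamma>) powr (q / \<gamma>)) \<longlonglongrightarrow> 0"
    by (rule filterlim_compose)
  then show ?thesis using assms(2) by (simp add: powr_powr)
qed

lemma contour_int_append: "contour_int (\<Gamma> @ \<Gamma>') g = contour_int \<Gamma> g + contour_int \<Gamma>' g"
  by (simp add: contour_int_def)

section \<open>The difference of two values of \<open>R\<close>\<close>

text \<open>For a = 0 the circle has radius 1 for all n \<ge> 1, which is where r > 1 enters;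
  otherwise it shrinks to 0.\<close>

lemma circle_radius_less:
  fixes a r :: real
  assumes "0 \<le> a" "0 < r" "a = 0 \<Longrightarrow> 1 < r"
  shows "\<forall>\<^sub>F n in sequentially. real n powr - a < r"
proof (cases "a = 0")
  case True
  then show ?thesis using assms(3) by (auto intro!: eventually_mono[OF eventually_gt_at_top[of 0]])
next
  case False
  then have "(\<lambda>n. real n powr - a) \<longlonglongrightarrow> 0" using assms(1) by real_asymp
  then show ?thesis by (rule order_tendstoD) (fact assms(2))
qed

lemma unif_bigoD:
  assumes "unif_bigo S X g"
  obtains M where "0 \<le> M" "\<forall>\<^sub>F n in sequentially. \<forall>z\<in>S n. norm (X n z) \<le> M * norm (g n z)"
proof -
  from assms obtain M where M: "\<forall>\<^sub>F n in sequentially. \<forall>z\<in>S n. norm (X n z) \<le> M * norm (g n z)"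
    unfolding unif_bigo_def by blast
  have "M * norm (g n z) \<le> \<bar>M\<bar> * norm (g n z)" for n z by (intro mult_right_mono) auto
  then have "\<forall>\<^sub>F n in sequentially. \<forall>z\<in>S n. norm (X n z) \<le> \<bar>M\<bar> * norm (g n z)"
    using M by (auto elim!: eventually_mono intro: order_trans)
  then show ?thesis using that[of "\<bar>M\<bar>"] by simp
qed

text \<open>Each part of the contour has its own reason to be harmless. On the inner circle \<Delta>
  = O(n^(d-c)) meets the order n^(3a/2) of the kernel; on the inner arcs \<Delta> decays faster than
  any power of n, which outweighs both their polynomial length and the kernel; on the circle of
  radius r it is bounded because d \<le> b; and the outer arcs are handled by L2 norms.\<close>

lemma Cauchy_transform_difference:
  fixes a b c d r \<alpha> \<beta> \<kappa> :: real
    and R \<Delta> FR X :: "nat \<Rightarrow> complex \<Rightarrow> complex^'m^'m"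
    and \<Gamma> \<Gamma>r \<Gamma>inf :: "nat \<Rightarrow> curve list"
  assumes a: "0 \<le> a" and r: "0 < r" "a = 0 \<Longrightarrow> 1 < r" and db: "d \<le> b"
    and \<Gamma>_eq: "\<And>n. \<Gamma> n = circle_curve (real n powr - a) # \<Gamma>r n @ circle_curve r # \<Gamma>inf n"
    and \<Gamma>r_contour: "\<forall>\<^sub>F n in sequentially. is_contour (\<Gamma>r n) \<and>
      contour_trace (\<Gamma>r n) \<subseteq> {z. real n powr - a < norm z \<and> norm z < r}"
    and \<Gamma>inf_contour: "\<forall>\<^sub>F n in sequentially. is_contour (\<Gamma>inf n) \<and>
      contour_trace (\<Gamma>inf n) \<subseteq> {z. r < norm z}"
    and \<Gamma>r_length: "\<exists>M. \<forall>\<^sub>F n in sequentially. contour_length (\<Gamma>r n) \<le> ennreal (M * real n powr \<kappa>)"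
    and \<Gamma>inf_inverse: "\<exists>M. \<forall>\<^sub>F n in sequentially.
      contour_L2 (\<Gamma>inf n) inverse \<and> contour_L2norm (\<Gamma>inf n) inverse \<le> M"
    and R_eq: "\<forall>\<^sub>F n in sequentially. \<forall>z. z \<notin> contour_trace (\<Gamma> n) \<longrightarrow>
      R n z = mat 1 + (1 / (2 * of_real pi * \<i>)) *\<^sub>C
        contour_int (\<Gamma> n) (\<lambda>s. (1 / (s - z)) *\<^sub>C (FR n s ** \<Delta> n s))"
    and \<Delta>_L2: "\<forall>\<^sub>F n in sequentially. contour_L2 (\<Gamma> n) (\<Delta> n)"
    and \<alpha>\<beta>: "0 < \<alpha>" "0 < \<beta>" "a > 0 \<Longrightarrow> \<beta> < 1 / a"
    and \<Delta>_a: "unif_bigo (\<lambda>n. sphere 0 (real n powr - a)) \<Delta> (\<lambda>n z. real n powr (d - c))"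
    and \<Delta>_r: "unif_bigo (\<lambda>n. sphere 0 r) \<Delta> (\<lambda>n z. real n powr (d - b))"
    and \<Delta>_\<Gamma>r: "unif_bigo (\<lambda>n. contour_trace (\<Gamma>r n)) \<Delta>
      (\<lambda>n z. exp (- \<alpha> * real n * norm z powr \<beta>))"
    and \<Delta>_L2_0: "(\<lambda>n. contour_L2norm (\<Gamma> n) (\<Delta> n)) \<longlonglongrightarrow> 0"
    and FR_eq: "\<forall>\<^sub>F n in sequentially. \<forall>s\<in>contour_trace (\<Gamma> n). FR n s = mat 1 + X n s"
    and X_L2: "\<forall>\<^sub>F n in sequentially. contour_L2 (\<Gamma> n) (X n)"
    and X_L2_0: "(\<lambda>n. contour_L2norm (\<Gamma> n) (X n)) \<longlonglongrightarrow> 0"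
  shows "\<exists>M\<ge>0. \<forall>\<^sub>F n in sequentially. \<forall>x y. norm x \<le> real n powr - a / 2 \<longrightarrow>
    norm y \<le> real n powr - a / 2 \<longrightarrow>
    x \<notin> contour_trace (\<Gamma> n) \<and> y \<notin> contour_trace (\<Gamma> n) \<and>
    norm (R n x - R n y) \<le> M * (1 + real n powr (3 / 2 * a + d - c)) * norm (x - y)"
proof -
  define \<rho> where "\<rho> = (\<lambda>n. real n powr - a)"
  define one where "one = norm (mat 1 :: complex^'m^'m)"
  have one0: "0 \<le> one" by (simp add: one_def)
  obtain Ma where Ma: "0 \<le> Ma"
      "\<forall>\<^sub>F n in sequentially. \<forall>s\<in>sphere 0 (\<rho> n). norm (\<Delta> n s) \<le> Ma * real n powr (d - c)"
    using unif_bigoD[OF \<Delta>_a] by (auto simp: \<rho>_def)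
  obtain Mr where Mr: "0 \<le> Mr"
      "\<forall>\<^sub>F n in sequentially. \<forall>s\<in>sphere 0 r. norm (\<Delta> n s) \<le> Mr * real n powr (d - b)"
    using unif_bigoD[OF \<Delta>_r] by auto
  obtain Me where Me: "0 \<le> Me" "\<forall>\<^sub>F n in sequentially. \<forall>s\<in>contour_trace (\<Gamma>r n).
      norm (\<Delta> n s) \<le> Me * exp (- \<alpha> * real n * norm s powr \<beta>)"
    using unif_bigoD[OF \<Delta>_\<Gamma>r] by auto
  obtain Ml where Ml: "\<forall>\<^sub>F n in sequentially. contour_length (\<Gamma>r n) \<le> ennreal (Ml * real n powr \<kappa>)"
    using \<Gamma>r_length by blast
  obtain Mi where Mi: "\<forall>\<^sub>F n in sequentially.
      contour_L2 (\<Gamma>inf n) inverse \<and> contour_L2norm (\<Gamma>inf n) inverse \<le> Mi"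
    using \<Gamma>inf_inverse by blast
  \<comment> \<open>On the inner arcs |s| > n^(-a), so n |s|^\<beta> is at least n^(1 - a \<beta>).
    The restriction \<beta> < 1/a is exactly positivity of this exponent.\<close>
  define \<gamma> where "\<gamma> = 1 - a * \<beta>"
  have \<gamma>: "0 < \<gamma>"
  proof (cases "a = 0")
    case False
    then show ?thesis using a \<alpha>\<beta>(3) by (simp add: \<gamma>_def field_simps)
  qed (simp add: \<gamma>_def)
  \<comment> \<open>This is the bound for the inner arcs with l = 1, up to the factor
    \<open>Me\<close>: decay of \<Delta>, times n^(2a) from the kernel, times
    \<open>(one + 1) * L + 1\<close>.\<close>
  have "(\<lambda>n. (one + 1) * \<bar>Ml\<bar> * (exp (- \<alpha> * real n powr \<gamma>) * real n powr (2 * a + \<kappa>))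
      + exp (- \<alpha> * real n powr \<gamma>) * real n powr (2 * a)) \<longlonglongrightarrow> (one + 1) * \<bar>Ml\<bar> * 0 + 0"
    by (intro tendsto_intros exp_decay_dominates_powr \<alpha>\<beta>(1) \<gamma>)
  then have decay: "\<forall>\<^sub>F n in sequentially. (one + 1) * \<bar>Ml\<bar> * (exp (- \<alpha> * real n powr \<gamma>) * real n powr (2 * a + \<kappa>))
      + exp (- \<alpha> * real n powr \<gamma>) * real n powr (2 * a) < 1"
    by (rule order_tendstoD) simp
  have L2_le_1: "\<forall>\<^sub>F n in sequentially. contour_L2norm (\<Gamma> n) (X n) < 1"
      "\<forall>\<^sub>F n in sequentially. contour_L2norm (\<Gamma> n) (\<Delta> n) < 1"
    by (rule order_tendstoD[OF X_L2_0] order_tendstoD[OF \<Delta>_L2_0], simp)+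
  have radius: "\<forall>\<^sub>F n in sequentially. real n powr - a < r"
    by (rule circle_radius_less) fact+
  define Ba where "Ba = 4 * Ma * (2 * pi * one + 2 * pi + 1)"
  define Br where "Br = 4 * (Mr / r\<^sup>2 * ((one + 1) * (2 * pi * r) + 1))"
  define Binf where "Binf = 4 * ((one * (1 + Mi\<^sup>2) + 2 / r) / r)"
  define M where "M = Ba + 4 * Me + Br + Binf"
  have B0: "0 \<le> Ba" "0 \<le> Br" "0 \<le> Binf"
    using Ma(1) Mr(1) one0 r(1) by (simp_all add: Ba_def Br_def Binf_def)
  then have "0 \<le> M" using Me(1) by (simp add: M_def)
  moreover have "\<forall>\<^sub>F n in sequentially. \<forall>x y. norm x \<le> \<rho> n / 2 \<longrightarrow> norm y \<le> \<rho> n / 2 \<longrightarrow>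
    x \<notin> contour_trace (\<Gamma> n) \<and> y \<notin> contour_trace (\<Gamma> n) \<and>
    norm (R n x - R n y) \<le> M * (1 + real n powr (3 / 2 * a + d - c)) * norm (x - y)"
    using \<Gamma>r_contour \<Gamma>inf_contour R_eq \<Delta>_L2 FR_eq X_L2 Ma(2) Mr(2) Me(2) Ml Mi decay L2_le_1
      radius eventually_gt_at_top[of 0]
  proof eventually_elim
    case (elim n)
    have n: "0 < n" "1 \<le> real n" using elim by auto
    have \<rho>: "0 < \<rho> n" "\<rho> n < r" using elim n by (simp_all add: \<rho>_def)
    have \<rho>_sq: "(\<rho> n)\<^sup>2 = real n powr (- (2 * a))"
      using n by (simp add: \<rho>_def powr_power mult.commute)
    let ?ca = "[circle_curve (\<rho> n)]" and ?cr = "[circle_curve r]"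
    have \<Gamma>: "\<Gamma> n = ?ca @ \<Gamma>r n @ ?cr @ \<Gamma>inf n" by (simp add: \<Gamma>_eq \<rho>_def)
    have reg: "regular_curve \<kappa>'" if "\<kappa>' \<in> set (\<Gamma> n)" for \<kappa>'
      using that elim(1,2) by (auto simp: \<Gamma> is_contour_def intro: circle_curve_regular smooth_curve_regular)
    have tr: "contour_trace (\<Gamma> n) = contour_trace ?ca \<union> contour_trace (\<Gamma>r n) \<union> contour_trace ?cr \<union> contour_trace (\<Gamma>inf n)"
      by (auto simp: \<Gamma> contour_trace_def)
    have tr_a: "contour_trace ?ca \<subseteq> sphere 0 (\<rho> n)" and tr_c: "contour_trace ?cr \<subseteq> sphere 0 r"
      using \<rho> by (auto intro!: circle_curve_trace)
    have tr_r: "contour_trace (\<Gamma>r n) \<subseteq> {z. \<rho> n < norm z \<and> norm z < r}"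
      and tr_inf: "contour_trace (\<Gamma>inf n) \<subseteq> {z. r < norm z}"
      using elim(1,2) by (auto simp: \<rho>_def)
    have off: "z \<notin> contour_trace (\<Gamma> n)" if "norm z \<le> \<rho> n / 2" for z
    proof
      assume "z \<in> contour_trace (\<Gamma> n)"
      then have "\<rho> n \<le> norm z"
        using tr tr_a tr_c tr_r tr_inf \<rho> by (auto simp: subset_iff)
      then show False using that \<rho> by simp
    qed
    \<comment> \<open>The squared L2 norm is a sum of nonnegative contributions, so a bound for the
      whole contour holds for each of its four parts.\<close>
    have piece: "contour_L2 \<Gamma>' g \<and> arc_integral \<Gamma>' (\<lambda>s. (norm (g s))\<^sup>2) \<le> 1"
      if "contour_L2 (\<Gamma> n) g" "contour_L2norm (\<Gamma> n) g < 1" "\<Gamma>' \<in> {?ca, \<Gamma>r n, ?cr, \<Gamma>inf n}"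
      for \<Gamma>' and g :: "complex \<Rightarrow> complex^'m^'m"
    proof
      have "set \<Gamma>' \<subseteq> set (\<Gamma> n)" using that(3) by (auto simp: \<Gamma>)
      then show "contour_L2 \<Gamma>' g" using that(1) by (auto simp: contour_L2_def)
      have "sqrt (arc_integral (\<Gamma> n) (\<lambda>s. (norm (g s))\<^sup>2)) < 1"
        using contour_L2_arc_integrable(2)[OF reg that(1)] that(2) by simp
      then have "arc_integral (\<Gamma> n) (\<lambda>s. (norm (g s))\<^sup>2) < 1" by simp
      moreover have "0 \<le> arc_integral \<Gamma>'' (\<lambda>s. (norm (g s))\<^sup>2)" for \<Gamma>''
        by (rule arc_integral_nonneg) simp
      note this[of ?ca] this[of "\<Gamma>r n"] this[of ?cr] this[of "\<Gamma>inf n"]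
      ultimately show "arc_integral \<Gamma>' (\<lambda>s. (norm (g s))\<^sup>2) \<le> 1"
        using that(3) unfolding \<Gamma> arc_integral_append by auto
    qed
    note X = piece[OF elim(6) elim(13)] and \<Delta> = piece[OF elim(4) elim(14)]
    define I where "I = (\<lambda>\<Gamma>' z. contour_int \<Gamma>' (\<lambda>s. (1 / (s - z)) *\<^sub>C (FR n s ** \<Delta> n s)))"
    show ?case
    proof (intro allI impI conjI off)
      fix x y :: complex
      assume x: "norm x \<le> \<rho> n / 2" and y: "norm y \<le> \<rho> n / 2"
      have xy_r: "norm x \<le> r / 2" "norm y \<le> r / 2" using x y \<rho> by simp_all
      let ?N = "real n powr (3 / 2 * a + d - c)"
      have Ia: "norm (I ?ca x - I ?ca y) \<le> Ba * ?N * norm (x - y)"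
      proof -
        \<comment> \<open>With radius n^(-a) this choice makes both \<open>\<rho> n * l\<close> and
          \<open>1 / l\<close> equal to n^(-a/2). Together with the kernel factor n^(2a) they
          produce the exponent 3a/2.\<close>
        define l where "l = real n powr (a / 2)"
        have l: "0 < l" using n by (simp add: l_def)
        have "norm (I ?ca x - I ?ca y) \<le> 4 * norm (x - y) *
            ((Ma * real n powr (d - c)) / (\<rho> n)\<^sup>2 * ((one + l) * (2 * pi * \<rho> n) + 1 / l))"
          unfolding I_def one_def
        proof (rule contour_int_difference_bounded_length[where X = "X n"])
          show "norm (\<Delta> n s) \<le> Ma * real n powr (d - c)" if "s \<in> contour_trace ?ca" for s
            using elim(7) that tr_a by auto
          show "\<rho> n \<le> norm s" if "s \<in> contour_trace ?ca" for s
            using that tr_a by auto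
        qed (use X \<Delta> elim(5) tr Ma(1) \<rho> arc_integrable_circle l x y in \<open>auto intro: circle_curve_regular\<close>)
        also have "\<dots> \<le> 4 * norm (x - y) *
            ((Ma * real n powr (d - c)) / (\<rho> n)\<^sup>2 * ((2 * pi * one + 2 * pi + 1) * (1 / l)))"
        proof -
          have "\<rho> n * l = 1 / l"
            by (simp add: \<rho>_def l_def powr_add[symmetric] powr_minus_divide[symmetric])
          moreover have "real n powr - a \<le> real n powr - (a / 2)"
            using n a by (intro powr_mono) auto
          then have "\<rho> n \<le> 1 / l"
            by (simp add: \<rho>_def l_def powr_minus_divide)
          ultimately have \<rho>l: "\<rho> n * l = 1 / l" "\<rho> n \<le> 1 / l" by simp_all
          have "(one + l) * (2 * pi * \<rho> n) + 1 / l = 2 * pi * one * \<rho> n + 2 * pi * (\<rho> n * l) + 1 / l"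
            by (simp add: algebra_simps)
          also have "\<dots> \<le> 2 * pi * one * (1 / l) + 2 * pi * (1 / l) + 1 / l"
            unfolding \<rho>l(1) using one0 by (intro add_right_mono mult_left_mono \<rho>l(2)) auto
          also have "\<dots> = (2 * pi * one + 2 * pi + 1) * (1 / l)" by (simp only: distrib_right mult_1_left)
          finally have "(one + l) * (2 * pi * \<rho> n) + 1 / l \<le> (2 * pi * one + 2 * pi + 1) * (1 / l)" .
          then show ?thesis
            using Ma(1) by (intro mult_left_mono) auto
        qed
        also have "\<dots> = Ba * (real n powr (d - c) / (\<rho> n)\<^sup>2 * (1 / l)) * norm (x - y)"
          by (simp add: Ba_def)
        also have "real n powr (d - c) / (\<rho> n)\<^sup>2 * (1 / l) = ?N"
        proof -
          have "1 / l = real n powr (- (a / 2))" by (simp add: l_def powr_minus_divide)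
          then have "real n powr (d - c) / (\<rho> n)\<^sup>2 * (1 / l) = real n powr ((d - c) - (- (2 * a)) + - (a / 2))"
            by (simp only: \<rho>_sq powr_diff[symmetric] powr_add[symmetric])
          then show ?thesis by (simp add: algebra_simps)
        qed
        finally show ?thesis .
      qed
      have Ir: "norm (I (\<Gamma>r n) x - I (\<Gamma>r n) y) \<le> 4 * Me * norm (x - y)"
      proof -
        define D where "D = Me * exp (- \<alpha> * real n powr \<gamma>)"
        define L where "L = max 0 (Ml * real n powr \<kappa>)"
        have regr: "regular_curve \<kappa>'" if "\<kappa>' \<in> set (\<Gamma>r n)" for \<kappa>'
          using that reg by (simp add: \<Gamma>)
        have "norm (I (\<Gamma>r n) x - I (\<Gamma>r n) y) \<le> 4 * norm (x - y) *
            (D / (\<rho> n)\<^sup>2 * ((one + 1) * L + 1 / 1))"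
          unfolding I_def one_def
        proof (rule contour_int_difference_bounded_length[where X = "X n"])
          show "norm (\<Delta> n s) \<le> D" if s: "s \<in> contour_trace (\<Gamma>r n)" for s
          proof -
            have "\<rho> n powr \<beta> \<le> norm s powr \<beta>"
              using s tr_r \<rho> \<alpha>\<beta>(2) by (intro powr_mono2) auto
            then have "real n * \<rho> n powr \<beta> \<le> real n * norm s powr \<beta>" by (intro mult_left_mono) auto
            moreover have "real n * \<rho> n powr \<beta> = real n powr \<gamma>"
            proof -
              have "\<rho> n powr \<beta> = real n powr (- (a * \<beta>))" by (simp add: \<rho>_def powr_powr)
              moreover have "real n powr \<gamma> = real n powr 1 * real n powr (- (a * \<beta>))"
                unfolding powr_add[symmetric] by (simp add: \<gamma>_def)
              ultimately show ?thesis using n by simp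
            qed
            ultimately have "- \<alpha> * real n * norm s powr \<beta> \<le> - \<alpha> * real n powr \<gamma>"
              using \<alpha>\<beta>(1) by (simp add: mult.assoc)
            then have "Me * exp (- \<alpha> * real n * norm s powr \<beta>) \<le> D"
              unfolding D_def using Me(1) by (intro mult_left_mono) auto
            then show ?thesis using elim(9) s by force
          qed
          show "\<rho> n \<le> norm s" if "s \<in> contour_trace (\<Gamma>r n)" for s
            using that tr_r by auto
          show "arc_integrable (\<Gamma>r n) (\<lambda>s. 1)" "arc_integral (\<Gamma>r n) (\<lambda>s. 1) \<le> L"
            unfolding L_def by (rule arc_integrable_length[OF regr elim(10)]; assumption)+
        qed (use X \<Delta> elim(5) tr Me(1) \<rho> regr x y in \<open>auto simp: D_def\<close>)
        moreover have "D / (\<rho> n)\<^sup>2 * ((one + 1) * L + 1 / 1) \<le> Me * 1"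
        proof -
          define e where "e = exp (- \<alpha> * real n powr \<gamma>)"
          have inv\<rho>: "1 / (\<rho> n)\<^sup>2 = real n powr (2 * a)"
            by (simp add: \<rho>_sq powr_minus_divide)
          have "L \<le> \<bar>Ml\<bar> * real n powr \<kappa>" by (auto simp: L_def intro: mult_right_mono)
          then have "e * real n powr (2 * a) * ((one + 1) * L + 1)
              \<le> e * real n powr (2 * a) * ((one + 1) * (\<bar>Ml\<bar> * real n powr \<kappa>) + 1)"
            using one0 by (intro mult_left_mono add_right_mono) (auto simp: e_def)
          also have "\<dots> = (one + 1) * \<bar>Ml\<bar> * (e * real n powr (2 * a + \<kappa>)) + e * real n powr (2 * a)"
            by (simp add: powr_add algebra_simps)
          also have "\<dots> \<le> 1" using elim(12) by (simp add: e_def)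
          finally have "Me * (e * real n powr (2 * a) * ((one + 1) * L + 1)) \<le> Me * 1"
            using Me(1) by (intro mult_left_mono)
          then show ?thesis unfolding inv\<rho>[symmetric] by (simp add: D_def e_def)
        qed
        then have "4 * norm (x - y) * (D / (\<rho> n)\<^sup>2 * ((one + 1) * L + 1 / 1)) \<le> 4 * norm (x - y) * (Me * 1)"
          by (intro mult_left_mono) auto
        ultimately show ?thesis by (simp add: mult.commute mult.left_commute)
      qed
      have Ic: "norm (I ?cr x - I ?cr y) \<le> Br * norm (x - y)"
      proof -
        have "norm (I ?cr x - I ?cr y) \<le> 4 * norm (x - y) *
            (Mr / r\<^sup>2 * ((one + 1) * (2 * pi * r) + 1 / 1))"
          unfolding I_def one_def
        proof (rule contour_int_difference_bounded_length[where X = "X n"])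
          show "norm (\<Delta> n s) \<le> Mr" if "s \<in> contour_trace ?cr" for s
          proof -
            have "real n powr (d - b) \<le> real n powr 0" using n db by (intro powr_mono) auto
            then have "Mr * real n powr (d - b) \<le> Mr * 1" using Mr(1) n by (intro mult_left_mono) auto
            moreover have "norm (\<Delta> n s) \<le> Mr * real n powr (d - b)" using elim(8) that tr_c by auto
            ultimately show ?thesis by simp
          qed
          show "r \<le> norm s" if "s \<in> contour_trace ?cr" for s
            using that tr_c by auto
        qed (use X \<Delta> elim(5) tr Mr(1) r(1) arc_integrable_circle xy_r in \<open>auto intro: circle_curve_regular\<close>)
        then show ?thesis by (simp add: Br_def algebra_simps)
      qed
      have Iinf: "norm (I (\<Gamma>inf n) x - I (\<Gamma>inf n) y) \<le> Binf * norm (x - y)"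
      proof -
        have regi: "regular_curve \<kappa>'" if "\<kappa>' \<in> set (\<Gamma>inf n)" for \<kappa>'
          using that reg by (simp add: \<Gamma>)
        have "norm (I (\<Gamma>inf n) x - I (\<Gamma>inf n) y) \<le> 4 * norm (x - y) * ((one * (1 + Mi\<^sup>2) + 2 / r) / r)"
          unfolding I_def one_def
        proof (rule contour_int_difference_unbounded[where X = "X n"])
          show "r \<le> norm s" if "s \<in> contour_trace (\<Gamma>inf n)" for s
            using that tr_inf by auto
          have "contour_L2norm (\<Gamma>inf n) inverse = sqrt (arc_integral (\<Gamma>inf n) (\<lambda>s. (norm (inverse s))\<^sup>2))"
            using elim(11) by (intro contour_L2_arc_integrable(2) regi) auto
          then have "sqrt (arc_integral (\<Gamma>inf n) (\<lambda>s. (norm (inverse s))\<^sup>2)) \<le> Mi" using elim(11) by simp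
          then show "arc_integral (\<Gamma>inf n) (\<lambda>s. (norm (inverse s))\<^sup>2) \<le> Mi\<^sup>2"
            by (rule sqrt_le_D)
        qed (use X \<Delta> elim(5,11) tr r(1) regi xy_r in auto)
        then show ?thesis by (simp add: Binf_def algebra_simps)
      qed
      have "R n x - R n y = (1 / (2 * of_real pi * \<i>)) *\<^sub>C (I (\<Gamma> n) x - I (\<Gamma> n) y)"
        using elim(3) off[OF x] off[OF y] by (simp add: I_def cscale_algebra)
      then have "norm (R n x - R n y) = 1 / (2 * pi) * norm (I (\<Gamma> n) x - I (\<Gamma> n) y)"
        by (simp add: norm_cscale norm_divide norm_mult)
      also have "\<dots> \<le> 1 * norm (I (\<Gamma> n) x - I (\<Gamma> n) y)"
        using pi_ge_two by (intro mult_right_mono) auto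
      also have "I (\<Gamma> n) x - I (\<Gamma> n) y = (I ?ca x - I ?ca y) + (I (\<Gamma>r n) x - I (\<Gamma>r n) y)
          + (I ?cr x - I ?cr y) + (I (\<Gamma>inf n) x - I (\<Gamma>inf n) y)"
        unfolding I_def \<Gamma> contour_int_append by simp
      also have "1 * norm \<dots> \<le> Ba * ?N * norm (x - y) + 4 * Me * norm (x - y)
          + Br * norm (x - y) + Binf * norm (x - y)"
        unfolding mult_1 by (intro norm_triangle_mono Ia Ir Ic Iinf)
      also have "\<dots> = (Ba * ?N + (4 * Me + Br + Binf)) * norm (x - y)"
        by (simp add: algebra_simps)
      also have "\<dots> \<le> (M * ?N + M) * norm (x - y)"
        using B0 Me(1) by (intro mult_right_mono add_mono) (auto simp: M_def)
      finally show "norm (R n x - R n y) \<le> M * (1 + ?N) * norm (x - y)"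
        by (simp add: algebra_simps)
    qed
  qed
  ultimately show ?thesis unfolding \<rho>_def by blast
qed

section \<open>The prefactor\<close>

text \<open>The maximum principle is applied in one variable at a time: for z on the circle the
  expression is holomorphic in w and vanishes at w = z, which moves w into the disc; then z is moved
  with w fixed. Each move costs the square of the dimension.\<close>

lemma inverse_product_extends_to_disc:
  fixes G :: "complex \<Rightarrow> complex^'m^'m"
  assumes G: "G mat_holomorphic_on ball 0 r" and inv: "\<And>z. z \<in> ball 0 r \<Longrightarrow> invertible (G z)"
    and \<rho>: "0 < \<rho>" "\<rho> < r"
    and M: "\<And>z w. z \<in> sphere 0 \<rho> \<Longrightarrow> w \<in> sphere 0 \<rho> \<Longrightarrow>
      norm (matrix_inv (G z) ** G w - mat 1) \<le> M * norm (z - w)"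
    and zw: "z \<in> cball 0 \<rho>" "w \<in> cball 0 \<rho>"
  shows "norm (matrix_inv (G z) ** G w - mat 1)
    \<le> real CARD('m) * real CARD('m) * (real CARD('m) * real CARD('m) * M * norm (z - w))"
proof -
  have sphere: "norm (matrix_inv (G u) ** G w - mat 1) \<le> real CARD('m) * real CARD('m) * M * norm (u - w)"
    if u: "u \<in> sphere 0 \<rho>" for u
  proof -
    have "norm (matrix_inv (G u) ** G w - mat 1) \<le> real CARD('m) * real CARD('m) * (M * norm (w - u))"
    proof (rule mat_max_modulus_difference_quotient[OF _ \<rho>, where G = "\<lambda>w. matrix_inv (G u) ** G w - mat 1"])
      show "(\<lambda>w. matrix_inv (G u) ** G w - mat 1) mat_holomorphic_on ball 0 r"
        by (intro mat_holomorphic_intros G)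
      show "norm (matrix_inv (G u) ** G v - mat 1) \<le> M * norm (v - u)" if "v \<in> sphere 0 \<rho>" for v
        using M[OF u that] by (simp add: norm_minus_commute)
    qed (use u zw \<rho> in \<open>auto simp: matrix_inv_mult inv\<close>)
    then show ?thesis by (simp add: norm_minus_commute mult.assoc)
  qed
  show ?thesis
  proof (rule mat_max_modulus_difference_quotient[OF _ \<rho>, where G = "\<lambda>z. matrix_inv (G z) ** G w - mat 1"])
    show "(\<lambda>z. matrix_inv (G z) ** G w - mat 1) mat_holomorphic_on ball 0 r"
      by (intro mat_holomorphic_intros mat_holomorphic_inv G inv)
  qed (use sphere zw \<rho> in \<open>auto simp: matrix_inv_mult inv\<close>)
qed

text \<open>Regrouped so that the conjugating matrices meet \<open>E\<close> and its inverse: the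
  outer factors are then quotients of values of \<open>E\<close>, which stay bounded.\<close>

lemma conj_by_F_fun:
  "conj_by A (F_fun b E C n z) = (1 / (of_real (real n powr b) * z)) *\<^sub>C
    (matrix_inv A ** E n z ** C n z ** (matrix_inv (E n z) ** A))"
  by (simp add: conj_by_def F_fun_def cscale_matrix_mult matrix_mult_cscale matrix_mul_assoc)

lemma pole_order_le_F_fun:
  assumes C: "pole_order_le p r (C n)" and E: "E n mat_holomorphic_on ball 0 r"
    and inv: "\<And>z. z \<in> ball 0 r \<Longrightarrow> invertible (E n z)"
  shows "pole_order_le (p + 1) r (F_fun b E C n)"
proof -
  have "pole_order_le (0 + p + 0) r (\<lambda>z. E n z ** C n z ** matrix_inv (E n z))"
    by (intro pole_order_le_mult pole_order_le_holomorphic E mat_holomorphic_inv inv C)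
  then obtain H where H: "H mat_holomorphic_on ball 0 r"
    "\<And>z. z \<in> ball 0 r - {0} \<Longrightarrow> E n z ** C n z ** matrix_inv (E n z) = (1 / z ^ p) *\<^sub>C H z"
    unfolding pole_order_le_def by auto
  show ?thesis
    unfolding pole_order_le_def
  proof (intro exI conjI ballI)
    show "(\<lambda>z. (1 / of_real (real n powr b)) *\<^sub>C H z) mat_holomorphic_on ball 0 r"
      by (intro mat_holomorphic_intros H holomorphic_on_const)
    fix z :: complex assume "z \<in> ball 0 r - {0}"
    then show "F_fun b E C n z = (1 / z ^ (p + 1)) *\<^sub>C (1 / of_real (real n powr b)) *\<^sub>C H z"
      by (simp add: F_fun_def H(2) cscale_algebra mult_ac)
  qed
qed

text \<open>Collects all that the final quotient uses of the prefactor, with one constant. Single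
  matrices E(0) and E(0)^-1 are bounded by n^(d/2), everything else by a constant or by n^e times
  the distance.\<close>

lemma prefactor_estimates:
  fixes a b d e r :: real and C E :: "nat \<Rightarrow> complex \<Rightarrow> complex^'m^'m" and K :: nat
  assumes a: "0 \<le> a" "a \<le> e" "e < b" and r: "0 < r" "a = 0 \<Longrightarrow> 1 < r"
    and C_mero: "\<And>n. n \<ge> 1 \<Longrightarrow> pole_at_0_only p r (C n)"
    and E_analytic: "\<And>n i j. n \<ge> 1 \<Longrightarrow> (\<lambda>z. E n z $ i $ j) analytic_on cball 0 r"
    and E_inv: "\<And>n z. n \<ge> 1 \<Longrightarrow> z \<in> cball 0 r \<Longrightarrow> invertible (E n z)"
    and E_bound: "unif_bigo (\<lambda>n. sphere 0 (real n powr - a)) E (\<lambda>n z. real n powr (d / 2))"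
    and E_inv_bound: "unif_bigo (\<lambda>n. sphere 0 (real n powr - a))
      (\<lambda>n z. matrix_inv (E n z)) (\<lambda>n z. real n powr (d / 2))"
    and E_lipschitz: "unif_bigo (\<lambda>n. sphere 0 (real n powr - a) \<times> sphere 0 (real n powr - a))
      (\<lambda>n (z, w). matrix_inv (E n z) ** E n w - mat 1)
      (\<lambda>n (z, w). of_real (real n powr e) * (z - w))"
    and C_bound_e: "unif_bigo (\<lambda>n. sphere 0 (real n powr - e)) C (\<lambda>n z. 1 :: real)"
  defines "T \<equiv> \<lambda>n z. conj_by (E n 0) (pi_product (F_fun b E C n) K z)"
  shows "\<exists>M\<ge>0. \<forall>\<^sub>F n in sequentially. invertible (E n 0) \<and>
    norm (E n 0) \<le> M * real n powr (d / 2) \<and> norm (matrix_inv (E n 0)) \<le> M * real n powr (d / 2) \<and>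
    (\<forall>z\<in>cball 0 (real n powr - e / 2). invertible (E n z) \<and>
      norm (matrix_inv (E n 0) ** E n z) \<le> M \<and> norm (matrix_inv (E n z) ** E n 0) \<le> M \<and>
      norm (T n z - mat 1) \<le> 1 / 2) \<and>
    (\<forall>x\<in>cball 0 (real n powr - e / 2). \<forall>y\<in>cball 0 (real n powr - e / 2).
      norm (matrix_inv (E n y) ** E n x - mat 1) \<le> M * real n powr e * norm (x - y) \<and>
      norm (T n x - T n y) \<le> M * real n powr e * norm (x - y))"
proof -
  define one where "one = norm (mat 1 :: complex^'m^'m)"
  define m where "m = real CARD('m) * real CARD('m)"
  have m0: "0 \<le> m" "0 \<le> one" by (simp_all add: m_def one_def)
  define \<epsilon> where "\<epsilon> = (\<lambda>n. real n powr (e - b))"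
  have \<epsilon>_0: "\<epsilon> \<longlonglongrightarrow> 0"
    using a unfolding \<epsilon>_def by real_asymp
  obtain M1 where M1: "0 \<le> M1" "\<forall>\<^sub>F n in sequentially. \<forall>z\<in>sphere 0 (real n powr - a).
      norm (E n z) \<le> M1 * real n powr (d / 2)"
    using unif_bigoD[OF E_bound] by auto
  obtain M2 where M2: "0 \<le> M2" "\<forall>\<^sub>F n in sequentially. \<forall>z\<in>sphere 0 (real n powr - a).
      norm (matrix_inv (E n z)) \<le> M2 * real n powr (d / 2)"
    using unif_bigoD[OF E_inv_bound] by auto
  obtain M3 where M3: "0 \<le> M3" "\<forall>\<^sub>F n in sequentially. \<forall>z\<in>sphere 0 (real n powr - a).
      \<forall>w\<in>sphere 0 (real n powr - a). norm (matrix_inv (E n z) ** E n w - mat 1) \<le> M3 * real n powr e * norm (z - w)"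
    using unif_bigoD[OF E_lipschitz] by (auto simp: norm_mult mult.assoc split: prod.splits)
  obtain Mc where Mc: "0 \<le> Mc" "\<forall>\<^sub>F n in sequentially. \<forall>z\<in>sphere 0 (real n powr - e). norm (C n z) \<le> Mc"
    using unif_bigoD[OF C_bound_e] by auto
  have radius: "\<forall>\<^sub>F n in sequentially. real n powr - a < r"
    by (rule circle_radius_less) fact+
  define MLip where "MLip = m * m * M3"
  have MLip0: "0 \<le> MLip" using M3(1) m0 by (simp add: MLip_def)
  have E_disc: "\<forall>\<^sub>F n in sequentially. 1 \<le> n \<and> 0 < real n powr - e \<and> real n powr - e \<le> real n powr - a \<and>
    real n powr - a < r \<and> E n mat_holomorphic_on ball 0 r \<and> (\<forall>z\<in>ball 0 r. invertible (E n z)) \<and>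
    norm (E n 0) \<le> m * (M1 * real n powr (d / 2)) \<and> norm (matrix_inv (E n 0)) \<le> m * (M2 * real n powr (d / 2)) \<and>
    (\<forall>z\<in>cball 0 (real n powr - a). \<forall>w\<in>cball 0 (real n powr - a).
      norm (matrix_inv (E n z) ** E n w - mat 1) \<le> MLip * real n powr e * norm (z - w)) \<and>
    (\<forall>z\<in>cball 0 (real n powr - e). norm (matrix_inv (E n 0) ** E n z) \<le> one + MLip \<and>
      norm (matrix_inv (E n z) ** E n 0) \<le> one + MLip)"
    using M1(2) M2(2) M3(2) radius eventually_ge_at_top[of 1]
  proof eventually_elim
    case (elim n)
    have n: "1 \<le> n" "1 \<le> real n" using elim by auto
    have \<rho>: "0 < real n powr - a" "real n powr - a < r" using elim n by simp_all
    have \<rho>e: "0 < real n powr - e" "real n powr - e \<le> real n powr - a"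
      using n a by (auto intro!: powr_mono)
    have holo: "E n mat_holomorphic_on ball 0 r"
      unfolding mat_holomorphic_def
      using analytic_imp_holomorphic[OF E_analytic[OF n(1)]] by (auto intro: holomorphic_on_subset[OF _ ball_subset_cball])
    have inv: "invertible (E n z)" if "z \<in> ball 0 r" for z
      using E_inv[OF n(1)] that by simp
    have lip: "norm (matrix_inv (E n z) ** E n w - mat 1) \<le> MLip * real n powr e * norm (z - w)"
      if "z \<in> cball 0 (real n powr - a)" "w \<in> cball 0 (real n powr - a)" for z w
      using inverse_product_extends_to_disc[OF holo inv \<rho> _ that, of "M3 * real n powr e"] elim(3)
      by (simp add: MLip_def m_def mult.assoc)
    \<comment> \<open>The Lipschitz constant n^e is compensated by the distance n^(-e). One of the
      two points will be 0, so the last condition holds on the whole disc.\<close>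
    have near: "norm (matrix_inv (E n z) ** E n w) \<le> one + MLip"
      if "z \<in> cball 0 (real n powr - e)" "w \<in> cball 0 (real n powr - e)" "norm (z - w) \<le> real n powr - e" for z w
    proof -
      have "norm (matrix_inv (E n z) ** E n w - mat 1) \<le> MLip * real n powr e * norm (z - w)"
        using that \<rho>e by (intro lip) auto
      also have "\<dots> \<le> MLip * real n powr e * real n powr - e"
        using that MLip0 by (intro mult_left_mono) auto
      also have "\<dots> = MLip" using n by (simp add: powr_minus)
      finally show ?thesis
        using norm_triangle_ineq[of "matrix_inv (E n z) ** E n w - mat 1" "mat 1"] by (simp add: one_def)
    qed
    have "norm (E n 0) \<le> m * (M1 * real n powr (d / 2))"
      unfolding m_def using elim(1) by (intro mat_max_modulus_ball[OF holo \<rho>]) auto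
    moreover have "norm (matrix_inv (E n 0)) \<le> m * (M2 * real n powr (d / 2))"
      unfolding m_def using elim(2)
      by (intro mat_max_modulus_ball[OF mat_holomorphic_inv[OF holo inv] \<rho>]) auto
    ultimately show ?case
      using n \<rho> \<rho>e holo inv lip near by (auto simp: norm_minus_commute)
  qed
  interpret conjugated_discs r "\<lambda>n. E n 0" "\<lambda>n. real n powr - e" \<epsilon>
  proof
    show "\<forall>\<^sub>F n in sequentially. invertible (E n 0) \<and> 0 < real n powr - e \<and> real n powr - e < r \<and> 0 \<le> \<epsilon> n"
      using E_disc by eventually_elim (use r(1) in \<open>auto simp: \<epsilon>_def\<close>)
  qed (fact \<epsilon>_0)
  have "\<forall>\<^sub>F n in sequentially. pole_order_le (p + 1) r (F_fun b E C n) \<and>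
    (\<forall>z\<in>sphere 0 (real n powr - e). norm (conj_by (E n 0) (F_fun b E C n z))
      \<le> ((one + MLip) * Mc * (one + MLip)) * \<epsilon> n)"
    using E_disc Mc(2)
  proof eventually_elim
    case (elim n)
    have "norm (conj_by (E n 0) (F_fun b E C n z)) \<le> ((one + MLip) * Mc * (one + MLip)) * \<epsilon> n"
      if z: "z \<in> sphere 0 (real n powr - e)" for z
    proof -
      have "norm (matrix_inv (E n 0) ** E n z ** C n z ** (matrix_inv (E n z) ** E n 0))
          \<le> (one + MLip) * Mc * (one + MLip)"
        using elim z by (intro norm_matrix_mult_mono) auto
      moreover have "norm (1 / (of_real (real n powr b) * z)) = \<epsilon> n"
      proof -
        have "norm (1 / (of_real (real n powr b) * z)) = 1 / (real n powr b * real n powr - e)"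
          using z by (simp add: norm_divide norm_mult)
        also have "\<dots> = 1 / real n powr (b - e)"
          using powr_add[of "real n" b "- e"] by simp
        also have "\<dots> = \<epsilon> n"
          using powr_minus_divide[of "real n" "b - e"] by (simp add: \<epsilon>_def)
        finally show ?thesis .
      qed
      ultimately show ?thesis
        unfolding conj_by_F_fun norm_cscale
        by (simp add: \<epsilon>_def mult_left_mono mult.commute)
    qed
    moreover have "pole_order_le (p + 1) r (F_fun b E C n)"
      using elim r(1) C_mero by (intro pole_order_le_F_fun pole_at_0_only_imp_pole_order_le) auto
    ultimately show ?case by blast
  qed
  then have "small (F_fun b E C)" unfolding small_def by blast
  from pi_product_near_identity[OF this, of K] obtain c where c: "0 \<le> c"
    "\<forall>\<^sub>F n in sequentially. pi_product (F_fun b E C n) K mat_holomorphic_on ball 0 r \<and>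
      (\<forall>z\<in>cball 0 (real n powr - e). norm (T n z - mat 1) \<le> c * \<epsilon> n)"
    unfolding T_def by blast
  define M where "M = m * M1 + m * M2 + (one + MLip) + m * (4 * c)"
  have le_M: "m * M1 \<le> M" "m * M2 \<le> M" "one + MLip \<le> M" "MLip \<le> M" "m * (4 * c) \<le> M" "0 \<le> M"
    using m0 MLip0 M1(1) M2(1) c(1) by (simp_all add: M_def)
  have "\<forall>\<^sub>F n in sequentially. invertible (E n 0) \<and>
    norm (E n 0) \<le> M * real n powr (d / 2) \<and> norm (matrix_inv (E n 0)) \<le> M * real n powr (d / 2) \<and>
    (\<forall>z\<in>cball 0 (real n powr - e / 2). invertible (E n z) \<and>
      norm (matrix_inv (E n 0) ** E n z) \<le> M \<and> norm (matrix_inv (E n z) ** E n 0) \<le> M \<and>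
      norm (T n z - mat 1) \<le> 1 / 2) \<and>
    (\<forall>x\<in>cball 0 (real n powr - e / 2). \<forall>y\<in>cball 0 (real n powr - e / 2).
      norm (matrix_inv (E n y) ** E n x - mat 1) \<le> M * real n powr e * norm (x - y) \<and>
      norm (T n x - T n y) \<le> M * real n powr e * norm (x - y))"
    \<comment> \<open>The multiple \<open>2 * c\<close> keeps the conjugated product within 1/2 of
      the identity; the multiple 1 discards \<epsilon> in the Lipschitz bound.\<close>
    using E_disc c(2) eventually_\<epsilon>_le_1[of "2 * c"] eventually_\<epsilon>_le_1[of 1]
  proof eventually_elim
    case (elim n)
    have n: "1 \<le> n" and \<rho>e: "0 < real n powr - e" "real n powr - e \<le> real n powr - a" "real n powr - e < r"
      using elim(1) by auto
    have inv0: "invertible (E n 0)" using elim(1) r(1) by auto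
    have "norm (E n 0) \<le> m * M1 * real n powr (d / 2)" "norm (matrix_inv (E n 0)) \<le> m * M2 * real n powr (d / 2)"
      using elim(1) by (simp_all add: mult.assoc)
    then have bounds: "norm (E n 0) \<le> M * real n powr (d / 2)" "norm (matrix_inv (E n 0)) \<le> M * real n powr (d / 2)"
      by (auto elim!: order_trans intro!: mult_right_mono le_M)
    have half: "z \<in> cball 0 (real n powr - e)" "z \<in> ball 0 r" "z \<in> cball 0 (real n powr - a)"
      if "z \<in> cball 0 (real n powr - e / 2)" for z :: complex
    proof -
      have "norm z \<le> real n powr - e / 2" using that by simp
      then show "z \<in> cball 0 (real n powr - e)" "z \<in> ball 0 r" "z \<in> cball 0 (real n powr - a)"
        unfolding mem_cball mem_ball dist_0_norm using \<rho>e by linarith+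
    qed
    have points: "invertible (E n z) \<and>
      norm (matrix_inv (E n 0) ** E n z) \<le> M \<and> norm (matrix_inv (E n z) ** E n 0) \<le> M \<and>
      norm (T n z - mat 1) \<le> 1 / 2" if z: "z \<in> cball 0 (real n powr - e / 2)" for z
    proof -
      note z' = half[OF z]
      then have "norm (T n z - mat 1) \<le> c * \<epsilon> n" using elim(2) by blast
      moreover have "invertible (E n z)" "norm (matrix_inv (E n 0) ** E n z) \<le> one + MLip"
          "norm (matrix_inv (E n z) ** E n 0) \<le> one + MLip"
        using elim(1) z' by blast+
      ultimately show ?thesis using elim(3) le_M(3) by auto
    qed
    have lips: "norm (matrix_inv (E n y) ** E n x - mat 1) \<le> M * real n powr e * norm (x - y)"
        "norm (T n x - T n y) \<le> M * real n powr e * norm (x - y)"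
      if x: "x \<in> cball 0 (real n powr - e / 2)" and y: "y \<in> cball 0 (real n powr - e / 2)" for x y
    proof -
      have "norm (matrix_inv (E n y) ** E n x - mat 1) \<le> MLip * real n powr e * norm (y - x)"
        using elim(1) half(3)[OF x] half(3)[OF y] by blast
      also have "\<dots> \<le> M * real n powr e * norm (y - x)"
        by (intro mult_right_mono le_M) auto
      finally show "norm (matrix_inv (E n y) ** E n x - mat 1) \<le> M * real n powr e * norm (x - y)"
        by (simp add: norm_minus_commute)
      have "(\<lambda>z. T n z - mat 1) mat_holomorphic_on ball 0 r"
        unfolding T_def conj_by_def using elim(2) by (intro mat_holomorphic_intros) auto
      \<comment> \<open>The circle of radius n^(-e) yields the Lipschitz constant n^e \<epsilon>,
        and \<epsilon> \<le> 1 leaves n^e.\<close>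
      then have "norm ((T n x - mat 1) - (T n y - mat 1)) \<le> m * (4 * (c * \<epsilon> n) / real n powr - e * norm (x - y))"
        unfolding m_def using elim(2) y half(1)[OF x] \<rho>e by (intro mat_holomorphic_lipschitz) blast+
      also have "\<dots> = m * (4 * c) * real n powr e * norm (x - y) * \<epsilon> n"
        using n by (simp add: powr_minus divide_simps)
      also have "\<dots> \<le> m * (4 * c) * real n powr e * norm (x - y) * 1"
        using elim(4) m0 c(1) by (intro mult_left_mono) auto
      also have "\<dots> \<le> M * real n powr e * norm (x - y) * 1"
        by (intro mult_right_mono le_M) auto
      finally show "norm (T n x - T n y) \<le> M * real n powr e * norm (x - y)" by simp
    qed
    show ?case using inv0 bounds points lips by blast
  qed
  then show ?thesis using le_M(6) by blast
qed

text \<open>With V = Ey^-1 A and U = A^-1 Ex the quotient is V Ty^-1 A^-1 Ry^-1 Rx A Tx U. Replacing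
  Rx by Ry + (Rx - Ry) and then Tx by Ty + (Tx - Ty) lets everything else cancel. Only the term with
  Rx - Ry keeps A and its inverse, so only there the square of k appears.\<close>

lemma conjugated_quotient_bound:
  fixes A Tx Ty Ex Ey Rx Ry :: "complex^'m^'m"
  assumes A: "invertible A" and Ey: "invertible Ey"
    and Tx: "norm (Tx - mat 1) \<le> 1 / 2" and Ty: "norm (Ty - mat 1) \<le> 1 / 2" and Ry: "norm (Ry - mat 1) \<le> 1 / 2"
    and U: "norm (matrix_inv A ** Ex) \<le> u" "norm (matrix_inv Ey ** A) \<le> u"
    and k: "norm A \<le> k" "norm (matrix_inv A) \<le> k"
    and t: "norm (Tx - Ty) \<le> t" and s: "norm (Rx - Ry) \<le> s" and v: "norm (matrix_inv Ey ** Ex - mat 1) \<le> v"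
  defines "one \<equiv> norm (mat 1 :: complex^'m^'m)"
  shows "norm (matrix_inv (A ** Ty ** matrix_inv A ** Ey) ** matrix_inv Ry ** Rx ** (A ** Tx ** matrix_inv A ** Ex) - mat 1)
    \<le> v + u * (2 * one) * t * u + u * (2 * one) * k * (2 * one) * s * k * (one + 1) * u"
proof -
  note A' = matrix_inv_mult[OF A] and Ey' = matrix_inv_mult[OF Ey]
  note Ty' = invertible_near_identity[OF Ty] and Ry' = invertible_near_identity[OF Ry]
  note Tyi = matrix_inv_mult[OF Ty'(1)] and Ryi = matrix_inv_mult[OF Ry'(1)]
  note simps = matrix_cancel[OF A'(1)] matrix_cancel[OF A'(2)] matrix_cancel[OF Ey'(1)]
    matrix_cancel[OF Ey'(2)] matrix_cancel[OF Tyi(1)] matrix_cancel[OF Tyi(2)]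
    matrix_cancel[OF Ryi(2)] A' Ey' Tyi Ryi
  define Vy where "Vy = matrix_inv Ey ** A"
  define Ux where "Ux = matrix_inv A ** Ex"
  have inv: "matrix_inv (A ** Ty ** matrix_inv A ** Ey) = Vy ** matrix_inv Ty ** matrix_inv A"
    by (rule matrix_inv_unique) (simp add: Vy_def matrix_mul_assoc simps)
  \<comment> \<open>After expansion by distributivity, all products beyond the displayed telescoping
    cancel through adjacent inverse pairs.\<close>
  have "Vy ** matrix_inv Ty ** matrix_inv A ** matrix_inv Ry ** Rx ** (A ** Tx ** Ux)
    = Vy ** Ux + Vy ** matrix_inv Ty ** (Tx - Ty) ** Ux
      + Vy ** matrix_inv Ty ** matrix_inv A ** matrix_inv Ry ** (Rx - Ry) ** A ** Tx ** Ux"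
    by (simp add: matrix_distribs matrix_mul_assoc simps)
  moreover have "Vy ** Ux = matrix_inv Ey ** Ex"
    by (simp add: Vy_def Ux_def matrix_mul_assoc simps)
  moreover have "A ** Tx ** matrix_inv A ** Ex = A ** Tx ** Ux"
    by (simp add: Ux_def matrix_mul_assoc)
  ultimately have "matrix_inv (A ** Ty ** matrix_inv A ** Ey) ** matrix_inv Ry ** Rx ** (A ** Tx ** matrix_inv A ** Ex) - mat 1
    = (matrix_inv Ey ** Ex - mat 1) + Vy ** matrix_inv Ty ** (Tx - Ty) ** Ux
      + Vy ** matrix_inv Ty ** matrix_inv A ** matrix_inv Ry ** (Rx - Ry) ** A ** Tx ** Ux"
    by (simp add: inv)
  also have "norm \<dots> \<le> v + u * (2 * one) * t * u + u * (2 * one) * k * (2 * one) * s * k * (one + 1) * u"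
  proof -
    have "norm Tx \<le> one + 1"
      using norm_triangle_ineq[of "Tx - mat 1" "mat 1"] Tx by (simp add: one_def)
    then show ?thesis
      using U Ty'(2) Ry'(2) unfolding one_def
      by (intro norm_triangle_mono norm_matrix_mult_mono v t s k) (simp_all add: Vy_def Ux_def)
  qed
  finally show ?thesis .
qed

section \<open>The local limit\<close>

theorem theorem3p1:
  fixes a b c d e r \<alpha> \<beta> \<cc> \<kappa> :: real
    and p :: nat
    and P N C E R \<Delta> FR X :: "nat \<Rightarrow> complex \<Rightarrow> complex^'m^'m"
    and \<Gamma> \<Gamma>r \<Gamma>inf :: "nat \<Rightarrow> curve list"
  \<comment> \<open>the setting\<close>
  assumes "0 \<le> a" "0 \<le> b" "0 \<le> c" "0 \<le> d" "0 \<le> e" "0 < r"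
    and "a = 0 \<Longrightarrow> 1 < r"
    and "a \<le> e" "e < b" "d < min b c" "b - a < c"
    and N_inv: "\<forall>\<^sub>F n in sequentially. \<forall>z\<in>sphere 0 (real n powr - a). invertible (N n z)"
    and matching: "unif_bigo (\<lambda>n. sphere 0 (real n powr - a))
      (\<lambda>n z. P n z ** matrix_inv (N n z) ** E n z
        - (mat 1 + (1 / (of_real (real n powr b) * z)) *\<^sub>C C n z))
      (\<lambda>n z. real n powr - c)"
    and C_mero: "\<And>n. n \<ge> 1 \<Longrightarrow> pole_at_0_only p r (C n)"
    and C_bound: "unif_bigo (\<lambda>n. sphere 0 (real n powr - a)) C (\<lambda>n z. 1 :: real)"
    and E_analytic: "\<And>n i j. n \<ge> 1 \<Longrightarrow> (\<lambda>z. E n z $ i $ j) analytic_on cball 0 r"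
    and E_inv: "\<And>n z. n \<ge> 1 \<Longrightarrow> z \<in> cball 0 r \<Longrightarrow> invertible (E n z)"
    and E_bound: "unif_bigo (\<lambda>n. sphere 0 (real n powr - a)) E (\<lambda>n z. real n powr (d / 2))"
    and E_inv_bound: "unif_bigo (\<lambda>n. sphere 0 (real n powr - a))
      (\<lambda>n z. matrix_inv (E n z)) (\<lambda>n z. real n powr (d / 2))"
    and E_lipschitz: "unif_bigo (\<lambda>n. sphere 0 (real n powr - a) \<times> sphere 0 (real n powr - a))
      (\<lambda>n (z, w). matrix_inv (E n z) ** E n w - mat 1)
      (\<lambda>n (z, w). of_real (real n powr e) * (z - w))"
  \<comment> \<open>the additional assumptions\<close>
    and C_bound_e: "unif_bigo (\<lambda>n. sphere 0 (real n powr - e)) C (\<lambda>n z. 1 :: real)"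
    and c_ge: "min (3 / 2 * a + d) (3 / 2 * a + 2 * d - e) \<le> c"
  \<comment> \<open>the contour\<close>
    and \<Gamma>_eq: "\<And>n. \<Gamma> n = circle_curve (real n powr - a) # \<Gamma>r n @ circle_curve r # \<Gamma>inf n"
    and \<Gamma>r_contour: "\<forall>\<^sub>F n in sequentially. is_contour (\<Gamma>r n) \<and>
      contour_trace (\<Gamma>r n) \<subseteq> {z. real n powr - a < norm z \<and> norm z < r}"
    and \<Gamma>inf_contour: "\<forall>\<^sub>F n in sequentially. is_contour (\<Gamma>inf n) \<and>
      contour_trace (\<Gamma>inf n) \<subseteq> {z. r < norm z}"
    \<comment> \<open>implicit in the original; see \<open>contour_length\<close>\<close>
    and \<Gamma>r_length: "\<exists>M. \<forall>\<^sub>F n in sequentially. contour_length (\<Gamma>r n) \<le> ennreal (M * real n powr \<kappa>)"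
    and \<Gamma>inf_inverse: "\<exists>M. \<forall>\<^sub>F n in sequentially.
      contour_L2 (\<Gamma>inf n) inverse \<and> contour_L2norm (\<Gamma>inf n) inverse \<le> M"
  \<comment> \<open>the function \<open>R\<close>\<close>
    and R_to_I: "\<And>\<epsilon>. \<epsilon> > 0 \<Longrightarrow> \<forall>\<^sub>F n in sequentially.
      \<forall>z. z \<notin> contour_trace (\<Gamma> n) \<longrightarrow> norm (R n z - mat 1) < \<epsilon>"
    and R_eq: "\<forall>\<^sub>F n in sequentially. \<forall>z. z \<notin> contour_trace (\<Gamma> n) \<longrightarrow>
      R n z = mat 1 + (1 / (2 * of_real pi * \<i>)) *\<^sub>C
        contour_int (\<Gamma> n) (\<lambda>s. (1 / (s - z)) *\<^sub>C (FR n s ** \<Delta> n s))"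
    and \<Delta>_Lp: "\<forall>\<^sub>F n in sequentially. contour_L2 (\<Gamma> n) (\<Delta> n) \<and> contour_Linf (\<Gamma> n) (\<Delta> n)"
    and \<alpha>\<beta>: "0 < \<alpha>" "0 < \<beta>" "a > 0 \<Longrightarrow> \<beta> < 1 / a"
    and \<Delta>_a: "unif_bigo (\<lambda>n. sphere 0 (real n powr - a)) \<Delta> (\<lambda>n z. real n powr (d - c))"
    and \<Delta>_r: "unif_bigo (\<lambda>n. sphere 0 r) \<Delta> (\<lambda>n z. real n powr (d - b))"
    and \<Delta>_\<Gamma>r: "unif_bigo (\<lambda>n. contour_trace (\<Gamma>r n)) \<Delta>
      (\<lambda>n z. exp (- \<alpha> * real n * norm z powr \<beta>))"
    and \<Delta>_L2_0: "(\<lambda>n. contour_L2norm (\<Gamma> n) (\<Delta> n)) \<longlonglongrightarrow> 0"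
    and \<Delta>_Linf_0: "(\<lambda>n. contour_Linfnorm (\<Gamma> n) (\<Delta> n)) \<longlonglongrightarrow> 0"
    and FR_eq: "\<forall>\<^sub>F n in sequentially. \<forall>s\<in>contour_trace (\<Gamma> n). FR n s = mat 1 + X n s"
    and X_L2: "\<forall>\<^sub>F n in sequentially. contour_L2 (\<Gamma> n) (X n)"
    and X_L2_0: "(\<lambda>n. contour_L2norm (\<Gamma> n) (X n)) \<longlonglongrightarrow> 0"
    and "0 < \<cc>"
  shows "\<forall>Q. compact Q \<longrightarrow> (\<exists>A B.
    unif_bigo (\<lambda>n. Q \<times> Q) A (\<lambda>n (x, y). of_real (real n powr (d - b)) * (x - y)) \<and>
    unif_bigo (\<lambda>n. Q \<times> Q) B (\<lambda>n (x, y). of_real (real n powr (e - b)) * (x - y)) \<and>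
    (\<forall>\<^sub>F n in sequentially. \<forall>x\<in>Q. \<forall>y\<in>Q.
      (let xn = x / of_real (\<cc> * real n powr b); yn = y / of_real (\<cc> * real n powr b) in
        matrix_inv (E0 a b c e E C n yn) ** matrix_inv (R n yn) ** R n xn ** E0 a b c e E C n xn
        = mat 1 + A n (x, y) + B n (x, y))))"
proof (intro allI impI)
  fix Q :: "complex set" assume Q: "compact Q"
  note a = \<open>0 \<le> a\<close> \<open>a \<le> e\<close> \<open>e < b\<close> and r = \<open>0 < r\<close> \<open>a = 0 \<Longrightarrow> 1 < r\<close>
  have db: "d \<le> b" using \<open>d < min b c\<close> by simp
  have \<Delta>_L2: "\<forall>\<^sub>F n in sequentially. contour_L2 (\<Gamma> n) (\<Delta> n)"
    using \<Delta>_Lp by eventually_elim simp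
  have "\<exists>M\<ge>0. \<forall>\<^sub>F n in sequentially. \<forall>x y. norm x \<le> real n powr - a / 2 \<longrightarrow>
    norm y \<le> real n powr - a / 2 \<longrightarrow>
    x \<notin> contour_trace (\<Gamma> n) \<and> y \<notin> contour_trace (\<Gamma> n) \<and>
    norm (R n x - R n y) \<le> M * (1 + real n powr (3 / 2 * a + d - c)) * norm (x - y)"
    by (rule Cauchy_transform_difference[where \<Delta> = \<Delta> and FR = FR and X = X and \<Gamma>r = \<Gamma>r and \<Gamma>inf = \<Gamma>inf
          and b = b and \<alpha> = \<alpha> and \<beta> = \<beta> and \<kappa> = \<kappa> and r = r]) fact+
  then obtain MR where MR: "0 \<le> MR" "\<forall>\<^sub>F n in sequentially. \<forall>x y. norm x \<le> real n powr - a / 2 \<longrightarrow>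
    norm y \<le> real n powr - a / 2 \<longrightarrow>
    x \<notin> contour_trace (\<Gamma> n) \<and> y \<notin> contour_trace (\<Gamma> n) \<and>
    norm (R n x - R n y) \<le> MR * (1 + real n powr (3 / 2 * a + d - c)) * norm (x - y)" by blast
  define T where "T = (\<lambda>n z. conj_by (E n 0) (pi_product (F_fun b E C n) (K_max a b c e) z))"
  have "\<exists>M\<ge>0. \<forall>\<^sub>F n in sequentially. invertible (E n 0) \<and>
    norm (E n 0) \<le> M * real n powr (d / 2) \<and> norm (matrix_inv (E n 0)) \<le> M * real n powr (d / 2) \<and>
    (\<forall>z\<in>cball 0 (real n powr - e / 2). invertible (E n z) \<and>
      norm (matrix_inv (E n 0) ** E n z) \<le> M \<and> norm (matrix_inv (E n z) ** E n 0) \<le> M \<and>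
      norm (T n z - mat 1) \<le> 1 / 2) \<and>
    (\<forall>x\<in>cball 0 (real n powr - e / 2). \<forall>y\<in>cball 0 (real n powr - e / 2).
      norm (matrix_inv (E n y) ** E n x - mat 1) \<le> M * real n powr e * norm (x - y) \<and>
      norm (T n x - T n y) \<le> M * real n powr e * norm (x - y))"
    unfolding T_def by (rule prefactor_estimates[where r = r and p = p and a = a]) fact+
  then obtain ME where ME: "0 \<le> ME" "\<forall>\<^sub>F n in sequentially. invertible (E n 0) \<and>
    norm (E n 0) \<le> ME * real n powr (d / 2) \<and> norm (matrix_inv (E n 0)) \<le> ME * real n powr (d / 2) \<and>
    (\<forall>z\<in>cball 0 (real n powr - e / 2). invertible (E n z) \<and>
      norm (matrix_inv (E n 0) ** E n z) \<le> ME \<and> norm (matrix_inv (E n z) ** E n 0) \<le> ME \<and>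
      norm (T n z - mat 1) \<le> 1 / 2) \<and>
    (\<forall>x\<in>cball 0 (real n powr - e / 2). \<forall>y\<in>cball 0 (real n powr - e / 2).
      norm (matrix_inv (E n y) ** E n x - mat 1) \<le> ME * real n powr e * norm (x - y) \<and>
      norm (T n x - T n y) \<le> ME * real n powr e * norm (x - y))" by blast
  obtain B where B: "\<And>x. x \<in> Q \<Longrightarrow> norm x \<le> B"
    using compact_imp_bounded[OF Q] by (auto simp: bounded_iff)
  define sc where "sc = (\<lambda>n (x::complex). x / of_real (\<cc> * real n powr b))"
  \<comment> \<open>Rescaled points have size at most B / \<cc> times n^(-b). As e < b, this is
    eventually below n^(-e) / 2, so they lie in the half disc where the prefactor is
    controlled.\<close>
  have "(\<lambda>n. B / \<cc> * real n powr (e - b)) \<longlonglongrightarrow> B / \<cc> * 0"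
    using a by (intro tendsto_intros) real_asymp
  then have small_points: "\<forall>\<^sub>F n in sequentially. B / \<cc> * real n powr (e - b) < 1 / 2"
    by (rule order_tendstoD) simp
  have R_near: "\<forall>\<^sub>F n in sequentially. \<forall>z. z \<notin> contour_trace (\<Gamma> n) \<longrightarrow> norm (R n z - mat 1) < 1 / 2"
    by (rule R_to_I) simp
  define V where "V = (\<lambda>n x y. matrix_inv (E0 a b c e E C n (sc n y)) ** matrix_inv (R n (sc n y)) **
    R n (sc n x) ** E0 a b c e E C n (sc n x) - mat 1)"
  define one where "one = norm (mat 1 :: complex^'m^'m)"
  \<comment> \<open>\<open>c1\<close> gathers the coefficients of n^e, from \<open>E\<close> and
    \<open>T\<close>, and \<open>c2\<close> that of n^d (1 + n^(3a/2+d-c)), from \<open>R\<close>.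
    In \<open>M\<close> the 2 comes from \<open>nd\<close> and the division by \<cc> from the
    rescaling.\<close>
  define c1 where "c1 = ME + ME * (2 * one) * ME * ME"
  define c2 where "c2 = ME * (2 * one) * ME * (2 * one) * MR * ME * (one + 1) * ME"
  define M where "M = (c1 + 2 * c2) / \<cc>"
  have one0: "0 \<le> one" by (simp add: one_def)
  have c0: "0 \<le> c1" "0 \<le> c2" using ME(1) MR(1) one0 by (simp_all add: c1_def c2_def)
  have M0: "0 \<le> M" using c0 \<open>0 < \<cc>\<close> by (simp add: M_def)
  have V_bound: "\<forall>\<^sub>F n in sequentially. 1 \<le> n \<and>
    (\<forall>x\<in>Q. \<forall>y\<in>Q. norm (V n x y) \<le> M * (real n powr (d - b) + real n powr (e - b)) * norm (x - y))"
    using MR(2) ME(2) small_points R_near eventually_ge_at_top[of 1]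
  proof eventually_elim
    case (elim n)
    have n: "1 \<le> n" "1 \<le> real n" using elim by auto
    let ?N = "real n powr (3 / 2 * a + d - c)"
    \<comment> \<open>The alternatives of the minimum decide which power takes the error: c \<ge>
      3a/2 + d bounds n^(3a/2+2d-c) by n^d, and c \<ge> 3a/2 + 2d - e bounds it by n^e.\<close>
    have nd: "real n powr d * (1 + ?N) \<le> 2 * (real n powr d + real n powr e)"
    proof -
      have "real n powr d * ?N = real n powr (3 / 2 * a + 2 * d - c)"
        by (simp add: powr_add[symmetric] algebra_simps)
      also have "\<dots> \<le> real n powr d + real n powr e"
      proof (cases "3 / 2 * a + d \<le> c")
        case True
        then have "real n powr (3 / 2 * a + 2 * d - c) \<le> real n powr d" using n by (intro powr_mono) auto
        then show ?thesis by (simp add: add_increasing2)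
      next
        case False
        then have "real n powr (3 / 2 * a + 2 * d - c) \<le> real n powr e"
          using n c_ge by (intro powr_mono) (auto simp: min_le_iff_disj)
        then show ?thesis by (simp add: add_increasing)
      qed
      finally have "real n powr d * ?N \<le> real n powr d + real n powr e" .
      moreover have "0 \<le> real n powr e" by simp
      ultimately show ?thesis unfolding distrib_left mult_1_right by linarith
    qed
    have "norm (V n x y) \<le> M * (real n powr (d - b) + real n powr (e - b)) * norm (x - y)"
      if x: "x \<in> Q" and y: "y \<in> Q" for x y
    proof -
      define \<delta> where "\<delta> = norm (sc n x - sc n y)"
      have in_disc: "norm (sc n z) \<le> real n powr - e / 2" if "z \<in> Q" for z
      proof -
        have "norm (sc n z) = norm z / \<cc> * real n powr (- b)"
          using \<open>0 < \<cc>\<close> by (simp add: sc_def norm_divide norm_mult powr_minus_divide)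
        also have "\<dots> \<le> B / \<cc> * real n powr (- b)"
          using B[OF that] \<open>0 < \<cc>\<close> by (intro mult_right_mono divide_right_mono) auto
        also have "\<dots> = (B / \<cc> * real n powr (e - b)) * real n powr - e"
          using powr_add[of "real n" "e - b" "- e"] by simp
        also have "\<dots> \<le> 1 / 2 * real n powr - e"
          using elim(3) by (intro mult_right_mono) auto
        finally show ?thesis by simp
      qed
      have "real n powr - e \<le> real n powr - a" using n a by (intro powr_mono) auto
      then have "norm (sc n x) \<le> real n powr - a / 2" "norm (sc n y) \<le> real n powr - a / 2"
        using in_disc[OF x] in_disc[OF y] by auto
      then have Rxy: "norm (R n (sc n x) - R n (sc n y)) \<le> MR * (1 + ?N) * \<delta>"
          and "sc n y \<notin> contour_trace (\<Gamma> n)"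
        using elim(1) unfolding \<delta>_def by blast+
      \<comment> \<open>Closeness of \<open>R\<close> to the identity holds off the contour only, so
        the point must first be known to avoid it.\<close>
      then have Ry: "norm (R n (sc n y) - mat 1) \<le> 1 / 2" using elim(4) by fastforce
      have xy: "sc n x \<in> cball 0 (real n powr - e / 2)" "sc n y \<in> cball 0 (real n powr - e / 2)"
        using in_disc[OF x] in_disc[OF y] by auto
      have E0: "E0 a b c e E C n z = E n 0 ** T n z ** matrix_inv (E n 0) ** E n z" for z
        using elim(2) by (simp add: E0_def T_def conj_by_inverse)
      have "norm (V n x y) \<le> ME * real n powr e * \<delta> + ME * (2 * one) * (ME * real n powr e * \<delta>) * ME
          + ME * (2 * one) * (ME * real n powr (d / 2)) * (2 * one) * (MR * (1 + ?N) * \<delta>)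
            * (ME * real n powr (d / 2)) * (one + 1) * ME"
        unfolding V_def E0 one_def
        by (rule conjugated_quotient_bound) (use elim(2) xy Ry Rxy in \<open>auto simp: \<delta>_def\<close>)
      also have "\<dots> = (c1 * real n powr e + c2 * ((real n powr (d / 2) * real n powr (d / 2)) * (1 + ?N))) * \<delta>"
        by (simp add: c1_def c2_def algebra_simps)
      also have "real n powr (d / 2) * real n powr (d / 2) = real n powr d"
        by (simp add: powr_add[symmetric])
      also have "(c1 * real n powr e + c2 * (real n powr d * (1 + ?N))) * \<delta>
          \<le> (c1 * (real n powr d + real n powr e) + c2 * (2 * (real n powr d + real n powr e))) * \<delta>"
        using c0 by (intro mult_right_mono add_mono mult_left_mono nd) (auto simp: \<delta>_def)
      also have "\<dots> = (c1 + 2 * c2) * (real n powr d + real n powr e) * \<delta>"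
        by (simp add: algebra_simps)
      also have "\<delta> = real n powr (- b) / \<cc> * norm (x - y)"
        using \<open>0 < \<cc>\<close> by (simp add: \<delta>_def sc_def diff_divide_distrib[symmetric] norm_divide norm_mult powr_minus_divide)
      also have "(c1 + 2 * c2) * (real n powr d + real n powr e) * (real n powr (- b) / \<cc> * norm (x - y))
          = M * (real n powr d * real n powr (- b) + real n powr e * real n powr (- b)) * norm (x - y)"
        by (simp add: M_def algebra_simps add_divide_distrib)
      finally show ?thesis by (simp add: powr_add[symmetric])
    qed
    then show ?case using n by blast
  qed
  \<comment> \<open>The whole error is given to the term with the larger exponent, since a sum of
    two powers of n is at most twice the larger one; the other term is 0. This explains the constant
    \<open>2 * M\<close>.\<close>
  define AA where "AA = (\<lambda>n (x, y). if e \<le> d then V n x y else 0)"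
  define BB where "BB = (\<lambda>n (x, y). if e \<le> d then 0 else V n x y)"
  have "unif_bigo (\<lambda>n. Q \<times> Q) AA (\<lambda>n (x, y). of_real (real n powr (d - b)) * (x - y))"
    unfolding unif_bigo_def
  proof (rule exI[of _ "2 * M"], use V_bound in eventually_elim, clarify)
    fix n x y assume V: "1 \<le> n" "\<forall>x\<in>Q. \<forall>y\<in>Q.
      norm (V n x y) \<le> M * (real n powr (d - b) + real n powr (e - b)) * norm (x - y)" and xy: "x \<in> Q" "y \<in> Q"
    show "norm (AA n (x, y)) \<le> 2 * M * norm (of_real (real n powr (d - b)) * (x - y))"
    proof (cases "e \<le> d")
      case True
      then have "real n powr (e - b) \<le> real n powr (d - b)" using V(1) by (intro powr_mono) auto
      then have "M * (real n powr (d - b) + real n powr (e - b)) * norm (x - y)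
          \<le> M * (real n powr (d - b) + real n powr (d - b)) * norm (x - y)"
        using M0 by (intro mult_right_mono mult_left_mono add_left_mono) auto
      with V(2) xy True show ?thesis by (force simp: AA_def norm_mult)
    qed (use M0 in \<open>simp add: AA_def\<close>)
  qed
  moreover have "unif_bigo (\<lambda>n. Q \<times> Q) BB (\<lambda>n (x, y). of_real (real n powr (e - b)) * (x - y))"
    unfolding unif_bigo_def
  proof (rule exI[of _ "2 * M"], use V_bound in eventually_elim, clarify)
    fix n x y assume V: "1 \<le> n" "\<forall>x\<in>Q. \<forall>y\<in>Q.
      norm (V n x y) \<le> M * (real n powr (d - b) + real n powr (e - b)) * norm (x - y)" and xy: "x \<in> Q" "y \<in> Q"
    show "norm (BB n (x, y)) \<le> 2 * M * norm (of_real (real n powr (e - b)) * (x - y))"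
    proof (cases "e \<le> d")
      case False
      then have "real n powr (d - b) \<le> real n powr (e - b)" using V(1) by (intro powr_mono) auto
      then have "M * (real n powr (d - b) + real n powr (e - b)) * norm (x - y)
          \<le> M * (real n powr (e - b) + real n powr (e - b)) * norm (x - y)"
        using M0 by (intro mult_right_mono mult_left_mono add_right_mono) auto
      with V(2) xy False show ?thesis by (force simp: BB_def norm_mult)
    qed (use M0 in \<open>simp add: BB_def\<close>)
  qed
  moreover have "\<forall>\<^sub>F n in sequentially. \<forall>x\<in>Q. \<forall>y\<in>Q.
    (let xn = x / of_real (\<cc> * real n powr b); yn = y / of_real (\<cc> * real n powr b) in
      matrix_inv (E0 a b c e E C n yn) ** matrix_inv (R n yn) ** R n xn ** E0 a b c e E C n xn
      = mat 1 + AA n (x, y) + BB n (x, y))"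
    by (intro always_eventually) (simp add: AA_def BB_def V_def sc_def Let_def)
  ultimately show "\<exists>A B.
    unif_bigo (\<lambda>n. Q \<times> Q) A (\<lambda>n (x, y). of_real (real n powr (d - b)) * (x - y)) \<and>
    unif_bigo (\<lambda>n. Q \<times> Q) B (\<lambda>n (x, y). of_real (real n powr (e - b)) * (x - y)) \<and>
    (\<forall>\<^sub>F n in sequentially. \<forall>x\<in>Q. \<forall>y\<in>Q.
      (let xn = x / of_real (\<cc> * real n powr b); yn = y / of_real (\<cc> * real n powr b) in
        matrix_inv (E0 a b c e E C n yn) ** matrix_inv (R n yn) ** R n xn ** E0 a b c e E C n xn
        = mat 1 + A n (x, y) + B n (x, y)))" by blast
qed

end
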